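(* Let $f\colon X\to Y$ be a map between cubical Kan complexes. Then $f$ is a homotopy equivalence if and only if $\pi_0f\colon\pi_0X\to\pi_0Y$ is a bijection and, for all $x\colon\square^0\to X$ and all $n\ge1$, the map $\pi_nf\colon\pi_n(X,x)\to\pi_n(Y,f(x))$ is an isomorphism.
   Context: Cubes: $\square$ is the category whose objects are the posets $[1]^n=\{0\le 1\}^n$, $n\ge 0$, with morphisms generated under composition (inside posets) by the faces $\partial_{i,\varepsilon}\colon [1]^{n-1}\to[1]^n$ inserting $\varepsilon\in\{0,1\}$ as $i$-th coordinate, the degeneracies $\sigma_i\colon[1]^n\to[1]^{n-1}$ deleting the $i$-th coordinate, and the connections $\gamma_{i,0},\gamma_{i,1}\colon[1]^n\to[1]^{n-1}$ ($1\le i\le n-1$) replacing $x_i,x_{i+1}$ by their maximum, resp. minimum. A cubical set is a functor $\square^{op}\to\mathsf{Set}$; operators act on the right. $\square^n$ is the representable at $[1]^n$. The open box $\sqcap^n_{i,\varepsilon}\subseteq\square^n$ is the union of the images of all faces $\partial_{j,\eta}$ with $(j,\eta)\ne(i,\varepsilon)$. The geometric product $\otimes$ is the left Kan extension of $[1]^m\otimes[1]^n=[1]^{m+n}$, and $\hom_R(X,-)$ is the right adjoint of $X\otimes -$. A Kan complex is a cubical set $X$ such that every map $\sqcap^n_{i,\varepsilon}\to X$ extends to $\square^n\to X$. Homotopies: an elementary homotopy from $f$ to $g\colon X\to Y$ is a map $H\colon X\otimes\square^1\to Y$ restricting to $f$ and $g$ at the $\partial_{1,0}$- and $\partial_{1,1}$-ends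 of $\square^1$; a homotopy is a zig-zag of elementary homotopies (if $Y$ is Kan, elementary homotopy is already an equivalence relation). A map $f\colon X\to Y$ is a homotopy equivalence if there is $g\colon Y\to X$ with homotopies $gf\sim\mathrm{id}_X$ and $fg\sim\mathrm{id}_Y$. Cubical homotopy groups of a pointed Kan complex $(X,x)$: $\Omega(X,x)$ is the pullback of $(x,x)\colon\square^0\to X\times X$ along $(\partial_{1,0}^*,\partial_{1,1}^* )\colon\hom_R(\square^1,X)\to X\times X$, pointed at $x\sigma_1$ (so a $k$-cube of $\Omega(X,x)$ is a $(k+1)$-cube of $X$ whose $\partial_{1,0}$- and $\partial_{1,1}$-faces are degenerate at $x$); $\Omega^0(X,x)=(X,x)$ and $\Omega^n(X,x)=\Omega(\Omega^{n-1}(X,x))$. $\pi_0(X)$ is the colimit of $X\colon\square^{op}\to\mathsf{Set}$ (so $\pi_0(\varnothing)=\varnothing$) and $\pi_n(X,x)=\pi_0(\Omega^n(X,x))$. Group structure on $\pi_1(X,x)$: for $1$-cubes $f,g$ with both end-points $x$, $[f][g]=[s\partial_{2,0}]$ for any $2$-cube $s$ with $s\partial_{1,0}=f$, $s\partial_{2,1}=g$, $s\partial_{1,1}=x\sigma_1$; for $n\ge1$, $\pi_n(X,x)=\pi_1(\Omega^{n-1}(X,x))$ carries the resulting group structure. *)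

theory Defs
  imports "HOL-Algebra.Group"
begin

section \<open>The box category\<close>

text \<open>The vertices of the poset \<open>[1]^n\<close> are the boolean lists of length \<open>n\<close>, with \<open>False\<close>, \<open>True\<close>
  for \<open>0\<close>, \<open>1\<close>. Coordinates are counted from \<open>1\<close>. Morphisms are extensional functions (they are
  \<open>undefined\<close> outside their domain), so that equality of morphisms with given domain and codomain is
  equality of functions; all operators are indexed by the dimension of their larger cube.\<close>

definition vertices :: "nat \<Rightarrow> bool list set" where
  "vertices n = {v. length v = n}"

definition box_id :: "nat \<Rightarrow> bool list \<Rightarrow> bool list" where
  "box_id n = (\<lambda>v\<in>vertices n. v)"

definition face :: "nat \<Rightarrow> nat \<Rightarrow> bool \<Rightarrow> bool list \<Rightarrow> bool list" where
  "face n i \<epsilon> = (\<lambda>v\<in>vertices (n - 1). take (i - 1) v @ \<epsilon> # drop (i - 1) v)"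

definition degen :: "nat \<Rightarrow> nat \<Rightarrow> bool list \<Rightarrow> bool list" where
  "degen n i = (\<lambda>v\<in>vertices n. take (i - 1) v @ drop i v)"

definition conn :: "nat \<Rightarrow> nat \<Rightarrow> bool \<Rightarrow> bool list \<Rightarrow> bool list" where
  "conn n i \<epsilon> = (\<lambda>v\<in>vertices n. take (i - 1) v @
     (if \<epsilon> then min (v ! (i - 1)) (v ! i) else max (v ! (i - 1)) (v ! i)) # drop (i + 1) v)"

inductive box_map :: "nat \<Rightarrow> nat \<Rightarrow> (bool list \<Rightarrow> bool list) \<Rightarrow> bool" where
  ident: "box_map n n (box_id n)"
| face: "1 \<le> i \<Longrightarrow> i \<le> n \<Longrightarrow> box_map (n - 1) n (face n i \<epsilon>)"
| degen: "1 \<le> i \<Longrightarrow> i \<le> n \<Longrightarrow> box_map n (n - 1) (degen n i)"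
| conn: "1 \<le> i \<Longrightarrow> i \<le> n - 1 \<Longrightarrow> box_map n (n - 1) (conn n i \<epsilon>)"
| comp: "box_map l m \<psi> \<Longrightarrow> box_map m n \<phi> \<Longrightarrow> box_map l n (compose (vertices l) \<phi> \<psi>)"

text \<open>The monoidal structure on morphisms: for \<open>\<alpha>\<close> with domain \<open>[1]^p\<close> and \<open>\<beta>\<close> with domain
  \<open>[1]^q\<close>, the morphism \<open>\<alpha> \<otimes> \<beta>\<close> with domain \<open>[1]^(p+q)\<close>.\<close>

definition box_tensor ::
    "nat \<Rightarrow> nat \<Rightarrow> (bool list \<Rightarrow> bool list) \<Rightarrow> (bool list \<Rightarrow> bool list) \<Rightarrow> bool list \<Rightarrow> bool list" where
  "box_tensor p q \<alpha> \<beta> = (\<lambda>v\<in>vertices (p + q). \<alpha> (take p v) @ \<beta> (drop p v))"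

section \<open>Cubical sets\<close>

text \<open>For a cube \<open>x \<in> cubes X n\<close> and a morphism \<open>\<phi>\<close> from \<open>[1]^m\<close> to \<open>[1]^n\<close>, the term
  \<open>act X m n \<phi> x\<close> is the \<open>m\<close>-cube \<open>x\<phi>\<close>. Values of \<open>act\<close>, and of the maps below, outside
  the sets of cubes carry no information.\<close>

record 'a cubical =
  cubes :: "nat \<Rightarrow> 'a set"
  act :: "nat \<Rightarrow> nat \<Rightarrow> (bool list \<Rightarrow> bool list) \<Rightarrow> 'a \<Rightarrow> 'a"

definition cubical_set :: "'a cubical \<Rightarrow> bool" where
  "cubical_set X \<longleftrightarrow>
     (\<forall>m n \<phi>. box_map m n \<phi> \<longrightarrow> act X m n \<phi> \<in> cubes X n \<rightarrow> cubes X m) \<and>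
     (\<forall>n. \<forall>x\<in>cubes X n. act X n n (box_id n) x = x) \<and>
     (\<forall>l m n \<psi> \<phi>. box_map l m \<psi> \<longrightarrow> box_map m n \<phi> \<longrightarrow>
        (\<forall>x\<in>cubes X n. act X l n (compose (vertices l) \<phi> \<psi>) x = act X l m \<psi> (act X m n \<phi> x)))"

definition cubical_map :: "'a cubical \<Rightarrow> 'b cubical \<Rightarrow> (nat \<Rightarrow> 'a \<Rightarrow> 'b) \<Rightarrow> bool" where
  "cubical_map X Y f \<longleftrightarrow>
     (\<forall>n. f n \<in> cubes X n \<rightarrow> cubes Y n) \<and>
     (\<forall>m n \<phi>. box_map m n \<phi> \<longrightarrow>
        (\<forall>x\<in>cubes X n. f m (act X m n \<phi> x) = act Y m n \<phi> (f n x)))"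

definition std_cube :: "nat \<Rightarrow> (bool list \<Rightarrow> bool list) cubical" where
  "std_cube n = \<lparr>cubes = (\<lambda>k. {\<phi>. box_map k n \<phi>}),
                 act = (\<lambda>l k \<psi> \<phi>. compose (vertices l) \<phi> \<psi>)\<rparr>"

definition open_box :: "nat \<Rightarrow> nat \<Rightarrow> bool \<Rightarrow> (bool list \<Rightarrow> bool list) cubical" where
  "open_box n i \<epsilon> = (std_cube n)
     \<lparr>cubes := (\<lambda>k. {compose (vertices k) (face n j \<eta>) \<psi> | j \<eta> \<psi>.
                      1 \<le> j \<and> j \<le> n \<and> (j, \<eta>) \<noteq> (i, \<epsilon>) \<and> box_map k (n - 1) \<psi>})\<rparr>"

definition kan_complex :: "'a cubical \<Rightarrow> bool" where
  "kan_complex X \<longleftrightarrow> cubical_set X \<and>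
     (\<forall>n i \<epsilon> u. 1 \<le> i \<and> i \<le> n \<and> cubical_map (open_box n i \<epsilon>) X u \<longrightarrow>
        (\<exists>v. cubical_map (std_cube n) X v \<and> (\<forall>k. \<forall>\<phi>\<in>cubes (open_box n i \<epsilon>) k. v k \<phi> = u k \<phi>)))"

section \<open>The geometric product\<close>

definition gen_equiv :: "'a set \<Rightarrow> ('a \<times> 'a) set \<Rightarrow> ('a \<times> 'a) set" where
  "gen_equiv A R = (R \<union> R\<inverse>)\<^sup>* \<inter> A \<times> A"

text \<open>The left Kan extension is computed by the coend formula: an \<open>n\<close>-cube of \<open>X \<otimes> Y\<close> is
  represented by \<open>(p, q, x, y, \<phi>)\<close> where \<open>x\<close> is a \<open>p\<close>-cube of \<open>X\<close>, \<open>y\<close> is a \<open>q\<close>-cube of \<open>Y\<close> and \<open>\<phi>\<close> is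
  a morphism from \<open>[1]^n\<close> to \<open>[1]^(p+q)\<close>; representatives are identified along
  \<open>(p, q, x\<alpha>, y\<beta>, \<phi>) \<sim> (p', q', x, y, (\<alpha> \<otimes> \<beta>)\<phi>)\<close>.\<close>

type_synonym ('a, 'b) geom_rep = "nat \<times> nat \<times> 'a \<times> 'b \<times> (bool list \<Rightarrow> bool list)"

definition geom_reps :: "'a cubical \<Rightarrow> 'b cubical \<Rightarrow> nat \<Rightarrow> ('a, 'b) geom_rep set" where
  "geom_reps X Y n =
     {(p, q, x, y, \<phi>). x \<in> cubes X p \<and> y \<in> cubes Y q \<and> box_map n (p + q) \<phi>}"

definition geom_rel ::
    "'a cubical \<Rightarrow> 'b cubical \<Rightarrow> nat \<Rightarrow> (('a, 'b) geom_rep \<times> ('a, 'b) geom_rep) set" where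
  "geom_rel X Y n = gen_equiv (geom_reps X Y n)
     {((p, q, act X p p' \<alpha> x, act Y q q' \<beta> y, \<phi>),
       (p', q', x, y, compose (vertices n) (box_tensor p q \<alpha> \<beta>) \<phi>)) | p q p' q' \<alpha> \<beta> x y \<phi>.
       box_map p p' \<alpha> \<and> box_map q q' \<beta> \<and> x \<in> cubes X p' \<and> y \<in> cubes Y q' \<and> box_map n (p + q) \<phi>}"

definition geom_prod :: "'a cubical \<Rightarrow> 'b cubical \<Rightarrow> ('a, 'b) geom_rep set cubical" where
  "geom_prod X Y =
     \<lparr>cubes = (\<lambda>n. geom_reps X Y n // geom_rel X Y n),
      act = (\<lambda>m n \<psi> C. geom_rel X Y m ``
               ((\<lambda>(p, q, x, y, \<phi>). (p, q, x, y, compose (vertices m) \<phi> \<psi>)) ` C))\<rparr>"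

section \<open>Homotopies\<close>

text \<open>The inclusion of \<open>X \<cong> X \<otimes> \<box>^0\<close> into \<open>X \<otimes> \<box>^1\<close> at the \<open>\<partial>\<^sub>1\<^sub>,\<^sub>\<epsilon>\<close>-end.\<close>

definition end_incl :: "'a cubical \<Rightarrow> bool \<Rightarrow> nat \<Rightarrow> 'a \<Rightarrow> ('a, bool list \<Rightarrow> bool list) geom_rep set" where
  "end_incl X \<epsilon> n x = geom_rel X (std_cube 1) n `` {(n, 0, x, face 1 1 \<epsilon>, box_id n)}"

definition elementary_homotopic ::
    "'a cubical \<Rightarrow> 'b cubical \<Rightarrow> (nat \<Rightarrow> 'a \<Rightarrow> 'b) \<Rightarrow> (nat \<Rightarrow> 'a \<Rightarrow> 'b) \<Rightarrow> bool" where
  "elementary_homotopic X Y f g \<longleftrightarrow> cubical_map X Y f \<and> cubical_map X Y g \<and>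
     (\<exists>H. cubical_map (geom_prod X (std_cube 1)) Y H \<and>
        (\<forall>n. \<forall>x\<in>cubes X n. H n (end_incl X False n x) = f n x \<and> H n (end_incl X True n x) = g n x))"

definition homotopic ::
    "'a cubical \<Rightarrow> 'b cubical \<Rightarrow> (nat \<Rightarrow> 'a \<Rightarrow> 'b) \<Rightarrow> (nat \<Rightarrow> 'a \<Rightarrow> 'b) \<Rightarrow> bool" where
  "homotopic X Y = equivclp (elementary_homotopic X Y)"

definition homotopy_equivalence :: "'a cubical \<Rightarrow> 'b cubical \<Rightarrow> (nat \<Rightarrow> 'a \<Rightarrow> 'b) \<Rightarrow> bool" where
  "homotopy_equivalence X Y f \<longleftrightarrow> cubical_map X Y f \<and>
     (\<exists>g. cubical_map Y X g \<and>
        homotopic X X (\<lambda>n. g n \<circ> f n) (\<lambda>n. id) \<and> homotopic Y Y (\<lambda>n. f n \<circ> g n) (\<lambda>n. id))"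

section \<open>Loop objects\<close>

text \<open>The cubical set \<open>hom_R (\<box>^1, X)\<close>: its \<open>k\<close>-cubes are the maps from \<open>\<box>^1 \<otimes> \<box>^k = \<box>^(1+k)\<close> to \<open>X\<close>,
  i.e. the \<open>(1+k)\<close>-cubes of \<open>X\<close>. Using this form keeps the type of cubes fixed, so that the
  loop object can be iterated.\<close>

definition path_object :: "'a cubical \<Rightarrow> 'a cubical" where
  "path_object X = \<lparr>cubes = (\<lambda>k. cubes X (1 + k)),
     act = (\<lambda>m n \<phi>. act X (1 + m) (1 + n) (box_tensor 1 m (box_id 1) \<phi>))\<rparr>"

definition path_end :: "'a cubical \<Rightarrow> bool \<Rightarrow> nat \<Rightarrow> 'a \<Rightarrow> 'a" where
  "path_end X \<epsilon> k = act X k (1 + k) (face (1 + k) 1 \<epsilon>)"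

text \<open>The \<open>k\<close>-cube degenerate at the \<open>0\<close>-cube \<open>x\<close>; \<open>\<lambda>v\<in>vertices k. []\<close> is the unique morphism
  from \<open>[1]^k\<close> to \<open>[1]^0\<close>.\<close>

definition const_cube :: "'a cubical \<Rightarrow> 'a \<Rightarrow> nat \<Rightarrow> 'a" where
  "const_cube X x k = act X k 0 (\<lambda>v\<in>vertices k. []) x"

definition loop_object :: "'a cubical \<times> 'a \<Rightarrow> 'a cubical \<times> 'a" where
  "loop_object = (\<lambda>(X, x).
     ((path_object X)\<lparr>cubes := (\<lambda>k. {p \<in> cubes (path_object X) k.
          path_end X False k p = const_cube X x k \<and> path_end X True k p = const_cube X x k})\<rparr>,
      act X 1 0 (degen 1 1) x))"

definition loop_map :: "(nat \<Rightarrow> 'a \<Rightarrow> 'b) \<Rightarrow> nat \<Rightarrow> 'a \<Rightarrow> 'b" where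
  "loop_map f k = f (1 + k)"

section \<open>Homotopy groups\<close>

text \<open>The colimit of the functor \<open>X\<close>, as a quotient of the disjoint union of the sets of cubes.\<close>

definition pi0_rel :: "'a cubical \<Rightarrow> ((nat \<times> 'a) \<times> (nat \<times> 'a)) set" where
  "pi0_rel X = gen_equiv (SIGMA n:UNIV. cubes X n)
     {((m, act X m n \<phi> x), (n, x)) | m n \<phi> x. box_map m n \<phi> \<and> x \<in> cubes X n}"

definition pi0 :: "'a cubical \<Rightarrow> (nat \<times> 'a) set set" where
  "pi0 X = (SIGMA n:UNIV. cubes X n) // pi0_rel X"

definition pi0_class :: "'a cubical \<Rightarrow> nat \<Rightarrow> 'a \<Rightarrow> (nat \<times> 'a) set" where
  "pi0_class X n x = pi0_rel X `` {(n, x)}"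

definition pi0_map :: "'b cubical \<Rightarrow> (nat \<Rightarrow> 'a \<Rightarrow> 'b) \<Rightarrow> (nat \<times> 'a) set \<Rightarrow> (nat \<times> 'b) set" where
  "pi0_map Y f C = pi0_rel Y `` ((\<lambda>(n, x). (n, f n x)) ` C)"

text \<open>The product of two elements of \<open>\<pi>\<^sub>1(X, x)\<close>; the description is well defined if \<open>X\<close> is Kan.\<close>

definition pi1_mult :: "'a cubical \<times> 'a \<Rightarrow> (nat \<times> 'a) set \<Rightarrow> (nat \<times> 'a) set \<Rightarrow> (nat \<times> 'a) set" where
  "pi1_mult = (\<lambda>(X, x) A B. let L = fst (loop_object (X, x)) in
     THE C. \<exists>s\<in>cubes X 2.
       act X 1 2 (face 2 1 False) s \<in> cubes L 0 \<and> A = pi0_class L 0 (act X 1 2 (face 2 1 False) s) \<and>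
       act X 1 2 (face 2 2 True) s \<in> cubes L 0 \<and> B = pi0_class L 0 (act X 1 2 (face 2 2 True) s) \<and>
       act X 1 2 (face 2 1 True) s = act X 1 0 (degen 1 1) x \<and>
       C = pi0_class L 0 (act X 1 2 (face 2 2 False) s))"

definition pi_set :: "nat \<Rightarrow> 'a cubical \<times> 'a \<Rightarrow> (nat \<times> 'a) set set" where
  "pi_set n P = pi0 (fst ((loop_object ^^ n) P))"

text \<open>For \<open>n \<ge> 1\<close>, the group structure of \<open>\<pi>\<^sub>n(P) = \<pi>\<^sub>1(\<Omega>^(n-1) P)\<close>.\<close>

definition pi_group :: "nat \<Rightarrow> 'a cubical \<times> 'a \<Rightarrow> (nat \<times> 'a) set monoid" where
  "pi_group n P = \<lparr>carrier = pi_set n P,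
     mult = pi1_mult ((loop_object ^^ (n - 1)) P),
     one = (case (loop_object ^^ n) P of (L, l) \<Rightarrow> pi0_class L 0 l)\<rparr>"

definition pi_map ::
    "nat \<Rightarrow> 'b cubical \<times> 'b \<Rightarrow> (nat \<Rightarrow> 'a \<Rightarrow> 'b) \<Rightarrow> (nat \<times> 'a) set \<Rightarrow> (nat \<times> 'b) set" where
  "pi_map n Q f = pi0_map (fst ((loop_object ^^ n) Q)) ((loop_map ^^ n) f)"

end

theory Submission
  imports Defs
begin

text \<open>Call \<open>f\<close> a weak equivalence if every \<open>n\<close>-cube \<open>w\<close> of \<open>Y\<close> whose boundary is the image of a
  boundary \<open>u\<close> in \<open>X\<close> is homotopic, relative to its boundary, to \<open>f v\<close> for some filler \<open>v\<close> of \<open>u\<close>.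
  This property is invariant under homotopy and has enough cancellation to hold for every homotopy
  equivalence. Boundaries that are constant at a point show that it implies bijectivity on
  homotopy groups. Conversely, solvability only depends on \<open>u\<close> up to homotopy, and every boundary
  deforms to one that is constant except on one face; there injectivity on \<open>\<pi>\<^bsub>n-1\<^esub>\<close> makes the last
  face constant too, and surjectivity on \<open>\<pi>\<^sub>n\<close> finishes. Finally, if \<open>f\<close> is a weak
  equivalence then its mapping path object projects to \<open>Y\<close> by a trivial fibration. A section of this is built by
  induction on dimension, as degenerate cubes have essentially unique presentations; it is a map \<open>g\<close> with a
  homotopy from \<open>f g\<close> to the identity. Since \<open>g\<close> is again a weak equivalence, it is a two-sided
  homotopy inverse.\<close>

section \<open>The box category\<close>

text \<open>The obstacle is that a map defined on Y cube by cube must commute with connections as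
  well as with degeneracies, so that one degenerate cube can be presented by several operators. No
  normal form of presentations is established. Instead, two candidate values determine each other
  through idempotents of the box category, and a finite check on words in these idempotents forces
  them to agree. Weak equivalences are phrased with boundaries instead of base points. This covers
  empty X and avoids transport between base points. Asking for fillers up to homotopy relative to
  the boundary leaves exactly the freedom that homotopy extension in a Kan complex can absorb, and a
  cube of the mapping path object carries the prism in Y that corrects the discrepancy. Maps respect
  the multiplication of homotopy groups automatically, so being an isomorphism reduces to being a
  bijection. The inverse is two-sided because g has a homotopy right inverse f' of its own, and g f
  and g f' are both homotopic to g f g f'.\<close>

text \<open>Morphisms are handled as unrestricted functions on lists, with coordinates counted from \<open>0\<close>
  and operators indexed by the dimension of the smaller cube.\<close>

definition bm :: "nat \<Rightarrow> nat \<Rightarrow> (bool list \<Rightarrow> bool list) \<Rightarrow> bool" where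
  "bm m n \<phi> \<longleftrightarrow> box_map m n (restrict \<phi> (vertices m))"

definition fc :: "nat \<Rightarrow> bool \<Rightarrow> bool list \<Rightarrow> bool list" where
  "fc i \<epsilon> v = take i v @ \<epsilon> # drop i v"

definition dl :: "nat \<Rightarrow> bool list \<Rightarrow> bool list" where
  "dl i v = take i v @ drop (Suc i) v"

definition cf :: "nat \<Rightarrow> bool \<Rightarrow> bool list \<Rightarrow> bool list" where
  "cf i \<epsilon> v = take i v @ (if \<epsilon> then v ! i \<and> v ! Suc i else v ! i \<or> v ! Suc i) # drop (Suc (Suc i)) v"

lemma mem_vertices [simp]: "v \<in> vertices n \<longleftrightarrow> length v = n"
  by (simp add: vertices_def)

lemma bool_max_min [simp]: "max (a::bool) b = (a \<or> b)" "min (a::bool) b = (a \<and> b)"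
  by (auto simp: max_def min_def)

lemma box_map_length:
  assumes "box_map m n \<phi>" "length v = m"
  shows "length (\<phi> v) = n"
  using assms
  by (induction arbitrary: v rule: box_map.induct)
    (auto simp: box_id_def face_def degen_def conn_def compose_def)

text \<open>Each generator is \<open>undefined\<close> outside its domain, and so is each composite.
  Restricting therefore loses nothing, which allows passing between \<open>box_map\<close> and
  \<open>bm\<close>.\<close>

lemma box_map_ext: "box_map m n \<phi> \<Longrightarrow> restrict \<phi> (vertices m) = \<phi>"
proof (induction rule: box_map.induct)
  case (ident n) then show ?case by (auto simp: box_id_def restrict_def fun_eq_iff)
next
  case face then show ?case by (auto simp: face_def restrict_def fun_eq_iff)
next
  case degen then show ?case by (auto simp: degen_def restrict_def fun_eq_iff)
next
  case conn then show ?case by (auto simp: conn_def restrict_def fun_eq_iff)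
next
  case comp then show ?case by (auto simp: compose_def restrict_def fun_eq_iff)
qed

lemma box_map_bm: "box_map m n \<phi> \<Longrightarrow> bm m n \<phi>"
  by (simp add: bm_def box_map_ext)

lemma restrict_vertices_eqI:
  "(\<And>v. length v = m \<Longrightarrow> \<phi> v = \<psi> v) \<Longrightarrow> restrict \<phi> (vertices m) = restrict \<psi> (vertices m)"
  by (auto intro: restrict_ext)

lemma bm_cong: "(\<And>v. length v = m \<Longrightarrow> \<phi> v = \<psi> v) \<Longrightarrow> bm m n \<phi> \<longleftrightarrow> bm m n \<psi>"
  unfolding bm_def using restrict_vertices_eqI by metis

lemma bm_length: "bm m n \<phi> \<Longrightarrow> length v = m \<Longrightarrow> length (\<phi> v) = n"
  unfolding bm_def using box_map_length by fastforce

lemma restrict_comp: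
  "(\<And>v. length v = l \<Longrightarrow> length (\<psi> v) = m) \<Longrightarrow>
   compose (vertices l) (restrict \<phi> (vertices m)) (restrict \<psi> (vertices l)) = restrict (\<phi> \<circ> \<psi>) (vertices l)"
  by (auto simp: compose_def restrict_def fun_eq_iff)

lemma bm_comp: "bm l m \<psi> \<Longrightarrow> bm m n \<phi> \<Longrightarrow> bm l n (\<phi> \<circ> \<psi>)"
  using box_map.comp[of l m "restrict \<psi> (vertices l)" n "restrict \<phi> (vertices m)"] bm_length[of l m \<psi>]
  by (simp add: bm_def restrict_comp)

lemma bm_comp': "bm l m \<psi> \<Longrightarrow> bm m n \<phi> \<Longrightarrow> (\<And>v. length v = l \<Longrightarrow> \<rho> v = \<phi> (\<psi> v)) \<Longrightarrow> bm l n \<rho>"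
  using bm_comp[of l m \<psi> n \<phi>] bm_cong[of l \<rho> "\<phi> \<circ> \<psi>"] by auto

lemma bm_ident: "(\<And>v. length v = n \<Longrightarrow> \<phi> v = v) \<Longrightarrow> bm n n \<phi>"
  using box_map.ident[of n] restrict_vertices_eqI[of n \<phi> "\<lambda>v. v"] by (simp add: bm_def box_id_def)

lemma bm_id [simp]: "bm n n id" "bm n n (\<lambda>v. v)"
  by (simp_all add: bm_ident)

lemma face_eq: "face (Suc n) (Suc i) \<epsilon> = restrict (fc i \<epsilon>) (vertices n)"
  by (auto simp: face_def fc_def)

lemma degen_eq: "degen (Suc n) (Suc i) = restrict (dl i) (vertices (Suc n))"
  by (auto simp: degen_def dl_def)

lemma conn_eq: "conn (Suc n) (Suc i) \<epsilon> = restrict (cf i \<epsilon>) (vertices (Suc n))"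
  by (auto simp: conn_def cf_def restrict_def fun_eq_iff)

lemma bm_fc [simp]: "i \<le> n \<Longrightarrow> bm n (Suc n) (fc i \<epsilon>)"
  using box_map.face[of "Suc i" "Suc n" \<epsilon>] by (simp add: bm_def face_eq)

lemma bm_dl [simp]: "i \<le> n \<Longrightarrow> bm (Suc n) n (dl i)"
  using box_map.degen[of "Suc i" "Suc n"] by (simp add: bm_def degen_eq)

lemma bm_cf [simp]: "i < n \<Longrightarrow> bm (Suc n) n (cf i \<epsilon>)"
  using box_map.conn[of "Suc i" "Suc n" \<epsilon>] by (simp add: bm_def conn_eq)

text \<open>The case \<open>cong\<close> compensates for the unrestricted functions:
  \<open>bm\<close> sees only values on vertices of the right dimension, so every property proved by
  this rule has to be blind to other values too.\<close>

lemma bm_induct [consumes 1, case_names ident fc dl cf comp cong]: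
  assumes "bm m n \<phi>"
    and ident: "\<And>n. P n n id"
    and fc: "\<And>n i \<epsilon>. i \<le> n \<Longrightarrow> P n (Suc n) (fc i \<epsilon>)"
    and dl: "\<And>n i. i \<le> n \<Longrightarrow> P (Suc n) n (dl i)"
    and cf: "\<And>n i \<epsilon>. i < n \<Longrightarrow> P (Suc n) n (cf i \<epsilon>)"
    and comp: "\<And>l m n \<psi> \<phi>. bm l m \<psi> \<Longrightarrow> bm m n \<phi> \<Longrightarrow> P l m \<psi> \<Longrightarrow> P m n \<phi> \<Longrightarrow> P l n (\<phi> \<circ> \<psi>)"
    and cong: "\<And>m n \<phi> \<psi>. P m n \<phi> \<Longrightarrow> (\<And>v. length v = m \<Longrightarrow> \<psi> v = \<phi> v) \<Longrightarrow> P m n \<psi>"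
  shows "P m n \<phi>"
proof -
  have "P m n \<phi>" if "box_map m n \<phi>" for m n \<phi>
    using that
  proof (induction rule: box_map.induct)
    case (ident n) then show ?case by (rule cong[OF assms(2)]) (simp add: box_id_def)
  next
    case (face i n \<epsilon>)
    then obtain i' n' where "i = Suc i'" "n = Suc n'" "i' \<le> n'" by (cases i; cases n) auto
    then show ?case using cong[OF assms(3)[of i' n' \<epsilon>]] by (simp add: face_eq)
  next
    case (degen i n)
    then obtain i' n' where "i = Suc i'" "n = Suc n'" "i' \<le> n'" by (cases i; cases n) auto
    then show ?case using cong[OF assms(4)[of i' n']] by (simp add: degen_eq)
  next
    case (conn i n \<epsilon>)
    then obtain i' n' where "i = Suc i'" "n = Suc n'" "i' < n'" by (cases i; cases n) auto
    then show ?case using cong[OF assms(5)[of i' n' \<epsilon>]] by (simp add: conn_eq)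
  next
    case (comp l m \<psi> n \<phi>)
    have "P l n (\<phi> \<circ> \<psi>)" by (rule assms(6)[OF box_map_bm[OF comp(1)] box_map_bm[OF comp(2)] comp(3,4)])
    then show ?case by (rule cong) (simp add: compose_def)
  qed
  from cong[OF this[OF assms(1)[unfolded bm_def]]] show ?thesis by simp
qed

lemma length_fc [simp]: "length (fc i \<epsilon> v) = Suc (length v)"
  by (simp add: fc_def)

lemma nth_fc: "i \<le> length v \<Longrightarrow> fc i \<epsilon> v ! k = (if k < i then v ! k else if k = i then \<epsilon> else v ! (k - 1))"
  by (simp add: fc_def nth_append nth_Cons' min_def)

lemma length_dl: "i < length v \<Longrightarrow> length (dl i v) = length v - 1"
  by (auto simp: dl_def)

lemma nth_dl: "i < length v \<Longrightarrow> dl i v ! k = (if k < i then v ! k else v ! Suc k)"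
  by (auto simp: dl_def nth_append min_def)

lemma length_cf: "Suc i < length v \<Longrightarrow> length (cf i \<epsilon> v) = length v - 1"
  by (auto simp: cf_def)

lemma nth_cf: "Suc i < length v \<Longrightarrow> cf i \<epsilon> v ! k = (if k < i then v ! k else if k = i then
   (if \<epsilon> then v ! i \<and> v ! Suc i else v ! i \<or> v ! Suc i) else v ! Suc k)"
  by (simp add: cf_def nth_append nth_Cons' min_def)

lemma fc_fc: "i < j \<Longrightarrow> j \<le> Suc (length v) \<Longrightarrow> fc j \<eta> (fc i \<epsilon> v) = fc i \<epsilon> (fc (j - 1) \<eta> v)"
  by (rule nth_equalityI) (auto simp: nth_fc)

section \<open>Tensoring a morphism with an identity\<close>

definition lwhisk :: "nat \<Rightarrow> (bool list \<Rightarrow> bool list) \<Rightarrow> bool list \<Rightarrow> bool list" where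
  "lwhisk k \<phi> v = take k v @ \<phi> (drop k v)"

text \<open>The two whiskerings serve different purposes: operators on loop objects act on the last
  coordinates, hence by \<open>lwhisk\<close>, while homotopies have their parameter in the last
  coordinate, hence are natural with respect to \<open>rwhisk\<close>.\<close>

definition rwhisk :: "nat \<Rightarrow> (bool list \<Rightarrow> bool list) \<Rightarrow> bool list \<Rightarrow> bool list" where
  "rwhisk m \<phi> v = \<phi> (take m v) @ drop m v"

lemma bm_lwhisk: "bm m n \<phi> \<Longrightarrow> bm (k + m) (k + n) (lwhisk k \<phi>)"
proof (induction rule: bm_induct)
  case (ident n) show ?case by (rule bm_ident) (simp add: lwhisk_def)
next
  case (fc n i \<epsilon>)
  then have "bm (k + n) (Suc (k + n)) (fc (k + i) \<epsilon>)" by simp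
  then show ?case unfolding add_Suc_right
    by (subst bm_cong[of _ _ "fc (k + i) \<epsilon>"]) (use fc in \<open>simp_all add: lwhisk_def fc_def dl_def cf_def take_add add.commute[of i k]\<close>)
next
  case (dl n i)
  then have "bm (Suc (k + n)) (k + n) (dl (k + i))" by simp
  then show ?case unfolding add_Suc_right
    by (subst bm_cong[of _ _ "dl (k + i)"]) (use dl in \<open>simp_all add: lwhisk_def fc_def dl_def cf_def take_add add.commute[of i k]\<close>)
next
  case (cf n i \<epsilon>)
  then have "bm (Suc (k + n)) (k + n) (cf (k + i) \<epsilon>)" by simp
  then show ?case unfolding add_Suc_right
    by (subst bm_cong[of _ _ "cf (k + i) \<epsilon>"]) (use cf in \<open>simp_all add: lwhisk_def fc_def dl_def cf_def take_add add.commute[of i k]\<close>)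
next
  case (comp l m n \<psi> \<phi>)
  show ?case by (rule bm_comp'[OF comp(3,4)]) (auto simp: lwhisk_def)
next
  case (cong m n \<phi> \<psi>)
  show ?case by (rule iffD1[OF bm_cong cong(1)]) (simp add: lwhisk_def cong(2))
qed

lemma drop_take_append: "i \<le> n \<Longrightarrow> drop i (take n v) @ drop n v = drop i v"
  by (metis append_take_drop_id drop_drop drop_take le_add_diff_inverse2)

lemma bm_rwhisk: "bm m n \<phi> \<Longrightarrow> bm (m + k) (n + k) (rwhisk m \<phi>)"
proof (induction rule: bm_induct)
  case (ident n) show ?case by (rule bm_ident) (simp add: rwhisk_def)
next
  case (fc n i \<epsilon>)
  then have "bm (n + k) (Suc (n + k)) (fc i \<epsilon>)" by simp
  then show ?case using fc unfolding add_Suc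
    by (subst bm_cong[of _ _ "fc i \<epsilon>"]) (use fc in \<open>simp_all add: rwhisk_def fc_def dl_def cf_def min_absorb1 drop_take_append\<close>)
next
  case (dl n i)
  then have "bm (Suc (n + k)) (n + k) (dl i)" by simp
  then show ?case using dl unfolding add_Suc
    by (subst bm_cong[of _ _ "dl i"]) (use dl in \<open>simp_all add: rwhisk_def fc_def dl_def cf_def min_absorb1 drop_take_append\<close>)
next
  case (cf n i \<epsilon>)
  then have "bm (Suc (n + k)) (n + k) (cf i \<epsilon>)" by simp
  then show ?case using cf unfolding add_Suc
    by (subst bm_cong[of _ _ "cf i \<epsilon>"]) (use cf in \<open>simp_all add: rwhisk_def fc_def dl_def cf_def min_absorb1 drop_take_append\<close>)
next
  case (comp l m n \<psi> \<phi>)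
  show ?case by (rule bm_comp'[OF comp(3,4)]) (auto simp: rwhisk_def bm_length[OF comp(1)])
next
  case (cong m n \<phi> \<psi>)
  show ?case by (rule iffD1[OF bm_cong cong(1)]) (simp add: rwhisk_def cong(2))
qed

lemma bm_take: "k \<le> n \<Longrightarrow> bm n k (take k)"
proof (induction n)
  case 0 then show ?case using bm_ident[of 0 "take 0"] by simp
next
  case (Suc n)
  show ?case
  proof (cases "k = Suc n")
    case True then show ?thesis by (simp add: bm_ident)
  next
    case False
    then have k: "k \<le> n" using Suc by simp
    show ?thesis
      by (rule bm_comp'[OF bm_dl[of n n] Suc(1)[OF k]]) (use k in \<open>auto simp: dl_def min_def\<close>)
  qed
qed

lemma bm_butlast [simp]: "bm (Suc n) n butlast"
  by (subst bm_cong[of _ _ "take n"]) (simp_all add: bm_take butlast_conv_take)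

section \<open>The action of morphisms on cubes\<close>

definition app :: "'a cubical \<Rightarrow> nat \<Rightarrow> nat \<Rightarrow> (bool list \<Rightarrow> bool list) \<Rightarrow> 'a \<Rightarrow> 'a" where
  "app X m n \<phi> x = act X m n (restrict \<phi> (vertices m)) x"

lemma app_cong: "(\<And>v. length v = m \<Longrightarrow> \<phi> v = \<psi> v) \<Longrightarrow> app X m n \<phi> = app X m n \<psi>"
  unfolding app_def using restrict_vertices_eqI[of m \<phi> \<psi>] by simp

lemma app_box_map: "box_map m n \<phi> \<Longrightarrow> act X m n \<phi> = app X m n \<phi>"
  by (simp add: app_def box_map_ext fun_eq_iff)

lemma app_in [simp]: "cubical_set X \<Longrightarrow> bm m n \<phi> \<Longrightarrow> x \<in> cubes X n \<Longrightarrow> app X m n \<phi> x \<in> cubes X m"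
  unfolding cubical_set_def app_def bm_def by blast

lemma app_ident: "cubical_set X \<Longrightarrow> (\<And>v. length v = n \<Longrightarrow> \<phi> v = v) \<Longrightarrow> x \<in> cubes X n \<Longrightarrow> app X n n \<phi> x = x"
  using restrict_vertices_eqI[of n \<phi> "\<lambda>v. v"] unfolding cubical_set_def app_def by (simp add: box_id_def)

lemma app_app:
  assumes "cubical_set X" "bm l m \<psi>" "bm m n \<phi>" "x \<in> cubes X n"
  shows "app X l m \<psi> (app X m n \<phi> x) = app X l n (\<phi> \<circ> \<psi>) x"
proof -
  have "act X l n (compose (vertices l) (restrict \<phi> (vertices m)) (restrict \<psi> (vertices l))) x =
      act X l m (restrict \<psi> (vertices l)) (act X m n (restrict \<phi> (vertices m)) x)"
    using assms unfolding cubical_set_def bm_def by blast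
  then show ?thesis using bm_length[OF assms(2)] by (simp add: app_def restrict_comp)
qed

text \<open>The workhorse for cubical identities: a commuting square of operators is checked on
  vertices, where it is a statement about lists.\<close>

lemma app_app_eq:
  assumes "cubical_set X" "bm l m \<psi>" "bm m n \<phi>" "bm l m' \<psi>'" "bm m' n \<phi>'" "x \<in> cubes X n"
    "\<And>v. length v = l \<Longrightarrow> \<phi> (\<psi> v) = \<phi>' (\<psi>' v)"
  shows "app X l m \<psi> (app X m n \<phi> x) = app X l m' \<psi>' (app X m' n \<phi>' x)"
  using assms app_cong[of l "\<phi> \<circ> \<psi>" "\<phi>' \<circ> \<psi>'" X n] by (simp add: app_app)

lemma app_app_eq1:
  assumes "cubical_set X" "bm l m \<psi>" "bm m n \<phi>" "x \<in> cubes X n"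
    "\<And>v. length v = l \<Longrightarrow> \<phi> (\<psi> v) = \<rho> v"
  shows "app X l m \<psi> (app X m n \<phi> x) = app X l n \<rho> x"
  using assms app_cong[of l "\<phi> \<circ> \<psi>" \<rho> X n] by (simp add: app_app)

lemma cubical_setI:
  assumes "\<And>m n \<phi> x. bm m n \<phi> \<Longrightarrow> x \<in> cubes X n \<Longrightarrow> app X m n \<phi> x \<in> cubes X m"
    "\<And>n x. x \<in> cubes X n \<Longrightarrow> app X n n id x = x"
    "\<And>l m n \<psi> \<phi> x. bm l m \<psi> \<Longrightarrow> bm m n \<phi> \<Longrightarrow> x \<in> cubes X n \<Longrightarrow>
       app X l n (\<phi> \<circ> \<psi>) x = app X l m \<psi> (app X m n \<phi> x)"
  shows "cubical_set X"
proof -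
  have "act X n n (box_id n) = app X n n id" for n
    by (simp add: app_def box_id_def id_def fun_eq_iff)
  moreover have "act X l n (compose (vertices l) \<phi> \<psi>) = app X l n (\<phi> \<circ> \<psi>)" for l n and \<phi> \<psi> :: "bool list \<Rightarrow> bool list"
    by (simp add: app_def compose_def comp_def fun_eq_iff)
  ultimately show ?thesis
    unfolding cubical_set_def using assms by (auto simp: app_box_map box_map_bm)
qed

lemma cubical_map_in: "cubical_map X Y f \<Longrightarrow> x \<in> cubes X n \<Longrightarrow> f n x \<in> cubes Y n"
  unfolding cubical_map_def by blast

lemma cubical_map_app:
  "cubical_map X Y f \<Longrightarrow> bm m n \<phi> \<Longrightarrow> x \<in> cubes X n \<Longrightarrow> f m (app X m n \<phi> x) = app Y m n \<phi> (f n x)"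
  unfolding cubical_map_def app_def bm_def by blast

lemma cubical_mapI:
  assumes "\<And>n x. x \<in> cubes X n \<Longrightarrow> f n x \<in> cubes Y n"
    "\<And>m n \<phi> x. bm m n \<phi> \<Longrightarrow> x \<in> cubes X n \<Longrightarrow> f m (app X m n \<phi> x) = app Y m n \<phi> (f n x)"
  shows "cubical_map X Y f"
  unfolding cubical_map_def using assms by (auto simp: app_box_map box_map_bm)

lemma cubical_map_comp:
  "cubical_map X Y f \<Longrightarrow> cubical_map Y Z g \<Longrightarrow> cubical_map X Z (\<lambda>n. g n \<circ> f n)"
  unfolding cubical_map_def by fastforce

lemma cubical_map_id: "cubical_map X X (\<lambda>n. id)"
  unfolding cubical_map_def by simp

definition fac :: "'a cubical \<Rightarrow> nat \<Rightarrow> nat \<Rightarrow> bool \<Rightarrow> 'a \<Rightarrow> 'a" where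
  "fac X n i \<epsilon> x = app X n (Suc n) (fc i \<epsilon>) x"

definition ldeg :: "'a cubical \<Rightarrow> nat \<Rightarrow> 'a \<Rightarrow> 'a" where
  "ldeg X n x = app X (Suc n) n butlast x"

lemma fac_in [simp]: "cubical_set X \<Longrightarrow> i \<le> n \<Longrightarrow> x \<in> cubes X (Suc n) \<Longrightarrow> fac X n i \<epsilon> x \<in> cubes X n"
  by (simp add: fac_def)

lemma ldeg_in [simp]: "cubical_set X \<Longrightarrow> x \<in> cubes X n \<Longrightarrow> ldeg X n x \<in> cubes X (Suc n)"
  by (simp add: ldeg_def)

lemma fac_fac:
  "cubical_set X \<Longrightarrow> i < j \<Longrightarrow> j \<le> Suc n \<Longrightarrow> x \<in> cubes X (Suc (Suc n)) \<Longrightarrow>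
   fac X n i \<epsilon> (fac X (Suc n) j \<eta> x) = fac X n (j - 1) \<eta> (fac X (Suc n) i \<epsilon> x)"
  unfolding fac_def by (rule app_app_eq) (auto simp: fc_fc)

lemma fac_ldeg:
  "cubical_set X \<Longrightarrow> j \<le> n \<Longrightarrow> x \<in> cubes X (Suc n) \<Longrightarrow>
   fac X (Suc n) j \<eta> (ldeg X (Suc n) x) = ldeg X n (fac X n j \<eta> x)"
  unfolding fac_def ldeg_def
  by (rule app_app_eq) (auto intro!: nth_equalityI simp: nth_fc nth_butlast)

text \<open>Faces of an n-cube live in dimension \<open>n - 1\<close>. The variants with truncated
  subtraction concentrate the case distinction on n here, since an index \<open>j < n\<close>
  already excludes dimension 0.\<close>

lemma fac_fac_pred:
  "cubical_set X \<Longrightarrow> x \<in> cubes X (Suc n) \<Longrightarrow> i < j \<Longrightarrow> j \<le> n \<Longrightarrow>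
   fac X (n - 1) i \<epsilon> (fac X n j \<eta> x) = fac X (n - 1) (j - 1) \<eta> (fac X n i \<epsilon> x)"
  using fac_fac[of X i j "n - 1" x \<epsilon> \<eta>] by (cases n) auto

lemma fac_ldeg_pred:
  "cubical_set X \<Longrightarrow> x \<in> cubes X n \<Longrightarrow> j < n \<Longrightarrow> fac X n j \<eta> (ldeg X n x) = ldeg X (n - 1) (fac X (n - 1) j \<eta> x)"
  using fac_ldeg[of X j "n - 1" x \<eta>] by (cases n) auto

lemma fac_ldeg_last: "cubical_set X \<Longrightarrow> x \<in> cubes X n \<Longrightarrow> fac X n n \<eta> (ldeg X n x) = x"
  unfolding fac_def ldeg_def
  by (subst app_app) (auto intro!: app_ident simp: fc_def butlast_append)

lemma map_fac: "cubical_map X Y f \<Longrightarrow> i \<le> n \<Longrightarrow> x \<in> cubes X (Suc n) \<Longrightarrow> f n (fac X n i \<epsilon> x) = fac Y n i \<epsilon> (f (Suc n) x)"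
  by (simp add: fac_def cubical_map_app)

lemma map_fac_pred:
  "cubical_map X Y f \<Longrightarrow> x \<in> cubes X n \<Longrightarrow> j < n \<Longrightarrow> fac Y (n - 1) j \<eta> (f n x) = f (n - 1) (fac X (n - 1) j \<eta> x)"
  using map_fac[of X Y f j "n - 1" x \<eta>] by (cases n) auto

lemma map_ldeg: "cubical_map X Y f \<Longrightarrow> x \<in> cubes X n \<Longrightarrow> f (Suc n) (ldeg X n x) = ldeg Y n (f n x)"
  by (simp add: ldeg_def cubical_map_app)

section \<open>The Kan condition for compatible families\<close>

text \<open>For \<open>k = n - 1\<close> these are the boundaries of \<open>n\<close>-cubes, for \<open>k = n\<close> the homotopies between them.\<close>

definition fam :: "'a cubical \<Rightarrow> nat \<Rightarrow> nat \<Rightarrow> (nat \<Rightarrow> bool \<Rightarrow> 'a) \<Rightarrow> bool" where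
  "fam X n k u \<longleftrightarrow> (\<forall>j<n. \<forall>\<eta>. u j \<eta> \<in> cubes X k) \<and>
     (\<forall>j<n. \<forall>i<j. \<forall>\<epsilon> \<eta>. fac X (k - 1) i \<epsilon> (u j \<eta>) = fac X (k - 1) (j - 1) \<eta> (u i \<epsilon>))"

text \<open>A map out of an open box is determined by its values on the faces, so extending it
  amounts to filling a family of cubes that agree on common faces. This is the form in which the Kan
  condition is used from here on.\<close>

definition akan :: "'a cubical \<Rightarrow> bool" where
  "akan X \<longleftrightarrow> cubical_set X \<and> (\<forall>n i \<epsilon> u. i \<le> n \<longrightarrow>
     (\<forall>j\<le>n. \<forall>\<eta>. (j, \<eta>) \<noteq> (i, \<epsilon>) \<longrightarrow> u j \<eta> \<in> cubes X n) \<longrightarrow>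
     (\<forall>j\<le>n. \<forall>k<j. \<forall>\<eta> \<theta>. (j, \<eta>) \<noteq> (i, \<epsilon>) \<longrightarrow> (k, \<theta>) \<noteq> (i, \<epsilon>) \<longrightarrow>
        fac X (n - 1) k \<theta> (u j \<eta>) = fac X (n - 1) (j - 1) \<eta> (u k \<theta>)) \<longrightarrow>
     (\<exists>x\<in>cubes X (Suc n). \<forall>j\<le>n. \<forall>\<eta>. (j, \<eta>) \<noteq> (i, \<epsilon>) \<longrightarrow> fac X n j \<eta> x = u j \<eta>))"

text \<open>A morphism with a constant coordinate factors through a face, by deleting and reinserting that
  coordinate. Hence faces of a representable intersect in common faces, and compatible cubes
  on the faces of an open box assemble to a map.\<close>

lemma fc_dl: "i < length v \<Longrightarrow> v ! i = \<epsilon> \<Longrightarrow> fc i \<epsilon> (dl i v) = v"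
  by (rule nth_equalityI) (auto simp: nth_fc nth_dl length_dl)

lemma dl_fc: "i \<le> length v \<Longrightarrow> dl i (fc i \<epsilon> v) = v"
  by (rule nth_equalityI) (auto simp: nth_fc nth_dl length_dl)

lemma kan_akan:
  assumes "kan_complex X"
  shows "akan X"
proof -
  have cX: "cubical_set X" using assms by (simp add: kan_complex_def)
  show ?thesis unfolding akan_def
  proof (intro conjI cX allI impI)
    fix n i :: nat and \<epsilon> :: bool and u :: "nat \<Rightarrow> bool \<Rightarrow> 'a"
    assume i: "i \<le> n" and uin: "\<forall>j\<le>n. \<forall>\<eta>. (j, \<eta>) \<noteq> (i, \<epsilon>) \<longrightarrow> u j \<eta> \<in> cubes X n"
      and comp: "\<forall>j\<le>n. \<forall>k<j. \<forall>\<eta> \<theta>. (j, \<eta>) \<noteq> (i, \<epsilon>) \<longrightarrow> (k, \<theta>) \<noteq> (i, \<epsilon>) \<longrightarrow>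
        fac X (n - 1) k \<theta> (u j \<eta>) = fac X (n - 1) (j - 1) \<eta> (u k \<theta>)"
    define ok where "ok k j \<eta> \<phi> \<longleftrightarrow> j \<le> n \<and> (j, \<eta>) \<noteq> (i, \<epsilon>) \<and> (\<forall>v. length v = k \<longrightarrow> \<phi> v ! j = \<eta>)" for k j \<eta> and \<phi> :: "bool list \<Rightarrow> bool list"
    define val where "val k \<phi> j \<eta> = app X k n (dl j \<circ> \<phi>) (u j \<eta>)" for k \<phi> j \<eta>
    have box: "box_map k (Suc n) \<phi> \<and> (\<exists>j \<eta>. ok k j \<eta> \<phi>)" if inbox: "\<phi> \<in> cubes (open_box (Suc n) (Suc i) \<epsilon>) k" for k \<phi>
    proof -
      obtain j \<eta> \<psi> where \<phi>: "\<phi> = compose (vertices k) (face (Suc n) j \<eta>) \<psi>"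
        and j: "1 \<le> j" "j \<le> Suc n" "(j, \<eta>) \<noteq> (Suc i, \<epsilon>)" and \<psi>: "box_map k n \<psi>"
        using inbox unfolding open_box_def by auto
      from j obtain j' where j': "j = Suc j'" by (cases j) auto
      have "box_map k (Suc n) \<phi>" unfolding \<phi>
        by (rule box_map.comp[OF \<psi>]) (use box_map.face[of j "Suc n" \<eta>] j in simp)
      moreover have "ok k j' \<eta> \<phi>"
        using j box_map_length[OF \<psi>] by (auto simp: ok_def j' \<phi> compose_def face_eq nth_fc)
      ultimately show ?thesis by blast
    qed
    \<comment> \<open>If two coordinates of \<open>\<phi>\<close> are constant, deleting both gives
      \<open>\<psi>\<close>, and both candidate values are obtained by applying
      \<open>\<psi>\<close> to the common face of the two cubes.\<close>
    have val_eq: "val k \<phi> j \<eta> = val k \<phi> j' \<eta>'"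
      if bm: "bm k (Suc n) \<phi>" and ok: "ok k j \<eta> \<phi>" "ok k j' \<eta>' \<phi>" and lt: "j' < j" for k \<phi> j \<eta> j' \<eta>'
    proof -
      from lt ok obtain n' where n': "n = Suc n'" by (cases n) (auto simp: ok_def)
      from ok lt have j: "j \<le> Suc n'" "j' \<le> n'" by (auto simp: ok_def n')
      define \<psi> where "\<psi> = dl j' \<circ> (dl j \<circ> \<phi>)"
      have bm1: "bm k n (dl j \<circ> \<phi>)" "bm k n (dl j' \<circ> \<phi>)"
        using bm_comp[OF bm bm_dl] ok by (auto simp: ok_def)
      have bm2: "bm k n' \<psi>" unfolding \<psi>_def by (rule bm_comp[OF bm1(1)]) (use j n' in simp)
      have len: "length (\<phi> v) = Suc (Suc n')" if "length v = k" for v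
        using bm_length[OF bm that] n' by simp
      have e1: "fc j' \<eta>' (\<psi> v) = (dl j \<circ> \<phi>) v" if "length v = k" for v
        using that ok lt j unfolding \<psi>_def comp_def
        by (intro fc_dl) (auto simp: ok_def length_dl len nth_dl)
      have e2: "fc (j - 1) \<eta> (\<psi> v) = (dl j' \<circ> \<phi>) v" if "length v = k" for v
        using that ok lt j unfolding \<psi>_def comp_def
        by (intro nth_equalityI) (auto simp: nth_fc nth_dl length_dl len ok_def)
      have "val k \<phi> j \<eta> = app X k n' \<psi> (app X n' n (fc j' \<eta>') (u j \<eta>))"
        unfolding val_def
        by (rule app_app_eq1[symmetric]) (use cX bm2 uin ok j e1 n' in \<open>auto simp: ok_def\<close>)
      also have "app X n' n (fc j' \<eta>') (u j \<eta>) = app X n' n (fc (j - 1) \<eta>) (u j' \<eta>')"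
        using comp ok lt unfolding ok_def fac_def n' by force
      also have "app X k n' \<psi> \<dots> = val k \<phi> j' \<eta>'"
        unfolding val_def
        by (rule app_app_eq1) (use cX bm2 uin ok j e2 n' lt in \<open>auto simp: ok_def\<close>)
      finally show ?thesis .
    qed
    have val_eq': "val k \<phi> j \<eta> = val k \<phi> j' \<eta>'"
      if "bm k (Suc n) \<phi>" "ok k j \<eta> \<phi>" "ok k j' \<eta>' \<phi>" for k \<phi> j \<eta> j' \<eta>'
    proof -
      have "\<eta> = \<eta>'" if "j = j'"
      proof -
        have "\<phi> (replicate k False) ! j = \<eta>" "\<phi> (replicate k False) ! j' = \<eta>'"
          using \<open>ok k j \<eta> \<phi>\<close> \<open>ok k j' \<eta>' \<phi>\<close> by (auto simp: ok_def)
        then show ?thesis using that by simp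
      qed
      consider "j = j'" "\<eta> = \<eta>'" | "j' < j" | "j < j'" using \<open>j = j' \<Longrightarrow> \<eta> = \<eta>'\<close> by linarith
      then show ?thesis
        using val_eq[OF that(1,2,3)] val_eq[OF that(1,3,2), symmetric] by cases simp_all
    qed
    define U where "U k \<phi> = (let (j, \<eta>) = (SOME p. ok k (fst p) (snd p) \<phi>) in val k \<phi> j \<eta>)" for k \<phi>
    have U: "U k \<phi> = val k \<phi> j \<eta>" if "bm k (Suc n) \<phi>" "ok k j \<eta> \<phi>" for k \<phi> j \<eta>
    proof -
      have "ok k (fst (SOME p. ok k (fst p) (snd p) \<phi>)) (snd (SOME p. ok k (fst p) (snd p) \<phi>)) \<phi>"
        by (rule someI[of "\<lambda>p. ok k (fst p) (snd p) \<phi>" "(j, \<eta>)"]) (use that in simp)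
      then show ?thesis using val_eq'[OF that(1) _ that(2)] by (simp add: U_def case_prod_unfold Let_def)
    qed
    have "cubical_map (open_box (Suc n) (Suc i) \<epsilon>) X U"
      unfolding cubical_map_def
    proof (intro conjI allI impI ballI funcsetI)
      fix k \<phi> assume "\<phi> \<in> cubes (open_box (Suc n) (Suc i) \<epsilon>) k"
      then obtain j \<eta> where \<phi>: "box_map k (Suc n) \<phi>" "ok k j \<eta> \<phi>" using box by blast
      then have "bm k n (dl j \<circ> \<phi>)" using bm_comp[OF box_map_bm bm_dl] by (auto simp: ok_def)
      then show "U k \<phi> \<in> cubes X k"
        using U[OF box_map_bm \<phi>(2)] \<phi> cX uin by (simp add: val_def ok_def)
    next
      fix l k \<psi> \<phi> assume \<psi>: "box_map l k \<psi>" and "\<phi> \<in> cubes (open_box (Suc n) (Suc i) \<epsilon>) k"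
      then obtain j \<eta> where \<phi>: "box_map k (Suc n) \<phi>" "ok k j \<eta> \<phi>" using box by blast
      let ?c = "compose (vertices l) \<phi> \<psi>"
      have c: "box_map l (Suc n) ?c" by (rule box_map.comp[OF \<psi> \<phi>(1)])
      have okc: "ok l j \<eta> ?c" using \<phi>(2) box_map_length[OF \<psi>] by (auto simp: ok_def compose_def)
      have bm1: "bm k n (dl j \<circ> \<phi>)" using bm_comp[OF box_map_bm bm_dl] \<phi> by (auto simp: ok_def)
      have "U l ?c = app X l n (dl j \<circ> ?c) (u j \<eta>)" using U[OF box_map_bm[OF c] okc] by (simp add: val_def)
      also have "\<dots> = app X l k \<psi> (app X k n (dl j \<circ> \<phi>) (u j \<eta>))"
        by (rule app_app_eq1[symmetric])
          (use cX bm1 box_map_bm[OF \<psi>] uin \<phi> in \<open>auto simp: ok_def compose_def\<close>)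
      also have "\<dots> = act X l k \<psi> (U k \<phi>)"
        using U[OF box_map_bm \<phi>(2)] \<phi> by (simp add: app_box_map[OF \<psi>] val_def)
      finally show "U l (act (open_box (Suc n) (Suc i) \<epsilon>) l k \<psi> \<phi>) = act X l k \<psi> (U k \<phi>)"
        by (simp add: open_box_def std_cube_def)
    qed
    moreover have "1 \<le> Suc i" "Suc i \<le> Suc n" using i by auto
    ultimately obtain V where V: "cubical_map (std_cube (Suc n)) X V"
      and VU: "\<And>k \<phi>. \<phi> \<in> cubes (open_box (Suc n) (Suc i) \<epsilon>) k \<Longrightarrow> V k \<phi> = U k \<phi>"
      using assms unfolding kan_complex_def by blast
    \<comment> \<open>By Yoneda the extension is a cube, namely its value at the identity, and its
      faces are the values at the face morphisms.\<close>
    let ?x = "V (Suc n) (box_id (Suc n))"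
    have idin: "box_id (Suc n) \<in> cubes (std_cube (Suc n)) (Suc n)" by (simp add: std_cube_def box_map.ident)
    have "?x \<in> cubes X (Suc n)" by (rule cubical_map_in[OF V idin])
    moreover have "fac X n j \<eta> ?x = u j \<eta>" if j: "j \<le> n" "(j, \<eta>) \<noteq> (i, \<epsilon>)" for j \<eta>
    proof -
      let ?f = "face (Suc n) (Suc j) \<eta>"
      have bf: "box_map n (Suc n) ?f" using bm_fc[OF j(1), of \<eta>] by (simp add: bm_def face_eq)
      have okf: "ok n j \<eta> ?f" using j by (simp add: ok_def face_eq nth_fc)
      have "fac X n j \<eta> ?x = V n (app (std_cube (Suc n)) n (Suc n) (fc j \<eta>) (box_id (Suc n)))"
        unfolding fac_def by (rule cubical_map_app[OF V bm_fc[OF j(1)] idin, symmetric])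
      also have "app (std_cube (Suc n)) n (Suc n) (fc j \<eta>) (box_id (Suc n)) = ?f"
        by (auto simp: app_def std_cube_def face_eq compose_def box_id_def fun_eq_iff)
      also have "V n ?f = U n ?f"
      proof (rule VU)
        have "?f = compose (vertices n) ?f (box_id n)" unfolding face_eq compose_def
          by (rule restrict_vertices_eqI) (simp add: box_id_def)
        then have "?f = compose (vertices n) ?f (box_id n) \<and> 1 \<le> Suc j \<and> Suc j \<le> Suc n \<and>
          (Suc j, \<eta>) \<noteq> (Suc i, \<epsilon>) \<and> box_map n (Suc n - 1) (box_id n)"
          using j box_map.ident[of n] by auto
        then show "?f \<in> cubes (open_box (Suc n) (Suc i) \<epsilon>) n" unfolding open_box_def by (simp, blast)
      qed
      also have "\<dots> = app X n n (dl j \<circ> ?f) (u j \<eta>)"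
        using U[OF box_map_bm[OF bf] okf] by (simp add: val_def)
      also have "\<dots> = u j \<eta>"
        by (rule app_ident[OF cX]) (use j uin in \<open>auto simp: face_eq dl_fc\<close>)
      finally show ?thesis .
    qed
    ultimately show "\<exists>x\<in>cubes X (Suc n). \<forall>j\<le>n. \<forall>\<eta>. (j, \<eta>) \<noteq> (i, \<epsilon>) \<longrightarrow> fac X n j \<eta> x = u j \<eta>" by blast
  qed
qed

section \<open>Sections of trivial fibrations\<close>

text \<open>The degeneracies are the case \<open>c = None\<close>, the connections the case \<open>c = Some \<epsilon>\<close>.\<close>

definition tau :: "nat \<Rightarrow> bool option \<Rightarrow> bool list \<Rightarrow> bool list" where
  "tau i c = (case c of None \<Rightarrow> dl i | Some \<epsilon> \<Rightarrow> cf i \<epsilon>)"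

definition tau_ok :: "nat \<Rightarrow> nat \<Rightarrow> bool option \<Rightarrow> bool" where
  "tau_ok n i c \<longleftrightarrow> i \<le> n \<and> (c \<noteq> None \<longrightarrow> i < n)"

lemma bm_tau [simp]: "tau_ok n i c \<Longrightarrow> bm (Suc n) n (tau i c)"
  by (cases c) (auto simp: tau_ok_def tau_def)

section \<open>Factorization into degeneracies and connections followed by faces\<close>

inductive box_epi :: "nat \<Rightarrow> nat \<Rightarrow> (bool list \<Rightarrow> bool list) \<Rightarrow> bool" where
  epi_id: "(\<And>v. length v = n \<Longrightarrow> e v = v) \<Longrightarrow> box_epi n n e"
| epi_step: "tau_ok m i c \<Longrightarrow> box_epi m k e \<Longrightarrow> (\<And>v. length v = Suc m \<Longrightarrow> e' v = e (tau i c v)) \<Longrightarrow> box_epi (Suc m) k e'"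

text \<open>The two kinds of words are read from opposite ends: \<open>box_epi\<close> exposes the
  operator applied first and \<open>box_mono\<close> the face applied last. These are the ends at
  which morphisms are taken apart in the induction on dimension.\<close>

inductive box_mono :: "nat \<Rightarrow> nat \<Rightarrow> (bool list \<Rightarrow> bool list) \<Rightarrow> bool" where
  mono_id: "(\<And>v. length v = n \<Longrightarrow> e v = v) \<Longrightarrow> box_mono n n e"
| mono_step: "i \<le> n \<Longrightarrow> box_mono k n e \<Longrightarrow> (\<And>v. length v = k \<Longrightarrow> e' v = fc i \<epsilon> (e v)) \<Longrightarrow> box_mono k (Suc n) e'"

lemma epi_bm: "box_epi m k e \<Longrightarrow> bm m k e"
proof (induction rule: box_epi.induct)
  case (epi_id n e) then show ?case by (rule bm_ident)
next
  case (epi_step m i c k e e') show ?case by (rule bm_comp'[OF bm_tau[OF epi_step(1)] epi_step(4,3)])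
qed

lemma mono_bm: "box_mono m k e \<Longrightarrow> bm m k e"
proof (induction rule: box_mono.induct)
  case (mono_id n e) then show ?case by (rule bm_ident)
next
  case (mono_step i n k e e' \<epsilon>) show ?case by (rule bm_comp'[OF mono_step(4) bm_fc[OF mono_step(1)] mono_step(3)])
qed

lemma epi_le: "box_epi m k e \<Longrightarrow> k \<le> m"
  by (induction rule: box_epi.induct) auto

lemma mono_le: "box_mono k n e \<Longrightarrow> k \<le> n"
  by (induction rule: box_mono.induct) auto

lemma epi_trans: "box_epi l m e \<Longrightarrow> box_epi m k e' \<Longrightarrow> (\<And>v. length v = l \<Longrightarrow> e'' v = e' (e v)) \<Longrightarrow> box_epi l k e''"
proof (induction arbitrary: e'' rule: box_epi.induct)
  case (epi_id n e)
  have "e'' v = e' v" if "length v = n" for v using epi_id that by simp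
  with epi_id(2) show ?case
  proof (induction rule: box_epi.cases)
    case (epi_id n e) then show ?case by (auto intro: box_epi.epi_id)
  next
    case (epi_step m i c k e e') then show ?case by (auto intro!: box_epi.epi_step[of m i c k e])
  qed
next
  case (epi_step m i c k' e1 e2)
  have "box_epi m k (e' \<circ> e1)" by (rule epi_step(4)) (use epi_step in auto)
  then show ?case
    by (rule box_epi.epi_step[OF epi_step(1)]) (use epi_step in auto)
qed

text \<open>A face followed by a degeneracy or connection either cancels or can be moved behind it.
  The remarkable case is a connection that meets its absorbing value: the merged coordinate becomes
  constant, so the composite is a degeneracy followed by a face.\<close>

lemma tau_fc:
  assumes "tau_ok n i c" "j \<le> n"
  shows "(\<forall>v. length v = n \<longrightarrow> tau i c (fc j \<eta> v) = v) \<or>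
    (\<exists>n' i' c' j'. n = Suc n' \<and> tau_ok n' i' c' \<and> j' \<le> n' \<and>
       (\<forall>v. length v = n \<longrightarrow> tau i c (fc j \<eta> v) = fc j' \<eta> (tau i' c' v)))"
proof (cases c)
  case None
  then have i: "i \<le> n" using assms by (simp add: tau_ok_def)
  consider "j = i" | "j < i" | "i < j" by linarith
  then show ?thesis
  proof cases
    case 1 then show ?thesis using i None by (auto simp: tau_def dl_fc)
  next
    case 2
    then obtain n' i' where n': "n = Suc n'" "i = Suc i'" using i by (cases n; cases i) auto
    have "tau i c (fc j \<eta> v) = fc j \<eta> (tau i' None v)" if "length v = n" for v
      using 2 i that n' None unfolding tau_def by (intro nth_equalityI) (auto simp: nth_fc nth_dl length_dl)
    moreover have "tau_ok n' i' None" using i n' by (simp add: tau_ok_def)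
    ultimately show ?thesis using 2 i n' by (intro disjI2 exI[of _ n'] exI[of _ i'] exI[of _ None] exI[of _ j]) auto
  next
    case 3
    then obtain n' j' where n': "n = Suc n'" "j = Suc j'" using assms by (cases n; cases j) auto
    have "tau i c (fc j \<eta> v) = fc j' \<eta> (tau i None v)" if "length v = n" for v
      using 3 i assms that n' None unfolding tau_def by (intro nth_equalityI) (auto simp: nth_fc nth_dl length_dl)
    moreover have "tau_ok n' i None" using assms 3 n' by (simp add: tau_ok_def)
    ultimately show ?thesis using 3 assms n' by (intro disjI2 exI[of _ n'] exI[of _ i] exI[of _ None] exI[of _ j']) auto
  qed
next
  case (Some \<epsilon>)
  then have i: "i < n" using assms by (simp add: tau_ok_def)
  then obtain n' where n': "n = Suc n'" by (cases n) auto
  consider "j = i \<or> j = Suc i" "\<eta> = \<epsilon>" | "j = i \<or> j = Suc i" "\<eta> \<noteq> \<epsilon>" | "j < i" | "Suc i < j" by linarith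
  then show ?thesis
  proof cases
    case 1
    have "tau i c (fc j \<eta> v) = v" if "length v = n" for v
      using 1 i that Some unfolding tau_def by (intro nth_equalityI) (auto simp: nth_fc nth_cf length_cf split: if_splits)
    then show ?thesis by blast
  next
    case 2
    have "tau i c (fc j \<eta> v) = fc i \<eta> (tau i None v)" if "length v = n" for v
      using 2 i that Some unfolding tau_def
      by (intro nth_equalityI) (auto simp: nth_fc nth_cf nth_dl length_cf length_dl split: if_splits)
    moreover have "tau_ok n' i None" using i n' by (simp add: tau_ok_def)
    ultimately show ?thesis using i n' by (intro disjI2 exI[of _ n'] exI[of _ i] exI[of _ None] exI[of _ i]) auto
  next
    case 3
    then obtain i' where i': "i = Suc i'" by (cases i) auto
    have "tau i c (fc j \<eta> v) = fc j \<eta> (tau i' c v)" if "length v = n" for v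
      using 3 i that i' Some unfolding tau_def by (intro nth_equalityI) (auto simp: nth_fc nth_cf length_cf)
    moreover have "tau_ok n' i' c" using i i' n' by (simp add: tau_ok_def)
    ultimately show ?thesis using 3 i n' by (intro disjI2 exI[of _ n'] exI[of _ i'] exI[of _ c] exI[of _ j]) auto
  next
    case 4
    then obtain j' where j': "j = Suc j'" by (cases j) auto
    have "tau i c (fc j \<eta> v) = fc j' \<eta> (tau i c v)" if "length v = n" for v
      using 4 i assms that j' Some unfolding tau_def by (intro nth_equalityI) (auto simp: nth_fc nth_cf length_cf)
    moreover have "tau_ok n' i c" using 4 assms j' n' by (simp add: tau_ok_def)
    ultimately show ?thesis using 4 j' assms n' by (intro disjI2 exI[of _ n'] exI[of _ i] exI[of _ c] exI[of _ j']) auto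
  qed
qed

text \<open>The operator travels through the faces from the last to the first. It either cancels
  against one of them, or survives all of them and is then the first operator of the
  composite.\<close>

lemma tau_mono:
  "box_mono k n' \<mu> \<Longrightarrow> n' = Suc n \<Longrightarrow> tau_ok n i c \<Longrightarrow>
   \<exists>k' e \<mu>'. box_epi k k' e \<and> box_mono k' n \<mu>' \<and> (\<forall>v. length v = k \<longrightarrow> tau i c (\<mu> v) = \<mu>' (e v))"
proof (induction arbitrary: n i c rule: box_mono.induct)
  case (mono_id n' \<mu>)
  have "box_epi (Suc n) n (tau i c)" by (rule epi_step[OF mono_id(3) epi_id]) auto
  moreover have "box_mono n n id" by (rule box_mono.mono_id) simp
  ultimately show ?case using mono_id by fastforce
next
  case (mono_step j n0 k \<mu>' \<mu> \<eta>)
  have n0: "n0 = n" using mono_step by simp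
  note len = bm_length[OF mono_bm[OF mono_step(2)]]
  from tau_fc[OF mono_step(6), of j \<eta>] mono_step(1) n0
  consider "\<forall>v. length v = n \<longrightarrow> tau i c (fc j \<eta> v) = v" |
    n1 i' c' j' where "n = Suc n1" "tau_ok n1 i' c'" "j' \<le> n1"
       "\<forall>v. length v = n \<longrightarrow> tau i c (fc j \<eta> v) = fc j' \<eta> (tau i' c' v)" by auto
  then show ?case
  proof cases
    case 1
    have "box_epi k k id" by (rule epi_id) simp
    moreover have "tau i c (\<mu> v) = \<mu>' (id v)" if "length v = k" for v
      using 1 mono_step(3) that len n0 by auto
    ultimately show ?thesis using mono_step(2) n0 by blast
  next
    case 2
    from mono_step(4)[of n1, OF _ 2(2)] n0 2(1) obtain k' e \<mu>1 where
      *: "box_epi k k' e" "box_mono k' n1 \<mu>1" "\<forall>v. length v = k \<longrightarrow> tau i' c' (\<mu>' v) = \<mu>1 (e v)" by auto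
    have "box_mono k' (Suc n1) (fc j' \<eta> \<circ> \<mu>1)" by (rule box_mono.mono_step[OF 2(3) *(2)]) simp
    moreover have "tau i c (\<mu> v) = (fc j' \<eta> \<circ> \<mu>1) (e v)" if "length v = k" for v
      using 2 mono_step(3) that len n0 * by auto
    ultimately show ?thesis using *(1) 2(1) by blast
  qed
qed

definition epi_mono :: "nat \<Rightarrow> nat \<Rightarrow> (bool list \<Rightarrow> bool list) \<Rightarrow> bool" where
  "epi_mono m n \<phi> \<longleftrightarrow> (\<exists>k e \<mu>. box_epi m k e \<and> box_mono k n \<mu> \<and> (\<forall>v. length v = m \<longrightarrow> \<phi> v = \<mu> (e v)))"

lemma epi_mono_tau:
  assumes "epi_mono l (Suc n) \<psi>" "tau_ok n i c"
  shows "epi_mono l n (tau i c \<circ> \<psi>)"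
proof -
  obtain k e \<mu> where 1: "box_epi l k e" "box_mono k (Suc n) \<mu>" "\<forall>v. length v = l \<longrightarrow> \<psi> v = \<mu> (e v)"
    using assms(1) unfolding epi_mono_def by auto
  obtain k' e' \<mu>' where 2: "box_epi k k' e'" "box_mono k' n \<mu>'" "\<forall>v. length v = k \<longrightarrow> tau i c (\<mu> v) = \<mu>' (e' v)"
    using tau_mono[OF 1(2) refl assms(2)] by auto
  have "box_epi l k' (e' \<circ> e)" by (rule epi_trans[OF 1(1) 2(1)]) simp
  then show ?thesis unfolding epi_mono_def using 1 2 bm_length[OF epi_bm[OF 1(1)]]
    by (intro exI[of _ k'] exI[of _ "e' \<circ> e"] exI[of _ \<mu>']) auto
qed

text \<open>Carrying an already factored morphism \<open>\<psi>\<close> on the right makes the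
  induction work: each generator then only has to be absorbed by a factorization from the
  left.\<close>

lemma bm_epi_mono_comp: "bm m n \<phi> \<Longrightarrow> epi_mono l m \<psi> \<Longrightarrow> epi_mono l n (\<phi> \<circ> \<psi>)"
proof (induction arbitrary: l \<psi> rule: bm_induct)
  case (ident n) then show ?case by simp
next
  case (fc n i \<epsilon>)
  obtain k e \<mu> where 1: "box_epi l k e" "box_mono k n \<mu>" "\<forall>v. length v = l \<longrightarrow> \<psi> v = \<mu> (e v)"
    using fc(2) unfolding epi_mono_def by auto
  have "box_mono k (Suc n) (fc i \<epsilon> \<circ> \<mu>)" by (rule mono_step[OF fc(1) 1(2)]) simp
  then show ?case unfolding epi_mono_def using 1 by (intro exI[of _ k] exI[of _ e] exI[of _ "fc i \<epsilon> \<circ> \<mu>"]) auto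
next
  case (dl n i) then show ?case using epi_mono_tau[of l n \<psi> i None] by (simp add: tau_ok_def tau_def comp_def)
next
  case (cf n i \<epsilon>) then show ?case using epi_mono_tau[of l n \<psi> i "Some \<epsilon>"] by (simp add: tau_ok_def tau_def comp_def)
next
  case (comp l' m n \<psi>' \<phi>) then show ?case by (simp add: comp_assoc)
next
  case (cong m n \<phi> \<psi>')
  have "epi_mono l n (\<phi> \<circ> \<psi>)" using cong by blast
  moreover have "length (\<psi> v) = m" if "length v = l" for v
    using cong(3) that unfolding epi_mono_def using bm_length[OF epi_bm] bm_length[OF mono_bm] by metis
  ultimately show ?case using cong(2) unfolding epi_mono_def by fastforce
qed

lemma bm_epi_mono: 
  assumes "bm m n \<phi>"
  shows "epi_mono m n \<phi>"
proof -
  have "epi_mono m m id" unfolding epi_mono_def using epi_id[of m id] mono_id[of m id] by fastforce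
  from bm_epi_mono_comp[OF assms this] show ?thesis by simp
qed

text \<open>Together with \<open>bm_tau_factor\<close> this reduces naturality in a new dimension to
  faces and to a single degeneracy or connection. If no face is left to split off, comparing
  dimensions makes the other factor an identity as well.\<close>

lemma bm_face_factor:
  assumes "bm m n \<phi>" "m \<le> n"
  shows "(m = n \<and> (\<forall>v. length v = m \<longrightarrow> \<phi> v = v)) \<or>
    (\<exists>n' i \<epsilon> \<phi>'. n = Suc n' \<and> i \<le> n' \<and> bm m n' \<phi>' \<and> (\<forall>v. length v = m \<longrightarrow> \<phi> v = fc i \<epsilon> (\<phi>' v)))"
proof -
  obtain k e \<mu> where 1: "box_epi m k e" "box_mono k n \<mu>" "\<forall>v. length v = m \<longrightarrow> \<phi> v = \<mu> (e v)"
    using bm_epi_mono[OF assms(1)] unfolding epi_mono_def by auto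
  note len = bm_length[OF epi_bm[OF 1(1)]]
  from 1(2) show ?thesis
  proof cases
    case mono_id
    then have "m = n" using epi_le[OF 1(1)] assms(2) by simp
    from 1(1) have "e v = v" if "length v = m" for v
      by cases (use epi_le \<open>m = n\<close> mono_id that in fastforce)+
    then show ?thesis using mono_id 1(3) \<open>m = n\<close> by auto
  next
    case (mono_step i n' \<mu>' \<epsilon>)
    have "bm m n' (\<mu>' \<circ> e)" by (rule bm_comp[OF epi_bm[OF 1(1)] mono_bm[OF mono_step(3)]])
    then show ?thesis using mono_step 1(3) len by (intro disjI2 exI[of _ n'] exI[of _ i] exI[of _ \<epsilon>] exI[of _ "\<mu>' \<circ> e"]) auto
  qed
qed

lemma bm_tau_factor:
  assumes "bm m n \<phi>" "n < m"
  shows "\<exists>m' i c \<phi>'. m = Suc m' \<and> tau_ok m' i c \<and> bm m' n \<phi>' \<and> (\<forall>v. length v = m \<longrightarrow> \<phi> v = \<phi>' (tau i c v))"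
proof -
  obtain k e \<mu> where 1: "box_epi m k e" "box_mono k n \<mu>" "\<forall>v. length v = m \<longrightarrow> \<phi> v = \<mu> (e v)"
    using bm_epi_mono[OF assms(1)] unfolding epi_mono_def by auto
  from 1(1) show ?thesis
  proof cases
    case epi_id
    then show ?thesis using mono_le[OF 1(2)] assms(2) by simp
  next
    case (epi_step m' i c e')
    have "bm m' n (\<mu> \<circ> e')" by (rule bm_comp[OF epi_bm[OF epi_step(3)] mono_bm[OF 1(2)]])
    then show ?thesis using epi_step 1(3) by (intro exI[of _ m'] exI[of _ i] exI[of _ c] exI[of _ "\<mu> \<circ> e'"]) auto
  qed
qed

text \<open>The two sections of a degeneracy or connection, and the corresponding idempotents.\<close>

definition del :: "nat \<Rightarrow> bool option \<Rightarrow> bool \<Rightarrow> bool list \<Rightarrow> bool list" where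
  "del i c a = (case c of None \<Rightarrow> fc i a | Some \<epsilon> \<Rightarrow> fc (if a then Suc i else i) \<epsilon>)"

definition idem :: "nat \<Rightarrow> bool option \<Rightarrow> bool \<Rightarrow> bool list \<Rightarrow> bool list" where
  "idem i c a v = del i c a (tau i c v)"

text \<open>The operation by which a connection merges two coordinates, with
  \<open>\<epsilon>\<close> as neutral and the other value as absorbing element. Keeping it symbolic
  treats both connections in one computation.\<close>

definition gate :: "bool \<Rightarrow> bool \<Rightarrow> bool \<Rightarrow> bool" where
  "gate \<epsilon> x y = (if \<epsilon> then x \<and> y else x \<or> y)"

lemma gate_simps [simp]: "gate \<epsilon> \<epsilon> x = x" "gate \<epsilon> x \<epsilon> = x" "\<epsilon> \<noteq> \<delta> \<Longrightarrow> gate \<epsilon> \<delta> x = \<delta>" "\<epsilon> \<noteq> \<delta> \<Longrightarrow> gate \<epsilon> x \<delta> = \<delta>"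
  "gate \<epsilon> (gate \<epsilon> x y) z = gate \<epsilon> x (gate \<epsilon> y z)"
  by (auto simp: gate_def)

lemma bm_del [simp]: "tau_ok n i c \<Longrightarrow> bm n (Suc n) (del i c a)"
  by (cases c) (auto simp: tau_ok_def del_def)

lemma tau_del: "tau_ok n i c \<Longrightarrow> length v = n \<Longrightarrow> tau i c (del i c a v) = v"
  by (rule nth_equalityI)
    (auto simp: tau_ok_def del_def tau_def length_dl length_cf nth_dl nth_cf nth_fc split: option.splits if_splits)

lemma bm_idem: "tau_ok n i c \<Longrightarrow> bm (Suc n) (Suc n) (idem i c a)"
  by (rule bm_comp'[OF bm_tau bm_del]) (auto simp: idem_def)

lemma idem_None: "i < length v \<Longrightarrow> idem i None a v = v[i := a]"
  unfolding idem_def del_def tau_def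
  by (rule nth_equalityI) (auto simp: nth_fc nth_dl length_dl nth_list_update)

lemma idem_Some: "Suc i < length v \<Longrightarrow> idem i (Some \<epsilon>) a v =
    (if a then v[i := gate \<epsilon> (v ! i) (v ! Suc i), Suc i := \<epsilon>] else v[i := \<epsilon>, Suc i := gate \<epsilon> (v ! i) (v ! Suc i)])"
  unfolding idem_def del_def tau_def
  by (rule nth_equalityI) (auto simp: nth_fc nth_cf length_cf nth_list_update gate_def)

lemma idem_idem: "tau_ok n i c \<Longrightarrow> length v = Suc n \<Longrightarrow> idem i c a (idem i c a v) = idem i c a v"
  by (simp add: idem_def tau_del bm_length[OF bm_tau])

lemma idem_commute:
  assumes "tau_ok n i c" "tau_ok n i' c'" "length v = Suc n" "i < i'" "c = None \<or> Suc i < i'"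
  shows "idem i c a (idem i' c' b v) = idem i' c' b (idem i c a v)"
  using assms
  by (cases c; cases c')
    (auto simp: tau_ok_def idem_None idem_Some list_update_swap nth_list_update)

lemma idem_commute_conn:
  assumes "Suc i < n" "length v = Suc n"
  shows "idem i (Some \<epsilon>) False (idem (Suc i) (Some \<epsilon>) True v) = idem (Suc i) (Some \<epsilon>) True (idem i (Some \<epsilon>) False v)"
  using assms
  by (auto simp: idem_Some list_update_swap nth_list_update)

text \<open>Any other pair of idempotents \<open>e\<close>, \<open>e'\<close> generates a word that makes the coordinates
  they touch constant.\<close>

lemma word_same:
  assumes "tau_ok n i c" "tau_ok n i c'" "length v = Suc n" "c \<noteq> c'" "c' = Some \<epsilon>'"
  shows "idem i c \<epsilon>' (idem i c' (c = None) (idem i c \<epsilon>' (idem i c' f v))) =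
    idem i c \<epsilon>' (idem i c' (c = None) (idem i c \<epsilon>' v))"
  using assms
  by (cases c) (auto simp: tau_ok_def idem_None idem_Some nth_list_update intro!: nth_equalityI)

text \<open>The neutral value of one connection is absorbing for the other. Both sides set the
  coordinates i, i + 1, i + 2 to \<open>\<epsilon>\<close>, \<open>\<epsilon>'\<close>,
  \<open>\<epsilon>\<close>, whatever they were before.\<close>

lemma word_conn_conn:
  assumes "Suc i < n" "length v = Suc n" "\<epsilon> \<noteq> \<epsilon>'"
  shows "idem i (Some \<epsilon>) False (idem (Suc i) (Some \<epsilon>') False (idem i (Some \<epsilon>) True (idem (Suc i) (Some \<epsilon>') f v))) =
    idem i (Some \<epsilon>) False (idem (Suc i) (Some \<epsilon>') False (idem i (Some \<epsilon>) True v))"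
  using assms by (auto simp: idem_Some nth_list_update intro!: nth_equalityI)

text \<open>Both sides set the coordinates i and i + 1 to \<open>\<epsilon>\<close>: the degeneracy
  supplies the neutral value, and the connection then moves it to the other coordinate.\<close>

lemma word_degen_conn:
  assumes "i < n" "length v = Suc n"
  shows "idem (Suc i) None \<epsilon> (idem i (Some \<epsilon>) False (idem (Suc i) None \<epsilon> (idem i (Some \<epsilon>) f v))) =
    idem (Suc i) None \<epsilon> (idem i (Some \<epsilon>) False (idem (Suc i) None \<epsilon> v))"
  using assms by (auto simp: idem_None idem_Some nth_list_update intro!: nth_equalityI)

text \<open>The sections are chosen so that either the idempotents commute or an alternating word,
  beginning and ending with the same idempotent, absorbs the other one on its right. Exchanging the
  two operators allows the assumption that the first has the smaller position or, at equal
  positions, that the second is a connection.\<close>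

lemma words:
  assumes "tau_ok n i c" "tau_ok n i' c'" "(i, c) \<noteq> (i', c')"
  shows "(\<exists>a b. \<forall>v. length v = Suc n \<longrightarrow> idem i c a (idem i' c' b v) = idem i' c' b (idem i c a v)) \<or>
    (\<exists>a b d f. \<forall>v. length v = Suc n \<longrightarrow>
       idem i c a (idem i' c' b (idem i c d (idem i' c' f v))) = idem i c a (idem i' c' b (idem i c d v))) \<or>
    (\<exists>a b d f. \<forall>v. length v = Suc n \<longrightarrow>
       idem i' c' a (idem i c b (idem i' c' d (idem i c f v))) = idem i' c' a (idem i c b (idem i' c' d v)))"
  (is "?C i c i' c' \<or> ?W i c i' c' \<or> ?W i' c' i c")
proof -
  have main: "?C i c i' c' \<or> ?W i c i' c' \<or> ?W i' c' i c"
    if ok: "tau_ok n i c" "tau_ok n i' c'" and ne: "(i, c) \<noteq> (i', c')" and le: "i < i' \<or> i = i' \<and> c' \<noteq> None" for i c i' c'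
  proof -
    consider "i < i'" "c = None \<or> Suc i < i'" | \<epsilon> where "i' = Suc i" "c = Some \<epsilon>" "c' = None"
      | \<epsilon> where "i' = Suc i" "c = Some \<epsilon>" "c' = Some \<epsilon>" | \<epsilon> \<epsilon>' where "i' = Suc i" "c = Some \<epsilon>" "c' = Some \<epsilon>'" "\<epsilon> \<noteq> \<epsilon>'"
      | \<epsilon>' where "i' = i" "c' = Some \<epsilon>'" "c \<noteq> c'"
    proof (cases "i' = i")
      case True then show ?thesis using that(5) le ne by auto
    next
      case False
      show ?thesis
      proof (cases "c = None \<or> Suc i < i'")
        case True then show ?thesis using that(1) le False by auto
      next
        case F: False
        then have "i' = Suc i" using le False by auto
        moreover obtain \<epsilon> where "c = Some \<epsilon>" using F by auto
        ultimately show ?thesis using that(2-4) by (cases c') auto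
      qed
    qed
    then show ?thesis
    proof cases
      case 1 then show ?thesis using idem_commute[OF ok] by blast
    next
      case 2 then show ?thesis using word_degen_conn[of i n] ok by (simp add: tau_ok_def) blast
    next
      case 3
      have "Suc i < n" using ok 3 by (simp add: tau_ok_def)
      then show ?thesis using idem_commute_conn[of i n] 3 by blast
    next
      case 4
      have "Suc i < n" using ok 4 by (simp add: tau_ok_def)
      then show ?thesis using word_conn_conn[OF _ _ 4(4)] 4 by blast
    next
      case 5 then show ?thesis using word_same[OF ok(1)] ok(2) by blast
    qed
  qed
  have sym: "?C i' c' i c \<Longrightarrow> ?C i c i' c'" by (elim exE) metis
  show ?thesis
  proof (cases "i < i' \<or> i = i' \<and> c' \<noteq> None")
    case True then show ?thesis using main[OF assms] by blast
  next
    case False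
    then have "i' < i \<or> i' = i \<and> c \<noteq> None" using assms(3) by auto
    then show ?thesis using main[OF assms(2,1)] assms(3) sym by blast
  qed
qed

text \<open>From \<open>BA\<close> and idempotence, A is fixed by the idempotents of the first
  operator. If the idempotents commute, applying both to A in the two orders gives B and A.
  Otherwise the alternating word m sends A to B and back, so it fixes A; since m absorbs an
  idempotent that sends A to B, this gives A = B.\<close>

lemma word_eq:
  assumes T: "cubical_set T" and A: "A \<in> cubes T (Suc n)" and B: "B \<in> cubes T (Suc n)"
    and ok: "tau_ok n i c" "tau_ok n i' c'" "(i, c) \<noteq> (i', c')"
    and BA: "\<And>a. app T (Suc n) (Suc n) (idem i c a) B = A"
    and AB: "\<And>a. app T (Suc n) (Suc n) (idem i' c' a) A = B"
  shows "A = B"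
proof -
  let ?g = "app T (Suc n) (Suc n)"
  have absorb: "A = B" if A: "A \<in> cubes T (Suc n)" and B: "B \<in> cubes T (Suc n)"
    and ok: "tau_ok n i c" "tau_ok n i' c'" and BA: "\<And>a. ?g (idem i c a) B = A" and AB: "\<And>a. ?g (idem i' c' a) A = B"
    and W: "\<forall>v. length v = Suc n \<longrightarrow>
       idem i c a (idem i' c' b (idem i c d (idem i' c' f v))) = idem i c a (idem i' c' b (idem i c d v))"
    for A B i c i' c' a b d f
  proof -
    note bms = bm_idem[OF ok(1)] bm_idem[OF ok(2)]
    have AA: "?g (idem i c a) A = A" for a
    proof -
      have "?g (idem i c a) A = ?g (idem i c a) (?g (idem i c a) B)" by (simp only: BA)
      also have "\<dots> = ?g (idem i c a) B"
        by (rule app_app_eq1[OF T bms(1) bms(1) B]) (simp add: idem_idem[OF ok(1)])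
      finally show ?thesis by (simp add: BA)
    qed
    define m where "m = idem i c a \<circ> (idem i' c' b \<circ> idem i c d)"
    have bm: "bm (Suc n) (Suc n) m" unfolding m_def by (rule bm_comp[OF bm_comp[OF bms(1) bms(2)] bms(1)])
    have "?g m A = ?g (idem i' c' b \<circ> idem i c d) (?g (idem i c a) A)"
      unfolding m_def by (rule app_app[OF T bm_comp[OF bms(1) bms(2)] bms(1) A, symmetric])
    also have "\<dots> = ?g (idem i c d) (?g (idem i' c' b) A)"
      unfolding AA by (rule app_app[OF T bms(1) bms(2) A, symmetric])
    finally have mA: "?g m A = A" by (simp add: AB BA)
    have "?g (idem i' c' f) (?g m A) = ?g m A"
      by (rule app_app_eq1[OF T bms(2) bm A]) (use W in \<open>simp add: m_def\<close>)
    then show "A = B" by (simp add: mA AB)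
  qed
  from words[OF ok] consider a b where "\<forall>v. length v = Suc n \<longrightarrow> idem i c a (idem i' c' b v) = idem i' c' b (idem i c a v)"
    | a b d f where "\<forall>v. length v = Suc n \<longrightarrow>
       idem i c a (idem i' c' b (idem i c d (idem i' c' f v))) = idem i c a (idem i' c' b (idem i c d v))"
    | a b d f where "\<forall>v. length v = Suc n \<longrightarrow>
       idem i' c' a (idem i c b (idem i' c' d (idem i c f v))) = idem i' c' a (idem i c b (idem i' c' d v))"
    by blast
  then show ?thesis
  proof cases
    case 1
    have "?g (idem i c a) (?g (idem i c a) B) = ?g (idem i c a) B"
      by (rule app_app_eq1[OF T bm_idem[OF ok(1)] bm_idem[OF ok(1)] B]) (simp add: idem_idem[OF ok(1)])
    then have AA: "?g (idem i c a) A = A" by (simp add: BA)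
    have "?g (idem i' c' b) (?g (idem i c a) A) = ?g (idem i c a) (?g (idem i' c' b) A)"
      by (rule app_app_eq[OF T bm_idem[OF ok(2)] bm_idem[OF ok(1)] bm_idem[OF ok(1)] bm_idem[OF ok(2)] A])
        (use 1 in simp)
    then show ?thesis by (simp add: AA AB BA)
  next
    case 2 show ?thesis by (rule absorb[OF A B ok(1,2) BA AB 2])
  next
    case 3 show ?thesis by (rule absorb[OF B A ok(2,1) AB BA 3, symmetric])
  qed
qed

section \<open>Extending a section dimension by dimension\<close>

definition natural_upto :: "nat \<Rightarrow> 'a cubical \<Rightarrow> 'b cubical \<Rightarrow> (nat \<Rightarrow> 'a \<Rightarrow> 'b) \<Rightarrow> bool" where
  "natural_upto N Y T s \<longleftrightarrow> (\<forall>n\<le>N. \<forall>y\<in>cubes Y n. s n y \<in> cubes T n) \<and>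
     (\<forall>m n \<phi>. m \<le> N \<longrightarrow> n \<le> N \<longrightarrow> bm m n \<phi> \<longrightarrow> (\<forall>y\<in>cubes Y n. s m (app Y m n \<phi> y) = app T m n \<phi> (s n y)))"

text \<open>If \<open>y\<close> has two degenerate presentations, let \<open>A\<close> and \<open>B\<close> be the two candidates for the value at \<open>y\<close>.
  Writing \<open>e\<close> and \<open>e'\<close> for the idempotents of the presentations, naturality in lower dimensions gives
  \<open>A = B e\<close> and \<open>B = A e'\<close>.\<close>

lemma degenerate_unique:
  assumes Y: "cubical_set Y" and T: "cubical_set T" and s: "natural_upto n Y T s"
    and y: "y1 \<in> cubes Y n" "y2 \<in> cubes Y n" and ok: "tau_ok n i c" "tau_ok n i' c'"
    and eq: "app Y (Suc n) n (tau i c) y1 = app Y (Suc n) n (tau i' c') y2"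
  shows "app T (Suc n) n (tau i c) (s n y1) = app T (Suc n) n (tau i' c') (s n y2)"
proof -
  have key: "app T (Suc n) (Suc n) (idem i c a) (app T (Suc n) n (tau i' c') (s n y2)) = app T (Suc n) n (tau i c) (s n y1)"
    if y: "y1 \<in> cubes Y n" "y2 \<in> cubes Y n" and ok: "tau_ok n i c" "tau_ok n i' c'"
    and eq: "app Y (Suc n) n (tau i c) y1 = app Y (Suc n) n (tau i' c') y2" for y1 y2 i c i' c' a
  proof -
    have sT: "s n y1 \<in> cubes T n" "s n y2 \<in> cubes T n" using s y by (auto simp: natural_upto_def)
    \<comment> \<open>A section of the first operator recovers \<open>y1\<close> from the degenerate
      cube. Inserting the second presentation writes \<open>y1\<close> as the image of
      \<open>y2\<close> under an endomorphism of the n-cube, for which naturality is already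
      known.\<close>
    have "y1 = app Y n (Suc n) (del i c a) (app Y (Suc n) n (tau i c) y1)"
      using Y y ok by (subst app_app) (auto intro!: app_ident[symmetric] simp: tau_del)
    also have "\<dots> = app Y n n (tau i' c' \<circ> del i c a) y2"
      using Y y ok by (simp add: eq app_app)
    finally have "s n y1 = s n (app Y n n (tau i' c' \<circ> del i c a) y2)" by simp
    also have "\<dots> = app T n n (tau i' c' \<circ> del i c a) (s n y2)"
      using s y ok bm_comp[OF bm_del[OF ok(1)] bm_tau[OF ok(2)]] unfolding natural_upto_def by blast
    finally have 1: "s n y1 = app T n n (tau i' c' \<circ> del i c a) (s n y2)" .
    have bmtd: "bm n n (tau i' c' \<circ> del i c a)" by (rule bm_comp[OF bm_del[OF ok(1)] bm_tau[OF ok(2)]])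
    show ?thesis unfolding 1
      by (rule app_app_eq[OF T bm_idem[OF ok(1)] bm_tau[OF ok(2)] bm_tau[OF ok(1)] bmtd sT(2)])
        (simp add: idem_def)
  qed
  have sT: "s n y1 \<in> cubes T n" "s n y2 \<in> cubes T n" using s y by (auto simp: natural_upto_def)
  show ?thesis
  proof (cases "(i, c) = (i', c')")
    case True
    then have "app Y n (Suc n) (del i c False) (app Y (Suc n) n (tau i c) y1) =
       app Y n (Suc n) (del i c False) (app Y (Suc n) n (tau i c) y2)" using eq by simp
    moreover have "app Y n (Suc n) (del i c False) (app Y (Suc n) n (tau i c) y) = y" if "y \<in> cubes Y n" for y
      using Y that ok by (subst app_app) (auto intro!: app_ident simp: tau_del)
    ultimately have "y1 = y2" using y by simp
    then show ?thesis using True by simp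
  next
    case False
    show ?thesis
      by (rule word_eq[OF T _ _ ok False key[OF y ok eq] key[OF y(2,1) ok(2,1) eq[symmetric]]])
        (use T ok sT in auto)
  qed
qed

text \<open>A morphism into the new dimension is the identity or ends in a face, and a morphism out
  of it that lowers the dimension begins with a degeneracy or connection. The fact
  \<open>down\<close> precedes \<open>up\<close> because splitting a face off an endomorphism of the
  (n+1)-cube leaves a morphism that lowers the dimension.\<close>

lemma natural_upto_Suc:
  assumes Y: "cubical_set Y" and T: "cubical_set T" and s: "natural_upto n Y T s"
    and fac: "\<And>y j \<eta>. y \<in> cubes Y (Suc n) \<Longrightarrow> j \<le> n \<Longrightarrow> fac T n j \<eta> (s (Suc n) y) = s n (fac Y n j \<eta> y)"
    and deg: "\<And>y i c. y \<in> cubes Y n \<Longrightarrow> tau_ok n i c \<Longrightarrow> s (Suc n) (app Y (Suc n) n (tau i c) y) = app T (Suc n) n (tau i c) (s n y)"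
    and inT: "\<And>y. y \<in> cubes Y (Suc n) \<Longrightarrow> s (Suc n) y \<in> cubes T (Suc n)"
  shows "natural_upto (Suc n) Y T s"
proof -
  have nat: "s m (app Y m k \<phi> y) = app T m k \<phi> (s k y)" if "m \<le> n" "k \<le> n" "bm m k \<phi>" "y \<in> cubes Y k" for m k \<phi> y
    using s that unfolding natural_upto_def by blast
  have inT': "s k y \<in> cubes T k" if "k \<le> Suc n" "y \<in> cubes Y k" for k y
    using s that inT unfolding natural_upto_def by (cases "k = Suc n") auto
  have down: "s (Suc n) (app Y (Suc n) k \<phi> y) = app T (Suc n) k \<phi> (s k y)"
    if k: "k \<le> n" and \<phi>: "bm (Suc n) k \<phi>" and y: "y \<in> cubes Y k" for k \<phi> y
  proof -
    obtain i c \<phi>' where f: "tau_ok n i c" "bm n k \<phi>'" "\<And>v. length v = Suc n \<Longrightarrow> \<phi> v = \<phi>' (tau i c v)"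
      using bm_tau_factor[OF \<phi>] k by auto
    have "app Y (Suc n) k \<phi> y = app Y (Suc n) n (tau i c) (app Y n k \<phi>' y)"
      by (rule app_app_eq1[symmetric]) (use Y f y in auto)
    moreover have "app T (Suc n) k \<phi> (s k y) = app T (Suc n) n (tau i c) (app T n k \<phi>' (s k y))"
      by (rule app_app_eq1[symmetric]) (use T f inT' y k in auto)
    ultimately show ?thesis using deg[OF _ f(1)] Y f(2) y nat[OF _ k f(2) y] by simp
  qed
  have up: "s m (app Y m (Suc n) \<phi> y) = app T m (Suc n) \<phi> (s (Suc n) y)"
    if m: "m \<le> Suc n" and \<phi>: "bm m (Suc n) \<phi>" and y: "y \<in> cubes Y (Suc n)" for m \<phi> y
    using bm_face_factor[OF \<phi> m]
  proof (elim disjE conjE exE)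
    assume *: "m = Suc n" "\<forall>v. length v = m \<longrightarrow> \<phi> v = v"
    then show ?thesis using app_ident[OF Y _ y, of \<phi>] app_ident[OF T _ inT[OF y], of \<phi>] by simp
  next
    fix n' i \<epsilon> \<phi>' assume "Suc n = Suc n'" "i \<le> n'" "bm m n' \<phi>'" and 4: "\<forall>v. length v = m \<longrightarrow> \<phi> v = fc i \<epsilon> (\<phi>' v)"
    then have f: "i \<le> n" "bm m n \<phi>'" by auto
    have "app Y m (Suc n) \<phi> y = app Y m n \<phi>' (fac Y n i \<epsilon> y)"
      unfolding fac_def by (rule app_app_eq1[symmetric]) (use Y f y 4 in auto)
    moreover have "app T m (Suc n) \<phi> (s (Suc n) y) = app T m n \<phi>' (fac T n i \<epsilon> (s (Suc n) y))"
      unfolding fac_def by (rule app_app_eq1[symmetric]) (use T f inT[OF y] 4 in auto)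
    moreover have "s m (app Y m n \<phi>' (fac Y n i \<epsilon> y)) = app T m n \<phi>' (s n (fac Y n i \<epsilon> y))"
      using nat[of m n \<phi>'] down[of n \<phi>'] m f Y y by (cases "m = Suc n") auto
    ultimately show ?thesis using fac[OF y f(1)] by simp
  qed
  show ?thesis
    unfolding natural_upto_def
  proof (intro conjI allI impI ballI)
    fix m k \<phi> y assume *: "m \<le> Suc n" "k \<le> Suc n" "bm m k \<phi>" "y \<in> cubes Y k"
    consider "k = Suc n" | "k \<le> n" "m = Suc n" | "k \<le> n" "m \<le> n" using * by linarith
    then show "s m (app Y m k \<phi> y) = app T m k \<phi> (s k y)"
      by cases (use * up down nat in auto)
  qed (use inT' in auto)
qed

text \<open>On a cube with a degenerate presentation the value is forced, and it is independent of
  the presentation by \<open>degenerate_unique\<close>. On any other cube the values on the faces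
  form a compatible boundary, which \<open>lift\<close> fills.\<close>

lemma trivial_fibration_section:
  assumes T: "cubical_set T" and Y: "cubical_set Y" and p: "cubical_map T Y p"
    and lift: "\<And>n y u. y \<in> cubes Y n \<Longrightarrow> fam T n (n - 1) u \<Longrightarrow> (\<And>j \<eta>. j < n \<Longrightarrow> p (n - 1) (u j \<eta>) = fac Y (n - 1) j \<eta> y) \<Longrightarrow>
      \<exists>t\<in>cubes T n. (\<forall>j<n. \<forall>\<eta>. fac T (n - 1) j \<eta> t = u j \<eta>) \<and> p n t = y"
  shows "\<exists>s. cubical_map Y T s \<and> (\<forall>n. \<forall>y\<in>cubes Y n. p n (s n y) = y)"
proof -
  define good where "good N s \<longleftrightarrow> natural_upto N Y T s \<and> (\<forall>n\<le>N. \<forall>y\<in>cubes Y n. p n (s n y) = y)" for N s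
  have base: "\<exists>s. good 0 s"
  proof -
    have "\<exists>t\<in>cubes T 0. p 0 t = y" if "y \<in> cubes Y 0" for y
      using lift[OF that, of "\<lambda>_ _. undefined"] by (simp add: fam_def)
    then obtain s0 where s0: "\<And>y. y \<in> cubes Y 0 \<Longrightarrow> s0 y \<in> cubes T 0 \<and> p 0 (s0 y) = y" by metis
    have "good 0 (\<lambda>_. s0)"
      unfolding good_def natural_upto_def
    proof (intro conjI allI impI ballI)
      fix m n \<phi> y assume *: "m \<le> (0::nat)" "n \<le> (0::nat)" "bm m n \<phi>" "y \<in> cubes Y n"
      then have mn: "m = 0" "n = 0" by auto
      have id: "\<phi> v = v" if "length v = 0" for v using bm_length[OF *(3)] that mn by auto
      show "s0 (app Y m n \<phi> y) = app T m n \<phi> (s0 y)"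
        using app_ident[OF Y id] app_ident[OF T id] s0 * mn by auto
    qed (use s0 in auto)
    then show ?thesis by blast
  qed
  have step: "\<exists>s'. good (Suc n) s' \<and> (\<forall>k\<le>n. s' k = s k)" if s: "good n s" for n s
  proof -
    have sn: "natural_upto n Y T s" and sp: "\<And>k y. k \<le> n \<Longrightarrow> y \<in> cubes Y k \<Longrightarrow> p k (s k y) = y"
      using s by (auto simp: good_def)
    have sT: "s n y \<in> cubes T n" if "y \<in> cubes Y n" for y using sn that by (auto simp: natural_upto_def)
    have snat: "s m (app Y m n \<phi> y) = app T m n \<phi> (s n y)" if "m \<le> n" "bm m n \<phi>" "y \<in> cubes Y n" for m \<phi> y
      using sn that unfolding natural_upto_def by blast
    \<comment> \<open>Every presentation of y is quantified over here, so that choosing any t with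
      \<open>P y t\<close> is automatically compatible with all degeneracies and
      connections.\<close>
    define P where "P y t \<longleftrightarrow> t \<in> cubes T (Suc n) \<and> p (Suc n) t = y \<and>
       (\<forall>j\<le>n. \<forall>\<eta>. fac T n j \<eta> t = s n (fac Y n j \<eta> y)) \<and>
       (\<forall>i c y1. tau_ok n i c \<longrightarrow> y1 \<in> cubes Y n \<longrightarrow> y = app Y (Suc n) n (tau i c) y1 \<longrightarrow> t = app T (Suc n) n (tau i c) (s n y1))" for y t
    have "\<exists>t. P y t" if y: "y \<in> cubes Y (Suc n)" for y
    proof (cases "\<exists>i c y1. tau_ok n i c \<and> y1 \<in> cubes Y n \<and> y = app Y (Suc n) n (tau i c) y1")
      case True
      then obtain i c y1 where 1: "tau_ok n i c" "y1 \<in> cubes Y n" "y = app Y (Suc n) n (tau i c) y1" by blast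
      let ?t = "app T (Suc n) n (tau i c) (s n y1)"
      have "fac T n j \<eta> ?t = s n (fac Y n j \<eta> y)" if j: "j \<le> n" for j \<eta>
      proof -
        have "fac T n j \<eta> ?t = app T n n (tau i c \<circ> fc j \<eta>) (s n y1)"
          unfolding fac_def by (rule app_app) (use T j 1 sT in auto)
        moreover have "fac Y n j \<eta> y = app Y n n (tau i c \<circ> fc j \<eta>) y1"
          unfolding fac_def 1(3) by (rule app_app) (use Y j 1 in auto)
        moreover have "bm n n (tau i c \<circ> fc j \<eta>)" by (rule bm_comp[OF bm_fc[OF j] bm_tau[OF 1(1)]])
        ultimately show ?thesis using snat 1(2) by auto
      qed
      moreover have "p (Suc n) ?t = y"
        using cubical_map_app[OF p bm_tau[OF 1(1)] sT[OF 1(2)]] sp[OF _ 1(2)] 1(3) by simp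
      moreover have "?t \<in> cubes T (Suc n)" using T 1 sT by simp
      moreover have "?t = app T (Suc n) n (tau i' c') (s n y2)"
        if "tau_ok n i' c'" "y2 \<in> cubes Y n" "y = app Y (Suc n) n (tau i' c') y2" for i' c' y2
        by (rule degenerate_unique[OF Y T sn 1(2) that(2) 1(1) that(1)]) (use 1(3) that(3) in simp)
      ultimately have "P y ?t" unfolding P_def by blast
      then show ?thesis by blast
    next
      case False
      have "fam T (Suc n) n (\<lambda>j \<eta>. s n (fac Y n j \<eta> y))"
        unfolding fam_def
      proof (intro conjI allI impI)
        fix j \<eta> assume "j < Suc n" then show "s n (fac Y n j \<eta> y) \<in> cubes T n" using Y y sT by simp
      next
        fix j i \<epsilon> \<eta> assume j: "j < Suc n" "i < j"
        then obtain n' where n': "n = Suc n'" by (cases n) auto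
        have nf: "fac T n' k \<theta> (s n z) = s n' (fac Y n' k \<theta> z)" if "k \<le> n'" "z \<in> cubes Y n" for k \<theta> z
          using snat[of n' "fc k \<theta>" z] that n' by (simp add: fac_def)
        show "fac T (n - 1) i \<epsilon> (s n (fac Y n j \<eta> y)) = fac T (n - 1) (j - 1) \<eta> (s n (fac Y n i \<epsilon> y))"
          using j y Y fac_fac[OF Y j(2), of n' y \<epsilon> \<eta>] unfolding n' by (simp add: nf[unfolded n'])
      qed
      moreover have "p n (s n (fac Y n j \<eta> y)) = fac Y n j \<eta> y" if "j < Suc n" for j \<eta>
        using sp Y y that by simp
      ultimately obtain t where "t \<in> cubes T (Suc n)" "\<forall>j<Suc n. \<forall>\<eta>. fac T n j \<eta> t = s n (fac Y n j \<eta> y)" "p (Suc n) t = y"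
        using lift[OF y, of "\<lambda>j \<eta>. s n (fac Y n j \<eta> y)"] by auto
      then have "P y t" unfolding P_def using False by auto
      then show ?thesis by blast
    qed
    then obtain t where t: "\<And>y. y \<in> cubes Y (Suc n) \<Longrightarrow> P y (t y)" by metis
    define s' where "s' = s(Suc n := t)"
    have eq: "s' k = s k" if "k \<le> n" for k using that by (simp add: s'_def)
    have "natural_upto n Y T s'" using sn unfolding natural_upto_def by (simp add: eq)
    then have "natural_upto (Suc n) Y T s'"
    proof (rule natural_upto_Suc[OF Y T])
      fix y i c assume *: "y \<in> cubes Y n" "tau_ok n i c"
      then have "app Y (Suc n) n (tau i c) y \<in> cubes Y (Suc n)" using Y by simp
      from t[OF this] * show "s' (Suc n) (app Y (Suc n) n (tau i c) y) = app T (Suc n) n (tau i c) (s' n y)"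
        unfolding P_def by (simp add: s'_def)
    qed (use t in \<open>auto simp: P_def s'_def\<close>)
    moreover have "p k (s' k y) = y" if "k \<le> Suc n" "y \<in> cubes Y k" for k y
      using that t sp by (cases "k = Suc n") (auto simp: s'_def P_def)
    ultimately show ?thesis using eq unfolding good_def by blast
  qed
  \<comment> \<open>Each stage agrees with the previous one in the old dimensions, so the diagonal
    is natural with respect to morphisms between arbitrary dimensions.\<close>
  obtain S where S: "\<And>n. good n (S n)" "\<And>n. \<forall>k\<le>n. S (Suc n) k = S n k"
    using dependent_nat_choice[of good "\<lambda>n s s'. \<forall>k\<le>n. s' k = s k"] base step by metis
  have stable: "S m n = S n n" if "n \<le> m" for m n
    using that by (induction m rule: dec_induct) (auto simp: S(2))
  have "cubical_map Y T (\<lambda>n. S n n)"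
  proof (rule cubical_mapI)
    fix n y assume "y \<in> cubes Y n" then show "S n n y \<in> cubes T n"
      using S(1)[of n] by (auto simp: good_def natural_upto_def)
  next
    fix m n \<phi> y assume *: "bm m n \<phi>" "y \<in> cubes Y n"
    have "S (max m n) m (app Y m n \<phi> y) = app T m n \<phi> (S (max m n) n y)"
      using S(1)[of "max m n"] * unfolding good_def natural_upto_def by (meson max.cobounded1 max.cobounded2)
    then show "S m m (app Y m n \<phi> y) = app T m n \<phi> (S n n y)"
      using stable[of m "max m n"] stable[of n "max m n"] by simp
  qed
  moreover have "p n (S n n y) = y" if "y \<in> cubes Y n" for n y
    using S(1)[of n] that by (auto simp: good_def)
  ultimately show ?thesis by blast
qed

section \<open>Homotopies relative to the boundary\<close>

lemma akan_cubical: "akan X \<Longrightarrow> cubical_set X"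
  by (simp add: akan_def)

lemma akan_fill:
  assumes "akan X" "i \<le> n"
    "\<And>j \<eta>. j \<le> n \<Longrightarrow> (j, \<eta>) \<noteq> (i, \<epsilon>) \<Longrightarrow> u j \<eta> \<in> cubes X n"
    "\<And>j k \<eta> \<theta>. j \<le> n \<Longrightarrow> k < j \<Longrightarrow> (j, \<eta>) \<noteq> (i, \<epsilon>) \<Longrightarrow> (k, \<theta>) \<noteq> (i, \<epsilon>) \<Longrightarrow>
        fac X (n - 1) k \<theta> (u j \<eta>) = fac X (n - 1) (j - 1) \<eta> (u k \<theta>)"
  obtains x where "x \<in> cubes X (Suc n)" "\<And>j \<eta>. j \<le> n \<Longrightarrow> (j, \<eta>) \<noteq> (i, \<epsilon>) \<Longrightarrow> fac X n j \<eta> x = u j \<eta>"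
proof -
  have "\<exists>x\<in>cubes X (Suc n). \<forall>j\<le>n. \<forall>\<eta>. (j, \<eta>) \<noteq> (i, \<epsilon>) \<longrightarrow> fac X n j \<eta> x = u j \<eta>"
    using assms unfolding akan_def by presburger
  then show ?thesis using that by blast
qed

lemma fam_in: "fam X n k u \<Longrightarrow> j < n \<Longrightarrow> u j \<eta> \<in> cubes X k"
  by (simp add: fam_def)

lemma fam_fac: "fam X n k u \<Longrightarrow> j < n \<Longrightarrow> i < j \<Longrightarrow> fac X (k - 1) i \<epsilon> (u j \<eta>) = fac X (k - 1) (j - 1) \<eta> (u i \<epsilon>)"
  by (simp add: fam_def)

lemma famI:
  assumes "\<And>j \<eta>. j < n \<Longrightarrow> u j \<eta> \<in> cubes X k"
    "\<And>i j \<epsilon> \<eta>. j < n \<Longrightarrow> i < j \<Longrightarrow> fac X (k - 1) i \<epsilon> (u j \<eta>) = fac X (k - 1) (j - 1) \<eta> (u i \<epsilon>)"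
  shows "fam X n k u"
  using assms by (simp add: fam_def)

lemma fam_faces:
  assumes X: "cubical_set X" and x: "x \<in> cubes X (Suc k)" and n: "n \<le> Suc k"
  shows "fam X n k (\<lambda>j \<eta>. fac X k j \<eta> x)"
  by (rule famI) (use assms fac_fac_pred[OF X x] in auto)

lemma fam_map:
  assumes f: "cubical_map X Y f" and u: "fam X n k u" and k: "n \<le> Suc k"
  shows "fam Y n k (\<lambda>j \<eta>. f k (u j \<eta>))"
proof (rule famI)
  fix i j \<epsilon> \<eta> assume j: "j < n" "i < j"
  moreover from this obtain k' where k': "k = Suc k'" using k by (cases k) auto
  ultimately have "fac Y k' i \<epsilon> (f k (u j \<eta>)) = f k' (fac X k' i \<epsilon> (u j \<eta>))"
    "fac Y k' (j - 1) \<eta> (f k (u i \<epsilon>)) = f k' (fac X k' (j - 1) \<eta> (u i \<epsilon>))"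
    using map_fac[OF f, of i k' "u j \<eta>" \<epsilon>] map_fac[OF f, of "j - 1" k' "u i \<epsilon>" \<eta>] fam_in[OF u, of j \<eta>] fam_in[OF u, of i \<epsilon>] k
    by auto
  then show "fac Y (k - 1) i \<epsilon> (f k (u j \<eta>)) = fac Y (k - 1) (j - 1) \<eta> (f k (u i \<epsilon>))"
    using fam_fac[OF u j] k' by simp
qed (use u in \<open>auto intro: cubical_map_in[OF f] fam_in\<close>)

text \<open>The ends in the last direction of the homotopy \<open>U\<close> on the boundary of an \<open>n\<close>-cube.\<close>

definition fend :: "'a cubical \<Rightarrow> nat \<Rightarrow> bool \<Rightarrow> (nat \<Rightarrow> bool \<Rightarrow> 'a) \<Rightarrow> nat \<Rightarrow> bool \<Rightarrow> 'a" where
  "fend X n \<epsilon> U j \<eta> = fac X (n - 1) (n - 1) \<epsilon> (U j \<eta>)"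

lemma fam_fend:
  assumes X: "cubical_set X" and U: "fam X n n U"
  shows "fam X n (n - 1) (fend X n \<epsilon> U)"
proof (rule famI)
  fix j \<eta> assume j: "j < n"
  then obtain m where n: "n = Suc m" by (cases n) auto
  show "fend X n \<epsilon> U j \<eta> \<in> cubes X (n - 1)" using fam_in[OF U j] X by (simp add: fend_def n)
next
  fix i j \<theta> \<eta> assume j: "j < n" "i < j"
  then obtain m where n: "n = Suc (Suc m)" by (cases n; cases "n - 1") auto
  have "fac X m i \<theta> (fac X (Suc m) (Suc m) \<epsilon> (U j \<eta>)) = fac X m m \<epsilon> (fac X (Suc m) i \<theta> (U j \<eta>))"
    using fac_fac[OF X, of i "Suc m" m "U j \<eta>"] fam_in[OF U j(1)] j by (simp add: n)
  also have "fac X (Suc m) i \<theta> (U j \<eta>) = fac X (Suc m) (j - 1) \<eta> (U i \<theta>)" using fam_fac[OF U j] by (simp add: n)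
  also have "fac X m m \<epsilon> \<dots> = fac X m (j - 1) \<eta> (fac X (Suc m) (Suc m) \<epsilon> (U i \<theta>))"
    using fac_fac[OF X, of "j - 1" "Suc m" m "U i \<theta>"] fam_in[OF U, of i] j by (simp add: n)
  finally show "fac X (n - 1 - 1) i \<theta> (fend X n \<epsilon> U j \<eta>) = fac X (n - 1 - 1) (j - 1) \<eta> (fend X n \<epsilon> U i \<theta>)"
    by (simp add: fend_def n)
qed

text \<open>The homotopy on the boundary and the cube w at one end form an open box whose missing
  face is the other end in the last direction.\<close>

lemma homotopy_extension:
  assumes X: "akan X" and U: "fam X n n U" and w: "w \<in> cubes X n"
    and wU: "\<And>j \<eta>. j < n \<Longrightarrow> fac X (n - 1) j \<eta> w = fend X n \<epsilon> U j \<eta>"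
  obtains W where "W \<in> cubes X (Suc n)" "fac X n n \<epsilon> W = w" "\<And>j \<eta>. j < n \<Longrightarrow> fac X n j \<eta> W = U j \<eta>"
    "\<And>j \<eta>. j < n \<Longrightarrow> fac X (n - 1) j \<eta> (fac X n n (\<not> \<epsilon>) W) = fend X n (\<not> \<epsilon>) U j \<eta>"
proof -
  note cX = akan_cubical[OF X]
  obtain W where W: "W \<in> cubes X (Suc n)"
    "\<And>j \<eta>. j \<le> n \<Longrightarrow> (j, \<eta>) \<noteq> (n, \<not> \<epsilon>) \<Longrightarrow> fac X n j \<eta> W = (if j < n then U j \<eta> else w)"
  proof (rule akan_fill[OF X, of n n "\<not> \<epsilon>" "\<lambda>j \<eta>. if j < n then U j \<eta> else w"])
    fix j k \<eta> \<theta> assume *: "j \<le> n" "k < j" "(j, \<eta>) \<noteq> (n, \<not> \<epsilon>)" "(k, \<theta>) \<noteq> (n, \<not> \<epsilon>)"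
    show "fac X (n - 1) k \<theta> (if j < n then U j \<eta> else w) = fac X (n - 1) (j - 1) \<eta> (if k < n then U k \<theta> else w)"
    proof (cases "j < n")
      case True then show ?thesis using fam_fac[OF U] * by simp
    next
      case False then show ?thesis using wU * by (auto simp: fend_def)
    qed
  qed (use U w in \<open>auto intro: fam_in\<close>)
  have "fac X (n - 1) j \<eta> (fac X n n (\<not> \<epsilon>) W) = fend X n (\<not> \<epsilon>) U j \<eta>" if j: "j < n" for j \<eta>
  proof -
    obtain m where n: "n = Suc m" using j by (cases n) auto
    show ?thesis using fac_fac[OF cX j, of m W \<eta> "\<not> \<epsilon>"] W j by (simp add: fend_def n)
  qed
  then show ?thesis using that[OF W(1)] W(2) by auto
qed

text \<open>The direction of a homotopy is always the last one, as in \<open>X \<otimes> \<box>^1\<close> and in \<open>\<Omega>^n\<close>.\<close>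

definition rh :: "'a cubical \<Rightarrow> nat \<Rightarrow> 'a \<Rightarrow> 'a \<Rightarrow> bool" where
  "rh X n a b \<longleftrightarrow> a \<in> cubes X n \<and> b \<in> cubes X n \<and>
     (\<exists>h\<in>cubes X (Suc n). fac X n n False h = a \<and> fac X n n True h = b \<and>
        (\<forall>j<n. \<forall>\<eta>. fac X n j \<eta> h = ldeg X (n - 1) (fac X (n - 1) j \<eta> a)))"

lemma rh_bdry:
  assumes X: "cubical_set X" and r: "rh X n a b" and j: "j < n"
  shows "fac X (n - 1) j \<eta> a = fac X (n - 1) j \<eta> b"
proof -
  obtain h where h: "h \<in> cubes X (Suc n)" "fac X n n False h = a" "fac X n n True h = b"
     "\<And>j \<eta>. j < n \<Longrightarrow> fac X n j \<eta> h = ldeg X (n - 1) (fac X (n - 1) j \<eta> a)" and a: "a \<in> cubes X n"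
    using r unfolding rh_def by blast
  have "fac X (n - 1) j \<eta> a \<in> cubes X (n - 1)" using X a j by (cases n) auto
  then have "fac X (n - 1) j \<eta> (fac X n n True h) = fac X (n - 1) j \<eta> a"
    using fac_fac_pred[OF X h(1) j] h(4)[OF j] by (simp add: fac_ldeg_last[OF X])
  then show ?thesis using h(3) by simp
qed

lemma rh_refl:
  assumes X: "cubical_set X" and a: "a \<in> cubes X n"
  shows "rh X n a a"
proof -
  show ?thesis unfolding rh_def using X a fac_ldeg_pred[OF X a] fac_ldeg_last
    by (intro conjI bexI[of _ "ldeg X n a"]) auto
qed

text \<open>Both ways of pasting a homotopy relative to the boundary onto an end of a prism are open box
  fillings in the directions: prism, prism height, homotopy.\<close>

lemma rh_other_end:
  assumes Y: "akan Y" and PQ: "P \<in> cubes Y (Suc n)" "Q \<in> cubes Y (Suc n)"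
    and sides: "\<And>j \<eta>. j < n \<Longrightarrow> fac Y n j \<eta> P = fac Y n j \<eta> Q"
    and r: "rh Y n (fac Y n n \<epsilon> P) (fac Y n n \<epsilon> Q)"
  shows "rh Y n (fac Y n n (\<not> \<epsilon>) P) (fac Y n n (\<not> \<epsilon>) Q)"
proof -
  note cY = akan_cubical[OF Y]
  obtain h where h: "h \<in> cubes Y (Suc n)" "fac Y n n False h = fac Y n n \<epsilon> P" "fac Y n n True h = fac Y n n \<epsilon> Q"
     "\<And>j \<eta>. j < n \<Longrightarrow> fac Y n j \<eta> h = ldeg Y (n - 1) (fac Y (n - 1) j \<eta> (fac Y n n \<epsilon> P))"
    using r unfolding rh_def by blast
  \<comment> \<open>The common sides are degenerate along the homotopy, the given homotopy h closes
    the prism at the end \<open>\<epsilon>\<close>, and P and Q are the two ends of the last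
    direction. The missing face, at the other end of the prism, is the desired homotopy.\<close>
  define u where "u j \<eta> = (if j < n then ldeg Y n (fac Y n j \<eta> P) else if j = n then h else if \<eta> then Q else P)" for j \<eta>
  have uin: "u j \<eta> \<in> cubes Y (Suc n)" if "j \<le> Suc n" for j \<eta>
    using that PQ h(1) cY by (auto simp: u_def)
  note PP = fac_fac_pred[OF cY PQ(1)]
  have degside: "fac Y n i \<theta> (ldeg Y n (fac Y n j \<eta> P)) = ldeg Y (n - 1) (fac Y (n - 1) i \<theta> (fac Y n j \<eta> P))"
    if "i < n" "j \<le> n" for i j \<theta> \<eta> using that fac_ldeg_pred[OF cY] PQ(1) cY by simp
  obtain H where H: "H \<in> cubes Y (Suc (Suc n))"
    "\<And>j \<eta>. j \<le> Suc n \<Longrightarrow> (j, \<eta>) \<noteq> (n, \<not> \<epsilon>) \<Longrightarrow> fac Y (Suc n) j \<eta> H = u j \<eta>"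
  proof (rule akan_fill[OF Y, of n "Suc n" "\<not> \<epsilon>" u])
    fix j k \<eta> \<theta> assume *: "j \<le> Suc n" "k < j" "(j, \<eta>) \<noteq> (n, \<not> \<epsilon>)" "(k, \<theta>) \<noteq> (n, \<not> \<epsilon>)"
    consider "j < n" | "j = n" "\<eta> = \<epsilon>" | "j = Suc n" "k < n" | "j = Suc n" "k = n" "\<theta> = \<epsilon>" using * by force
    then show "fac Y (Suc n - 1) k \<theta> (u j \<eta>) = fac Y (Suc n - 1) (j - 1) \<eta> (u k \<theta>)"
    proof cases
      case 1 then show ?thesis using * PP[of k j] by (simp add: u_def degside)
    next
      case 2 then show ?thesis using * PP[of k n] h(4)[of k] degside[of "n - 1" k] by (simp add: u_def)
    next
      case 3 then show ?thesis using sides cY PQ by (simp add: u_def fac_ldeg_last)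
    next
      case 4 then show ?thesis using h(2,3) by (simp add: u_def)
    qed
  qed (use uin in auto)
  let ?h = "fac Y (Suc n) n (\<not> \<epsilon>) H"
  have "?h \<in> cubes Y (Suc n)" using H(1) cY by simp
  moreover have "fac Y n n \<eta> ?h = fac Y n n (\<not> \<epsilon>) (u (Suc n) \<eta>)" for \<eta>
    using fac_fac[OF cY, of n "Suc n" n H "\<not> \<epsilon>" \<eta>] H by simp
  moreover have "fac Y n j \<eta> ?h = ldeg Y (n - 1) (fac Y (n - 1) j \<eta> (fac Y n n (\<not> \<epsilon>) P))" if j: "j < n" for j \<eta>
    using fac_fac[OF cY, of j n n H \<eta> "\<not> \<epsilon>"] H j PP[of j n] degside[of "n - 1" j] by (simp add: u_def)
  ultimately show ?thesis using PQ cY unfolding rh_def by (auto simp: u_def intro!: bexI[of _ ?h])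
qed

lemma rh_paste:
  assumes Y: "akan Y" and Q: "Q \<in> cubes Y (Suc n)" and r: "rh Y n a (fac Y n n False Q)"
  obtains P where "P \<in> cubes Y (Suc n)" "fac Y n n False P = a" "fac Y n n True P = fac Y n n True Q"
    "\<And>j \<eta>. j < n \<Longrightarrow> fac Y n j \<eta> P = fac Y n j \<eta> Q"
proof -
  note cY = akan_cubical[OF Y]
  let ?q = "fac Y n n True Q"
  have q: "?q \<in> cubes Y n" using Q cY by simp
  obtain h where h: "h \<in> cubes Y (Suc n)" "fac Y n n False h = a" "fac Y n n True h = fac Y n n False Q"
     "\<And>j \<eta>. j < n \<Longrightarrow> fac Y n j \<eta> h = ldeg Y (n - 1) (fac Y (n - 1) j \<eta> (fac Y n n False Q))"
    using r rh_bdry[OF cY r] unfolding rh_def by metis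
  \<comment> \<open>Here the missing face is the end \<open>False\<close> of the last direction,
    opposite to Q. In the height direction h replaces the lower end by a, and the constant homotopy
    keeps the upper end.\<close>
  define u where "u j \<eta> = (if j < n then ldeg Y n (fac Y n j \<eta> Q) else if j = n then (if \<eta> then ldeg Y n ?q else h) else Q)" for j \<eta>
  have uin: "u j \<eta> \<in> cubes Y (Suc n)" if "j \<le> Suc n" for j \<eta>
    using that Q h(1) cY by (auto simp: u_def)
  note QQ = fac_fac_pred[OF cY Q]
  have degside: "fac Y n i \<theta> (ldeg Y n (fac Y n j \<eta> Q)) = ldeg Y (n - 1) (fac Y (n - 1) i \<theta> (fac Y n j \<eta> Q))"
    if "i < n" "j \<le> n" for i j \<theta> \<eta> using that fac_ldeg_pred[OF cY] Q cY by simp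
  obtain H where H: "H \<in> cubes Y (Suc (Suc n))"
    "\<And>j \<eta>. j \<le> Suc n \<Longrightarrow> (j, \<eta>) \<noteq> (Suc n, False) \<Longrightarrow> fac Y (Suc n) j \<eta> H = u j \<eta>"
  proof (rule akan_fill[OF Y, of "Suc n" "Suc n" False u])
    fix j k \<eta> \<theta> assume *: "j \<le> Suc n" "k < j" "(j, \<eta>) \<noteq> (Suc n, False)" "(k, \<theta>) \<noteq> (Suc n, False)"
    consider "j < n" | "j = n" | "j = Suc n" "k < n" "\<eta>" | "j = Suc n" "k = n" "\<eta>" using * by fastforce
    then show "fac Y (Suc n - 1) k \<theta> (u j \<eta>) = fac Y (Suc n - 1) (j - 1) \<eta> (u k \<theta>)"
    proof cases
      case 1 then show ?thesis using * QQ[of k j] by (simp add: u_def degside)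
    next
      case 2
      then show ?thesis using * QQ[of k n] h(4)[of k] degside[of "n - 1" k] degside[of k n] by (auto simp: u_def)
    next
      case 3 then show ?thesis using cY Q by (simp add: u_def fac_ldeg_last)
    next
      case 4 then show ?thesis using h(2,3) cY q by (auto simp: u_def fac_ldeg_last)
    qed
  qed (use uin in auto)
  let ?P = "fac Y (Suc n) (Suc n) False H"
  have P: "?P \<in> cubes Y (Suc n)" using H(1) cY by simp
  have "fac Y n j \<eta> ?P = fac Y n n False (u j \<eta>)" if "j \<le> n" for j \<eta>
    using fac_fac[OF cY, of j "Suc n" n H \<eta> False] H that by simp
  then show ?thesis
    using that[OF P] h(2) cY q Q by (simp add: u_def fac_ldeg_last)
qed

text \<open>The two homotopies are themselves prisms with equal sides and a common end a, so the
  constant homotopy at that end transfers to the other one.\<close>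

lemma rh_euclid:
  assumes Y: "akan Y" and ab: "rh Y n a b" and ac: "rh Y n a c"
  shows "rh Y n b c"
proof -
  obtain h where h: "h \<in> cubes Y (Suc n)" "fac Y n n False h = a" "fac Y n n True h = b"
     "\<forall>j<n. \<forall>\<eta>. fac Y n j \<eta> h = ldeg Y (n - 1) (fac Y (n - 1) j \<eta> a)"
    using ab unfolding rh_def by blast
  obtain k where k: "k \<in> cubes Y (Suc n)" "fac Y n n False k = a" "fac Y n n True k = c"
     "\<forall>j<n. \<forall>\<eta>. fac Y n j \<eta> k = ldeg Y (n - 1) (fac Y (n - 1) j \<eta> a)"
    using ac unfolding rh_def by blast
  have "rh Y n a a" using rh_refl[OF akan_cubical[OF Y]] ab by (simp add: rh_def)
  then show ?thesis using rh_other_end[OF Y h(1) k(1), of False] h k by simp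
qed

lemma rh_sym:
  assumes Y: "akan Y" and r: "rh Y n a b"
  shows "rh Y n b a"
proof -
  have "a \<in> cubes Y n" using r by (simp add: rh_def)
  then show ?thesis by (rule rh_euclid[OF Y r rh_refl[OF akan_cubical[OF Y]]])
qed

lemma rh_trans: "akan Y \<Longrightarrow> rh Y n a b \<Longrightarrow> rh Y n b c \<Longrightarrow> rh Y n a c"
  by (rule rh_euclid[OF _ rh_sym])

section \<open>Lifting problems and weak equivalences\<close>

definition lift_problem :: "'a cubical \<Rightarrow> 'b cubical \<Rightarrow> (nat \<Rightarrow> 'a \<Rightarrow> 'b) \<Rightarrow> nat \<Rightarrow> (nat \<Rightarrow> bool \<Rightarrow> 'a) \<Rightarrow> 'b \<Rightarrow> bool" where
  "lift_problem X Y f n u w \<longleftrightarrow> fam X n (n - 1) u \<and> w \<in> cubes Y n \<and>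
     (\<forall>j<n. \<forall>\<eta>. fac Y (n - 1) j \<eta> w = f (n - 1) (u j \<eta>))"

definition lift_solution :: "'a cubical \<Rightarrow> 'b cubical \<Rightarrow> (nat \<Rightarrow> 'a \<Rightarrow> 'b) \<Rightarrow> nat \<Rightarrow> (nat \<Rightarrow> bool \<Rightarrow> 'a) \<Rightarrow> 'b \<Rightarrow> bool" where
  "lift_solution X Y f n u w \<longleftrightarrow>
     (\<exists>v\<in>cubes X n. (\<forall>j<n. \<forall>\<eta>. fac X (n - 1) j \<eta> v = u j \<eta>) \<and> rh Y n (f n v) w)"

text \<open>Dimension 0 is included: there the boundary is empty, and the condition says that every
  vertex of Y is joined by an edge to a vertex in the image.\<close>

definition weq :: "'a cubical \<Rightarrow> 'b cubical \<Rightarrow> (nat \<Rightarrow> 'a \<Rightarrow> 'b) \<Rightarrow> bool" where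
  "weq X Y f \<longleftrightarrow> (\<forall>n u w. lift_problem X Y f n u w \<longrightarrow> lift_solution X Y f n u w)"

lemma weq_id: "cubical_set X \<Longrightarrow> weq X X (\<lambda>n. id)"
  unfolding weq_def lift_problem_def lift_solution_def by (auto intro: rh_refl)

text \<open>A homotopy relative to the boundary from \<open>f n a\<close> to \<open>f n b\<close> is
  an (n+1)-cube whose boundary is the image of one in X, with ends a, b and degenerate sides. A
  filler of the latter is the homotopy sought. Since \<open>fill\<close> asks for fillers alone, the
  lemma applies to maps not yet known to be weak equivalences.\<close>

lemma lift_rh:
  assumes X: "cubical_set X" and Y: "cubical_set Y" and f: "cubical_map X Y f"
    and fill: "\<And>n u w. lift_problem X Y f n u w \<Longrightarrow> \<exists>v\<in>cubes X n. \<forall>j<n. \<forall>\<eta>. fac X (n - 1) j \<eta> v = u j \<eta>"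
    and a: "a \<in> cubes X n" and b: "b \<in> cubes X n"
    and ab: "\<And>j \<eta>. j < n \<Longrightarrow> fac X (n - 1) j \<eta> a = fac X (n - 1) j \<eta> b"
    and r: "rh Y n (f n a) (f n b)"
  shows "rh X n a b"
proof -
  obtain z where z: "z \<in> cubes Y (Suc n)" "fac Y n n False z = f n a" "fac Y n n True z = f n b"
     "\<And>j \<eta>. j < n \<Longrightarrow> fac Y n j \<eta> z = ldeg Y (n - 1) (fac Y (n - 1) j \<eta> (f n a))"
    using r unfolding rh_def by blast
  define u where "u j \<eta> = (if j < n then ldeg X (n - 1) (fac X (n - 1) j \<eta> a) else if \<eta> then b else a)" for j \<eta>
  have uin: "u j \<eta> \<in> cubes X n" for j \<eta>
    using a b X by (cases n) (auto simp: u_def)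
  have uc: "u j \<eta> = fac X n j \<eta> (ldeg X n a)" if "j < n" for j \<eta>
    using that fac_ldeg_pred[OF X a] by (simp add: u_def)
  have "fam X (Suc n) n u"
  proof (rule famI)
    fix i j \<epsilon> \<eta> assume j: "j < Suc n" "i < j"
    show "fac X (n - 1) i \<epsilon> (u j \<eta>) = fac X (n - 1) (j - 1) \<eta> (u i \<epsilon>)"
    proof (cases "j < n")
      case True
      then show ?thesis using fam_fac[OF fam_faces[OF X, of "ldeg X n a" n "Suc n"], of j i \<epsilon> \<eta>] uc j X a by simp
    next
      case False
      then have "j = n" using j by simp
      then show ?thesis using ab[of i \<epsilon>] j X a b by (cases n) (auto simp: u_def fac_ldeg_last)
    qed
  qed (rule uin)
  moreover have "fac Y n j \<eta> z = f n (u j \<eta>)" if "j < Suc n" for j \<eta>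
  proof (cases "j < n")
    case True
    then obtain m where n: "n = Suc m" by (cases n) auto
    show ?thesis
      using z(4)[OF True] map_fac[OF f, of j m a \<eta>] map_ldeg[OF f, of "fac X m j \<eta> a" m] a X True by (simp add: u_def n)
  next
    case False then show ?thesis using that z by (auto simp: u_def less_Suc_eq)
  qed
  ultimately have "lift_problem X Y f (Suc n) u z" using z(1) by (simp add: lift_problem_def)
  from fill[OF this] obtain v where "v \<in> cubes X (Suc n)" "\<And>j \<eta>. j < Suc n \<Longrightarrow> fac X n j \<eta> v = u j \<eta>" by auto
  then show ?thesis unfolding rh_def using a b by (auto simp: u_def intro!: bexI[of _ v])
qed

text \<open>Solving the problem for the composite gives v such that g f v and g w are homotopic
  relative to the boundary; \<open>lift_rh\<close> for g removes g. The hypothesis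
  \<open>inj\<close> on g is the part of a weak equivalence that a homotopy left inverse of g
  provides.\<close>

lemma weq_cancel:
  assumes X: "akan X" and Y: "akan Y" and Z: "akan Z" and f: "cubical_map X Y f" and g: "cubical_map Y Z g"
    and gf: "weq X Z (\<lambda>n. g n \<circ> f n)"
    and inj: "\<And>n u w. lift_problem Y Z g n u w \<Longrightarrow> \<exists>v\<in>cubes Y n. \<forall>j<n. \<forall>\<eta>. fac Y (n - 1) j \<eta> v = u j \<eta>"
  shows "weq X Y f"
  unfolding weq_def
proof (intro allI impI)
  fix n u w assume P: "lift_problem X Y f n u w"
  note cX = akan_cubical[OF X] and cY = akan_cubical[OF Y] and cZ = akan_cubical[OF Z]
  have u: "fam X n (n - 1) u" and w: "w \<in> cubes Y n" and wu: "\<And>j \<eta>. j < n \<Longrightarrow> fac Y (n - 1) j \<eta> w = f (n - 1) (u j \<eta>)"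
    using P by (auto simp: lift_problem_def)
  have "lift_problem X Z (\<lambda>n. g n \<circ> f n) n u (g n w)"
    unfolding lift_problem_def
    using u wu cubical_map_in[OF g w] map_fac_pred[OF g w] by simp
  then obtain v where v: "v \<in> cubes X n" "\<And>j \<eta>. j < n \<Longrightarrow> fac X (n - 1) j \<eta> v = u j \<eta>" and r: "rh Z n (g n (f n v)) (g n w)"
    using gf unfolding weq_def lift_solution_def by fastforce
  have fv: "f n v \<in> cubes Y n" by (rule cubical_map_in[OF f v(1)])
  have bd: "fac Y (n - 1) j \<eta> (f n v) = fac Y (n - 1) j \<eta> w" if j: "j < n" for j \<eta>
    using map_fac_pred[OF f v(1) j] wu[OF j] v(2)[OF j] by simp
  have "rh Y n (f n v) w" by (rule lift_rh[OF cY cZ g inj fv w bd r])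
  then show "lift_solution X Y f n u w" unfolding lift_solution_def using v by blast
qed

lemma weq_fill:
  "weq X Y f \<Longrightarrow> lift_problem X Y f n u w \<Longrightarrow> \<exists>v\<in>cubes X n. \<forall>j<n. \<forall>\<eta>. fac X (n - 1) j \<eta> v = u j \<eta>"
  unfolding weq_def lift_solution_def by blast

text \<open>A map out of the product of X with the interval, described by its values on the prisms
  over the cubes of X. Indexing both ends by a Boolean allows arguments that run in either direction
  along the homotopy.\<close>

definition natural_homotopy ::
    "'a cubical \<Rightarrow> 'b cubical \<Rightarrow> (nat \<Rightarrow> 'a \<Rightarrow> 'b) \<Rightarrow> (bool \<Rightarrow> nat \<Rightarrow> 'a \<Rightarrow> 'b) \<Rightarrow> bool" where
  "natural_homotopy X Y K f \<longleftrightarrow> (\<forall>n. \<forall>x\<in>cubes X n. K n x \<in> cubes Y (Suc n) \<and> (\<forall>\<epsilon>. fac Y n n \<epsilon> (K n x) = f \<epsilon> n x)) \<and>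
     (\<forall>m n \<phi>. bm m n \<phi> \<longrightarrow> (\<forall>x\<in>cubes X n. K m (app X m n \<phi> x) = app Y (Suc m) (Suc n) (rwhisk m \<phi>) (K n x)))"

lemma natural_homotopy_fac:
  assumes K: "natural_homotopy X Y K f" and x: "x \<in> cubes X (Suc n)" and j: "j \<le> n"
  shows "fac Y (Suc n) j \<eta> (K (Suc n) x) = K n (fac X n j \<eta> x)"
proof -
  have "K n (fac X n j \<eta> x) = app Y (Suc n) (Suc (Suc n)) (rwhisk n (fc j \<eta>)) (K (Suc n) x)"
    using K bm_fc[OF j, of \<eta>] x unfolding natural_homotopy_def fac_def by blast
  also have "app Y (Suc n) (Suc (Suc n)) (rwhisk n (fc j \<eta>)) = app Y (Suc n) (Suc (Suc n)) (fc j \<eta>)"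
    by (rule app_cong) (use j in \<open>simp add: rwhisk_def fc_def min_absorb1 drop_take_append\<close>)
  finally show ?thesis by (simp add: fac_def)
qed

text \<open>Extending K on the boundary over w moves the problem to the other end. For a solution v
  there, the prism K v and the extension Q have the same sides, so \<open>rh_other_end\<close>
  brings the comparison back.\<close>

lemma weq_homotopic:
  assumes X: "akan X" and Y: "akan Y" and f: "\<And>\<epsilon>. cubical_map X Y (f \<epsilon>)"
    and K: "natural_homotopy X Y K f" and W: "weq X Y (f (\<not> \<epsilon>))"
  shows "weq X Y (f \<epsilon>)"
  unfolding weq_def
proof (intro allI impI)
  fix n u w assume P: "lift_problem X Y (f \<epsilon>) n u w"
  note cX = akan_cubical[OF X] and cY = akan_cubical[OF Y]
  have u: "fam X n (n - 1) u" and w: "w \<in> cubes Y n" and wu: "\<And>j \<eta>. j < n \<Longrightarrow> fac Y (n - 1) j \<eta> w = f \<epsilon> (n - 1) (u j \<eta>)"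
    using P by (auto simp: lift_problem_def)
  have Kin: "K m x \<in> cubes Y (Suc m)" and Kend: "fac Y m m \<epsilon>' (K m x) = f \<epsilon>' m x" if "x \<in> cubes X m" for m x \<epsilon>'
    using K that by (auto simp: natural_homotopy_def)
  define U where "U j \<eta> = K (n - 1) (u j \<eta>)" for j \<eta>
  have U: "fam Y n n U"
  proof (rule famI)
    fix j \<eta> assume j: "j < n"
    then show "U j \<eta> \<in> cubes Y n" using Kin[OF fam_in[OF u j]] by (simp add: U_def)
  next
    fix i j \<theta> \<eta> assume j: "j < n" "i < j"
    then obtain m where n: "n = Suc (Suc m)" by (cases n; cases "n - 1") auto
    show "fac Y (n - 1) i \<theta> (U j \<eta>) = fac Y (n - 1) (j - 1) \<eta> (U i \<theta>)"
      using natural_homotopy_fac[OF K, of "u j \<eta>" m i] natural_homotopy_fac[OF K, of "u i \<theta>" m "j - 1"]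
        fam_in[OF u, of j \<eta>] fam_in[OF u, of i \<theta>] fam_fac[OF u j] j
      by (simp add: U_def n)
  qed
  have Uend: "fend Y n \<epsilon>' U j \<eta> = f \<epsilon>' (n - 1) (u j \<eta>)" if "j < n" for \<epsilon>' j \<eta>
    using Kend[OF fam_in[OF u that]] by (simp add: fend_def U_def)
  obtain Q where Q: "Q \<in> cubes Y (Suc n)" "fac Y n n \<epsilon> Q = w" "\<And>j \<eta>. j < n \<Longrightarrow> fac Y n j \<eta> Q = U j \<eta>"
    "\<And>j \<eta>. j < n \<Longrightarrow> fac Y (n - 1) j \<eta> (fac Y n n (\<not> \<epsilon>) Q) = fend Y n (\<not> \<epsilon>) U j \<eta>"
    by (rule homotopy_extension[OF Y U w, of \<epsilon>]) (use wu Uend in auto)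
  have "lift_problem X Y (f (\<not> \<epsilon>)) n u (fac Y n n (\<not> \<epsilon>) Q)"
    unfolding lift_problem_def using u Q Uend cY by auto
  then obtain v where v: "v \<in> cubes X n" "\<And>j \<eta>. j < n \<Longrightarrow> fac X (n - 1) j \<eta> v = u j \<eta>"
    and r: "rh Y n (f (\<not> \<epsilon>) n v) (fac Y n n (\<not> \<epsilon>) Q)"
    using W unfolding weq_def lift_solution_def by blast
  have "rh Y n (fac Y n n (\<not> (\<not> \<epsilon>)) (K n v)) (fac Y n n (\<not> (\<not> \<epsilon>)) Q)"
  proof (rule rh_other_end[OF Y Kin[OF v(1)] Q(1)])
    fix j \<eta> assume j: "j < n"
    then obtain m where n: "n = Suc m" by (cases n) auto
    show "fac Y n j \<eta> (K n v) = fac Y n j \<eta> Q"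
      using natural_homotopy_fac[OF K, of v m j \<eta>] v Q(3)[OF j] j by (simp add: n U_def)
  qed (use r Kend v in simp)
  then have "rh Y n (f \<epsilon> n v) w" using Kend v Q by simp
  then show "lift_solution X Y (f \<epsilon>) n u w" unfolding lift_solution_def using v by blast
qed

text \<open>The image of U is extended over w in Y to move the problem, and U is extended over the
  resulting solution in X to move the answer back. The image of the second extension and the first
  one are prisms with equal sides.\<close>

lemma solution_deform:
  assumes X: "akan X" and Y: "akan Y" and f: "cubical_map X Y f" and U: "fam X n n U"
    and G: "\<And>w. lift_problem X Y f n (fend X n \<epsilon> U) w \<Longrightarrow> lift_solution X Y f n (fend X n \<epsilon> U) w"
    and P: "lift_problem X Y f n (fend X n (\<not> \<epsilon>) U) w"
  shows "lift_solution X Y f n (fend X n (\<not> \<epsilon>) U) w"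
proof -
  note cX = akan_cubical[OF X] and cY = akan_cubical[OF Y]
  define V where "V j \<eta> = f n (U j \<eta>)" for j \<eta>
  have V: "fam Y n n V" unfolding V_def by (rule fam_map[OF f U]) simp
  have Vend: "fend Y n \<epsilon>' V j \<eta> = f (n - 1) (fend X n \<epsilon>' U j \<eta>)" if j: "j < n" for \<epsilon>' j \<eta>
  proof -
    obtain m where n: "n = Suc m" using j by (cases n) auto
    show ?thesis using map_fac[OF f, of m m "U j \<eta>"] fam_in[OF U j] by (simp add: fend_def V_def n)
  qed
  have w: "w \<in> cubes Y n" and wu: "\<And>j \<eta>. j < n \<Longrightarrow> fac Y (n - 1) j \<eta> w = f (n - 1) (fend X n (\<not> \<epsilon>) U j \<eta>)"
    using P by (auto simp: lift_problem_def)
  obtain Q where Q: "Q \<in> cubes Y (Suc n)" "fac Y n n (\<not> \<epsilon>) Q = w" "\<And>j \<eta>. j < n \<Longrightarrow> fac Y n j \<eta> Q = V j \<eta>"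
    "\<And>j \<eta>. j < n \<Longrightarrow> fac Y (n - 1) j \<eta> (fac Y n n (\<not> (\<not> \<epsilon>)) Q) = fend Y n (\<not> (\<not> \<epsilon>)) V j \<eta>"
    by (rule homotopy_extension[OF Y V w, of "\<not> \<epsilon>"]) (use wu Vend in auto)
  have "lift_problem X Y f n (fend X n \<epsilon> U) (fac Y n n \<epsilon> Q)"
    unfolding lift_problem_def using fam_fend[OF cX U] Q Vend cY by auto
  from G[OF this] obtain v where v: "v \<in> cubes X n" "\<And>j \<eta>. j < n \<Longrightarrow> fac X (n - 1) j \<eta> v = fend X n \<epsilon> U j \<eta>"
    and r: "rh Y n (f n v) (fac Y n n \<epsilon> Q)"
    unfolding lift_solution_def by blast
  obtain R where R: "R \<in> cubes X (Suc n)" "fac X n n \<epsilon> R = v" "\<And>j \<eta>. j < n \<Longrightarrow> fac X n j \<eta> R = U j \<eta>"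
    "\<And>j \<eta>. j < n \<Longrightarrow> fac X (n - 1) j \<eta> (fac X n n (\<not> \<epsilon>) R) = fend X n (\<not> \<epsilon>) U j \<eta>"
    by (rule homotopy_extension[OF X U v(1), of \<epsilon>]) (use v in auto)
  have fR: "fac Y n j \<eta> (f (Suc n) R) = f n (fac X n j \<eta> R)" if "j \<le> n" for j \<eta>
    using map_fac[OF f that R(1)] by simp
  have "rh Y n (fac Y n n (\<not> \<epsilon>) (f (Suc n) R)) (fac Y n n (\<not> \<epsilon>) Q)"
    by (rule rh_other_end[OF Y cubical_map_in[OF f R(1)] Q(1)]) (use r fR R Q in \<open>auto simp: V_def\<close>)
  then have "rh Y n (f n (fac X n n (\<not> \<epsilon>) R)) w" using fR Q by simp
  moreover have "fac X n n (\<not> \<epsilon>) R \<in> cubes X n" using R cX by simp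
  ultimately show ?thesis unfolding lift_solution_def using R by blast
qed

section \<open>Loop objects and homotopy groups\<close>

lemma box_tensor_id_left: "box_tensor k m (box_id k) (restrict \<phi> (vertices m)) = restrict (lwhisk k \<phi>) (vertices (k + m))"
  by (auto simp: box_tensor_def lwhisk_def box_id_def restrict_def fun_eq_iff)

lemma const_cube_app: "const_cube X x k = app X k 0 (\<lambda>v. []) x"
  by (simp add: const_cube_def app_def)

lemma bm_const_Nil: "bm k 0 (\<lambda>v. [])"
  by (rule iffD1[OF bm_cong bm_take[of 0 k]]) auto

lemma const_cube_in [simp]: "cubical_set X \<Longrightarrow> x \<in> cubes X 0 \<Longrightarrow> const_cube X x k \<in> cubes X k"
  by (simp add: const_cube_app bm_const_Nil)

lemma const_cube_0: "cubical_set X \<Longrightarrow> x \<in> cubes X 0 \<Longrightarrow> const_cube X x 0 = x"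
  unfolding const_cube_app by (rule app_ident) auto

lemma app_const_cube: "cubical_set X \<Longrightarrow> x \<in> cubes X 0 \<Longrightarrow> bm m k \<phi> \<Longrightarrow> app X m k \<phi> (const_cube X x k) = const_cube X x m"
  unfolding const_cube_app by (rule app_app_eq1) (auto simp: bm_const_Nil)

lemma fac_const_cube [simp]: "cubical_set X \<Longrightarrow> x \<in> cubes X 0 \<Longrightarrow> j \<le> k \<Longrightarrow> fac X k j \<eta> (const_cube X x (Suc k)) = const_cube X x k"
  unfolding fac_def by (rule app_const_cube) auto

lemma ldeg_const_cube [simp]: "cubical_set X \<Longrightarrow> x \<in> cubes X 0 \<Longrightarrow> ldeg X k (const_cube X x k) = const_cube X x (Suc k)"
  unfolding ldeg_def by (rule app_const_cube) auto

lemma map_const_cube: "cubical_map X Y f \<Longrightarrow> x \<in> cubes X 0 \<Longrightarrow> f k (const_cube X x k) = const_cube Y (f 0 x) k"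
  unfolding const_cube_app by (rule cubical_map_app[OF _ bm_const_Nil])

definition loops :: "'a cubical \<Rightarrow> 'a \<Rightarrow> nat \<Rightarrow> 'a cubical" where
  "loops X x n = fst ((loop_object ^^ n) (X, x))"

lemma loop_object_simps:
  "cubes (fst (loop_object (L, l))) k = {p \<in> cubes L (Suc k). fac L k 0 False p = const_cube L l k \<and> fac L k 0 True p = const_cube L l k}"
  "app (fst (loop_object (L, l))) m k \<phi> = app L (Suc m) (Suc k) (lwhisk 1 \<phi>)"
  "snd (loop_object (L, l)) = const_cube L l 1"
proof -
  show "cubes (fst (loop_object (L, l))) k = {p \<in> cubes L (Suc k). fac L k 0 False p = const_cube L l k \<and> fac L k 0 True p = const_cube L l k}"
    using face_eq[of k 0] by (simp add: loop_object_def path_object_def path_end_def fac_def app_def)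
  show "app (fst (loop_object (L, l))) m k \<phi> = app L (Suc m) (Suc k) (lwhisk 1 \<phi>)"
    unfolding app_def[abs_def] using box_tensor_id_left[of 1 m \<phi>]
    by (simp add: loop_object_def path_object_def)
  have "app L 1 0 (dl 0) l = app L 1 0 (\<lambda>v. []) l"
    by (rule fun_cong[OF app_cong]) (simp add: dl_def)
  then show "snd (loop_object (L, l)) = const_cube L l 1"
    using degen_eq[of 0 0] by (simp add: loop_object_def const_cube_app app_def)
qed

text \<open>Direction 0 of the n-fold loop object is direction n of X, so each further loop
  coordinate is placed directly after the earlier ones and operators act on the coordinates behind
  all of them.\<close>

lemma loop_iterate:
  assumes X: "cubical_set X" and x: "x \<in> cubes X 0"
  shows "cubes (loops X x n) k = {p \<in> cubes X (n + k). \<forall>j<n. \<forall>\<eta>. fac X (n + k - 1) j \<eta> p = const_cube X x (n + k - 1)}"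
    and "app (loops X x n) m k \<phi> = app X (n + m) (n + k) (lwhisk n \<phi>)"
    and "snd ((loop_object ^^ n) (X, x)) = const_cube X x n"
proof (induction n arbitrary: k m \<phi>)
  case 0
  { case 1 then show ?case by (simp add: loops_def)
  next
    case 2 show ?case unfolding loops_def using app_cong[of m \<phi> "lwhisk 0 \<phi>" X k] by (simp add: lwhisk_def)
  next
    case 3 then show ?case using X x by (simp add: const_cube_0) }
next
  case (Suc n)
  let ?L = "loops X x n" and ?l = "const_cube X x n"
  have L: "(loop_object ^^ n) (X, x) = (?L, ?l)" using Suc(3) by (simp add: loops_def prod_eq_iff)
  have L': "(loop_object ^^ Suc n) (X, x) = loop_object (?L, ?l)" by (simp only: funpow.simps comp_apply L)
  have lpS: "loops X x (Suc n) = fst (loop_object (?L, ?l))" unfolding loops_def[of X x "Suc n"] L' ..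
  have cc: "const_cube ?L ?l k = const_cube X x (n + k)" for k
  proof -
    have "const_cube ?L ?l k = app X (n + k) n (lwhisk n (\<lambda>v. [])) ?l"
      unfolding const_cube_app Suc(2) by simp
    also have "\<dots> = const_cube X x (n + k)"
      using bm_lwhisk[OF bm_const_Nil, of n k] by (intro app_const_cube[OF X x]) simp
    finally show ?thesis .
  qed
  have fac: "fac ?L k 0 \<epsilon> p = fac X (n + k) n \<epsilon> p" for k \<epsilon> p
  proof -
    have "app X (n + k) (n + Suc k) (lwhisk n (fc 0 \<epsilon>)) = app X (n + k) (n + Suc k) (fc n \<epsilon>)"
      by (rule app_cong) (simp add: lwhisk_def fc_def)
    then show ?thesis by (simp add: fac_def Suc(2))
  qed
  { case 1
    show ?case unfolding lpS loop_object_simps(1) Suc(1) cc fac by (auto simp: all_bool_eq less_Suc_eq)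
  next
    case 2
    have "app X (n + Suc m) (n + Suc k) (lwhisk n (lwhisk 1 \<phi>)) = app X (n + Suc m) (n + Suc k) (lwhisk (Suc n) \<phi>)"
      by (rule app_cong) (auto simp: lwhisk_def take_Suc_conv_app_nth drop_Suc tl_drop[symmetric] take_Suc hd_drop_conv_nth)
    then show ?case unfolding lpS loop_object_simps(2) Suc(2) by simp
  next
    case 3
    show ?case unfolding L' loop_object_simps(3) cc by simp }
qed

lemma loop_object_iterate:
  "cubical_set X \<Longrightarrow> x \<in> cubes X 0 \<Longrightarrow> (loop_object ^^ n) (X, x) = (loops X x n, const_cube X x n)"
  using loop_iterate(3) by (simp add: loops_def prod_eq_iff)

lemma loop_fac:
  assumes X: "cubical_set X" and x: "x \<in> cubes X 0"
  shows "fac (loops X x n) k i \<epsilon> = fac X (n + k) (n + i) \<epsilon>"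
proof -
  have "app X (n + k) (n + Suc k) (lwhisk n (fc i \<epsilon>)) = app X (n + k) (n + Suc k) (fc (n + i) \<epsilon>)"
    by (rule app_cong) (simp add: lwhisk_def fc_def take_add add.commute[of i n])
  then show ?thesis by (simp add: fac_def[abs_def] loop_iterate(2)[OF X x])
qed

lemma loops_0: "loops X x 0 = X"
  by (simp add: loops_def)

lemma cubical_set_loop:
  assumes X: "cubical_set X" and x: "x \<in> cubes X 0"
  shows "cubical_set (loops X x n)"
proof (rule cubical_setI)
  note L = loop_iterate(1,2)[OF X x]
  fix m k \<phi> p assume \<phi>: "bm m k \<phi>" and "p \<in> cubes (loops X x n) k"
  then have p: "p \<in> cubes X (n + k)" "\<And>j \<eta>. j < n \<Longrightarrow> fac X (n + k - 1) j \<eta> p = const_cube X x (n + k - 1)"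
    by (auto simp: L)
  have "fac X (n + m - 1) j \<eta> (app X (n + m) (n + k) (lwhisk n \<phi>) p) = const_cube X x (n + m - 1)" if j: "j < n" for j \<eta>
  proof -
    obtain n' where n: "n = Suc n'" using j by (cases n) auto
    \<comment> \<open>A face in a loop direction passes through the whiskered morphism and removes
      one of its identity coordinates.\<close>
    have "fac X (n' + m) j \<eta> (app X (Suc (n' + m)) (Suc (n' + k)) (lwhisk n \<phi>) p) =
        app X (n' + m) (n' + k) (lwhisk n' \<phi>) (fac X (n' + k) j \<eta> p)"
      unfolding fac_def
    proof (rule app_app_eq[OF X])
      show "bm (Suc (n' + m)) (Suc (n' + k)) (lwhisk n \<phi>)" using bm_lwhisk[OF \<phi>, of n] by (simp add: n)
      fix v :: "bool list" assume v: "length v = n' + m"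
      have "take n (fc j \<eta> v) = fc j \<eta> (take n' v)" "drop n (fc j \<eta> v) = drop n' v"
        using j v n by (auto simp: fc_def take_Cons' drop_Cons' min_def take_drop)
      then show "lwhisk n \<phi> (fc j \<eta> v) = fc j \<eta> (lwhisk n' \<phi> v)"
        using j n v by (auto simp: lwhisk_def fc_def min_def)
    qed (use j p n bm_lwhisk[OF \<phi>, of n'] in auto)
    also have "fac X (n' + k) j \<eta> p = const_cube X x (n' + k)" using p(2)[OF j] n by simp
    also have "app X (n' + m) (n' + k) (lwhisk n' \<phi>) \<dots> = const_cube X x (n' + m)"
      by (rule app_const_cube[OF X x bm_lwhisk[OF \<phi>]])
    finally show ?thesis by (simp add: n)
  qed
  then show "app (loops X x n) m k \<phi> p \<in> cubes (loops X x n) m"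
    using X p bm_lwhisk[OF \<phi>, of n] by (simp add: L)
next
  note L = loop_iterate(1,2)[OF X x]
  fix k p assume "p \<in> cubes (loops X x n) k"
  then show "app (loops X x n) k k id p = p" by (auto simp: L lwhisk_def intro!: app_ident[OF X])
next
  note L = loop_iterate(1,2)[OF X x]
  fix l m k \<psi> \<phi> p assume *: "bm l m \<psi>" "bm m k \<phi>" "p \<in> cubes (loops X x n) k"
  show "app (loops X x n) l k (\<phi> \<circ> \<psi>) p = app (loops X x n) l m \<psi> (app (loops X x n) m k \<phi> p)"
    unfolding L by (rule app_app_eq1[OF X bm_lwhisk[OF *(1)] bm_lwhisk[OF *(2)], symmetric]) (use * in \<open>auto simp: L lwhisk_def\<close>)
qed

text \<open>An open box in the loop object becomes one in X by adding constant faces in the loop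
  directions. Its filler has these faces, so it lies in the loop object.\<close>

lemma akan_loop:
  assumes X: "akan X" and x: "x \<in> cubes X 0"
  shows "akan (loops X x n)"
proof -
  note cX = akan_cubical[OF X]
  note L = loop_iterate(1)[OF cX x] and F = loop_fac[OF cX x]
  show ?thesis unfolding akan_def
  proof (intro conjI cubical_set_loop[OF cX x] allI impI)
    fix k i :: nat and \<epsilon> :: bool and u
    assume i: "i \<le> k" and uin: "\<forall>j\<le>k. \<forall>\<eta>. (j, \<eta>) \<noteq> (i, \<epsilon>) \<longrightarrow> u j \<eta> \<in> cubes (loops X x n) k"
      and comp: "\<forall>j\<le>k. \<forall>k'<j. \<forall>\<eta> \<theta>. (j, \<eta>) \<noteq> (i, \<epsilon>) \<longrightarrow> (k', \<theta>) \<noteq> (i, \<epsilon>) \<longrightarrow>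
         fac (loops X x n) (k - 1) k' \<theta> (u j \<eta>) = fac (loops X x n) (k - 1) (j - 1) \<eta> (u k' \<theta>)"
    define u' where "u' j \<eta> = (if j < n then const_cube X x (n + k) else u (j - n) \<eta>)" for j \<eta>
    have ui: "u j \<eta> \<in> cubes X (n + k)" "\<And>l \<theta>. l < n \<Longrightarrow> fac X (n + k - 1) l \<theta> (u j \<eta>) = const_cube X x (n + k - 1)"
      if "j \<le> k" "(j, \<eta>) \<noteq> (i, \<epsilon>)" for j \<eta> using uin that by (auto simp: L)
    obtain p where p: "p \<in> cubes X (Suc (n + k))"
      "\<And>j \<eta>. j \<le> n + k \<Longrightarrow> (j, \<eta>) \<noteq> (n + i, \<epsilon>) \<Longrightarrow> fac X (n + k) j \<eta> p = u' j \<eta>"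
    proof (rule akan_fill[OF X, of "n + i" "n + k" \<epsilon> u'])
      fix j \<eta> assume "j \<le> n + k" "(j, \<eta>) \<noteq> (n + i, \<epsilon>)"
      then show "u' j \<eta> \<in> cubes X (n + k)" using ui(1)[of "j - n" \<eta>] cX x by (auto simp: u'_def)
    next
      fix j l \<eta> \<theta> assume *: "j \<le> n + k" "l < j" "(j, \<eta>) \<noteq> (n + i, \<epsilon>)" "(l, \<theta>) \<noteq> (n + i, \<epsilon>)"
      have cc: "fac X (n + k - 1) t \<zeta> (const_cube X x (n + k)) = const_cube X x (n + k - 1)" if "t < n + k" for t \<zeta>
        using fac_const_cube[OF cX x, of t "n + k - 1"] that by (cases "n + k") auto
      consider "j < n" | "n \<le> j" "l < n" | "n \<le> l" by linarith
      then show "fac X (n + k - 1) l \<theta> (u' j \<eta>) = fac X (n + k - 1) (j - 1) \<eta> (u' l \<theta>)"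
      proof cases
        case 1 then show ?thesis using * cc by (auto simp: u'_def)
      next
        case 2
        moreover have "j - 1 < n + k" using * by simp
        ultimately show ?thesis using * cc ui(2)[of "j - n" \<eta> l \<theta>] by (auto simp: u'_def)
      next
        case 3
        have "fac (loops X x n) (k - 1) (l - n) \<theta> (u (j - n) \<eta>) = fac (loops X x n) (k - 1) (j - n - 1) \<eta> (u (l - n) \<theta>)"
          using comp 3 * by (auto simp del: One_nat_def)
        moreover have "n + (k - 1) = n + k - 1" "n + (l - n) = l" "n + (j - n - 1) = j - 1" using 3 * by auto
        ultimately show ?thesis using 3 * by (simp add: F u'_def)
      qed
    qed (use i in auto)
    have "p \<in> cubes (loops X x n) (Suc k)" using p by (auto simp: L u'_def)
    moreover have "fac (loops X x n) k j \<eta> p = u j \<eta>" if "j \<le> k" "(j, \<eta>) \<noteq> (i, \<epsilon>)" for j \<eta>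
      using p(2)[of "n + j" \<eta>] that by (auto simp: F u'_def)
    ultimately show "\<exists>p\<in>cubes (loops X x n) (Suc k). \<forall>j\<le>k. \<forall>\<eta>. (j, \<eta>) \<noteq> (i, \<epsilon>) \<longrightarrow> fac (loops X x n) k j \<eta> p = u j \<eta>"
      by blast
  qed
qed

lemma loop_map_iterate: "(loop_map ^^ n) f k = f (n + k)"
  by (induction n arbitrary: k) (simp_all add: loop_map_def)

lemma cubical_map_loop:
  assumes X: "cubical_set X" and x: "x \<in> cubes X 0" and Y: "cubical_set Y" and f: "cubical_map X Y f"
  shows "cubical_map (loops X x n) (loops Y (f 0 x) n) ((loop_map ^^ n) f)"
proof -
  have y: "f 0 x \<in> cubes Y 0" by (rule cubical_map_in[OF f x])
  note L = loop_iterate(1,2)[OF X x] loop_iterate(1,2)[OF Y y]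
  show ?thesis
  proof (rule cubical_mapI)
    fix k p assume p: "p \<in> cubes (loops X x n) k"
    have "fac Y (n + k - 1) j \<eta> (f (n + k) p) = const_cube Y (f 0 x) (n + k - 1)" if j: "j < n" for j \<eta>
      using map_fac[OF f, of j "n + k - 1" p \<eta>] p j map_const_cube[OF f x, of "n + k - 1"]
      by (cases n) (auto simp: L)
    then show "(loop_map ^^ n) f k p \<in> cubes (loops Y (f 0 x) n) k"
      using p cubical_map_in[OF f] by (auto simp: L loop_map_iterate)
  next
    fix m k \<phi> p assume *: "bm m k \<phi>" "p \<in> cubes (loops X x n) k"
    then show "(loop_map ^^ n) f m (app (loops X x n) m k \<phi> p) = app (loops Y (f 0 x) n) m k \<phi> ((loop_map ^^ n) f k p)"
      using cubical_map_app[OF f bm_lwhisk[OF *(1), of n]] by (auto simp: L loop_map_iterate)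
  qed
qed

lemma rh_loop_edge:
  assumes X: "cubical_set X" and x: "x \<in> cubes X 0" and a: "a \<in> cubes (loops X x n) 0"
  shows "rh X n a b \<longleftrightarrow> b \<in> cubes X n \<and> (\<exists>h\<in>cubes X (Suc n). fac X n n False h = a \<and> fac X n n True h = b \<and>
    (\<forall>j<n. \<forall>\<eta>. fac X n j \<eta> h = const_cube X x n))"
proof -
  have "ldeg X (n - 1) (fac X (n - 1) j \<eta> a) = const_cube X x n" if "j < n" for j \<eta>
    using a that ldeg_const_cube[OF X x, of "n - 1"] by (auto simp: loop_iterate(1)[OF X x])
  then show ?thesis unfolding rh_def using a by (auto simp: loop_iterate(1)[OF X x])
qed

text \<open>An edge in the n-fold loop object and a homotopy relative to a constant boundary are the
  same (n+1)-cube of X. This turns statements about homotopy groups into statements about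
  \<open>rh\<close>.\<close>

lemma rh_loop:
  assumes X: "cubical_set X" and x: "x \<in> cubes X 0" and ab: "a \<in> cubes (loops X x n) 0" "b \<in> cubes (loops X x n) 0"
  shows "rh (loops X x n) 0 a b \<longleftrightarrow> rh X n a b"
  unfolding rh_loop_edge[OF X x ab(1)] rh_def[of "loops X x n"] loop_fac[OF X x]
  using ab by (auto simp: loop_iterate(1)[OF X x])

section \<open>Components as a colimit\<close>

lemma gen_equiv_equiv:
  assumes "R \<subseteq> A \<times> A"
  shows "equiv A (gen_equiv A R)"
proof (rule equivI)
  show "gen_equiv A R \<subseteq> A \<times> A" by (auto simp: gen_equiv_def)
  show "refl_on A (gen_equiv A R)" by (auto simp: gen_equiv_def refl_on_def)
  have "sym ((R \<union> R\<inverse>)\<^sup>*)" by (rule sym_rtrancl) (auto simp: sym_def)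
  then show "sym (gen_equiv A R)" by (auto simp: gen_equiv_def sym_def)
  show "trans (gen_equiv A R)" by (auto simp: gen_equiv_def trans_def)
qed

lemma gen_equiv_step: "R \<subseteq> A \<times> A \<Longrightarrow> (a, b) \<in> R \<Longrightarrow> (a, b) \<in> gen_equiv A R"
  by (auto simp: gen_equiv_def)

lemma gen_equiv_invariant:
  assumes "(a, b) \<in> gen_equiv A R" and RA: "R \<subseteq> A \<times> A"
    and I: "\<And>a b. a \<in> A \<Longrightarrow> b \<in> A \<Longrightarrow> (a, b) \<in> R \<Longrightarrow> h a = h b"
  shows "h a = h b"
proof -
  have "(a, b) \<in> (R \<union> R\<inverse>)\<^sup>*" "a \<in> A" using assms(1) by (auto simp: gen_equiv_def)
  then have "h a = h b"
  proof (induction rule: rtrancl_induct)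
    case (step b c) then show ?case using I RA by auto
  qed simp
  then show ?thesis .
qed

lemma pi0_gen_sub:
  assumes L: "cubical_set L"
  shows "{((m, act L m n \<phi> x), (n, x)) | m n \<phi> x. box_map m n \<phi> \<and> x \<in> cubes L n} \<subseteq> (SIGMA n:UNIV. cubes L n) \<times> (SIGMA n:UNIV. cubes L n)"
  using L by (auto simp: app_box_map box_map_bm)

lemma pi0_equiv: "cubical_set L \<Longrightarrow> equiv (SIGMA n:UNIV. cubes L n) (pi0_rel L)"
  unfolding pi0_rel_def by (rule gen_equiv_equiv[OF pi0_gen_sub])

lemma pi0_rel_app:
  assumes "cubical_set L" "bm m n \<phi>" "x \<in> cubes L n"
  shows "((m, app L m n \<phi> x), (n, x)) \<in> pi0_rel L"
  unfolding pi0_rel_def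
  by (rule gen_equiv_step[OF pi0_gen_sub[OF assms(1)]]) (use assms in \<open>auto simp: app_def bm_def\<close>)

text \<open>A composite of faces inserting 0. The case \<open>k = 0\<close> is the vertex at the
  origin, and \<open>k = 1\<close> gives the edges issuing from it.\<close>

lemma bm_pad: "bm k (i + k + j) (\<lambda>v. replicate i False @ v @ replicate j False)"
proof (induction j)
  case 0
  show ?case
  proof (induction i)
    case (Suc i)
    show ?case unfolding add_Suc
      by (rule bm_comp'[OF Suc bm_fc[of 0 "i + k + 0" False]]) (simp_all add: fc_def)
  qed simp
next
  case (Suc j)
  show ?case unfolding add_Suc_right
    by (rule bm_comp'[OF Suc bm_fc[of "i + k + j" "i + k + j" False]]) (simp_all add: fc_def replicate_append_same[symmetric])
qed

lemma bm_origin: "bm 0 n (\<lambda>_. replicate n False)"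
  using bm_pad[of 0 n 0] bm_cong[of 0 "\<lambda>v. replicate n False @ v @ replicate 0 False" "\<lambda>_. replicate n False"] by simp

text \<open>In the colimit every cube is identified with each of its vertices; fixing this one
  reduces components to vertices modulo edges.\<close>

definition origin :: "'a cubical \<Rightarrow> nat \<Rightarrow> 'a \<Rightarrow> 'a" where
  "origin L n a = app L 0 n (\<lambda>_. replicate n False) a"

lemma origin_in: "cubical_set L \<Longrightarrow> a \<in> cubes L n \<Longrightarrow> origin L n a \<in> cubes L 0"
  by (simp add: origin_def bm_origin)

lemma origin_0: "cubical_set L \<Longrightarrow> a \<in> cubes L 0 \<Longrightarrow> origin L 0 a = a"
  unfolding origin_def by (rule app_ident) auto

text \<open>Degeneracies and connections send the origin to the origin, and a face moves it at most
  along one edge. The Kan condition enters through symmetry and transitivity of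
  \<open>rh\<close>.\<close>

lemma origin_app:
  assumes L: "akan L"
  shows "bm m n \<phi> \<Longrightarrow> x \<in> cubes L n \<Longrightarrow> rh L 0 (origin L m (app L m n \<phi> x)) (origin L n x)"
proof (induction arbitrary: x rule: bm_induct)
  note cL = akan_cubical[OF L]
  { case (ident n) then show ?case using rh_refl[OF cL origin_in[OF cL]] app_ident[OF cL, of n id x] by (simp add: id_def)
  next
    case (fc n i \<epsilon>)
    \<comment> \<open>The edge at the origin in direction i: its two ends are the images of the
      origin under the two faces in that direction.\<close>
    let ?e = "\<lambda>v. replicate i False @ v @ replicate (n - i) False"
    have e: "bm (Suc 0) (Suc n) ?e" using bm_pad[of "Suc 0" i "n - i"] fc(1) by simp
    have 1: "origin L n (app L n (Suc n) (fc i \<epsilon>) x) = fac L 0 0 \<epsilon> (app L (Suc 0) (Suc n) ?e x)" for \<epsilon>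
      unfolding origin_def fac_def
      by (rule app_app_eq) (use fc cL bm_origin e bm_fc[of 0 0] in \<open>auto simp: fc_def min_def\<close>)
    have *: "replicate i False @ False # replicate (n - i) False = replicate (Suc n) False"
      using fc(1) replicate_add[of i "Suc (n - i)" False] by (simp del: replicate_Suc add: Suc_diff_le flip: replicate_Suc)
    have 2: "origin L (Suc n) x = fac L 0 0 False (app L (Suc 0) (Suc n) ?e x)"
      unfolding origin_def fac_def
      by (rule app_app_eq1[symmetric])
        (use fc cL e bm_fc[of 0 0] in \<open>auto simp: fc_def * simp del: replicate_Suc\<close>)
    have h: "app L (Suc 0) (Suc n) ?e x \<in> cubes L (Suc 0)" using cL e fc by simp
    have "rh L 0 (fac L 0 0 False (app L (Suc 0) (Suc n) ?e x)) (fac L 0 0 True (app L (Suc 0) (Suc n) ?e x))"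
      unfolding rh_def using h cL by auto
    moreover have "rh L 0 (fac L 0 0 False (app L (Suc 0) (Suc n) ?e x)) (fac L 0 0 False (app L (Suc 0) (Suc n) ?e x))"
      by (rule rh_refl[OF cL]) (use h cL in simp)
    ultimately show ?case unfolding 1 2 by (cases \<epsilon>) (auto intro: rh_sym[OF L])
  next
    case (dl n i)
    have "origin L (Suc n) (app L (Suc n) n (dl i) x) = origin L n x"
      unfolding origin_def by (rule app_app_eq1) (use dl cL bm_origin[of "Suc n"] in \<open>auto simp: length_dl nth_dl simp del: replicate_Suc intro!: nth_equalityI split: if_splits\<close>)
    then show ?case using rh_refl[OF cL origin_in[OF cL dl(2)]] by simp
  next
    case (cf n i \<epsilon>)
    have "origin L (Suc n) (app L (Suc n) n (cf i \<epsilon>) x) = origin L n x"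
      unfolding origin_def
      by (rule app_app_eq1) (use cf cL bm_origin[of "Suc n"] in \<open>auto simp: length_cf nth_cf simp del: replicate_Suc intro!: nth_equalityI split: if_splits\<close>)
    then show ?case using rh_refl[OF cL origin_in[OF cL cf(2)]] by simp
  next
    case (comp l m n \<psi> \<phi>)
    have "rh L 0 (origin L l (app L l m \<psi> (app L m n \<phi> x))) (origin L n x)"
      by (rule rh_trans[OF L comp(3) comp(4)[OF comp(5)]]) (use cL comp in simp)
    then show ?case unfolding app_app[OF cL comp(1,2,5)] by (simp only: comp_def)
  next
    case (cong m n \<phi> \<psi>)
    then show ?case using app_cong[of m \<psi> \<phi>] by metis }
qed

lemma pi0_rel_iff:
  assumes L: "akan L" and ab: "a \<in> cubes L n" "b \<in> cubes L m"
  shows "((n, a), (m, b)) \<in> pi0_rel L \<longleftrightarrow> rh L 0 (origin L n a) (origin L m b)"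
proof
  note cL = akan_cubical[OF L]
  \<comment> \<open>An invariant with values in sets: it is constant along the generators of the
    colimit relation, hence on its classes.\<close>
  let ?h = "\<lambda>(n, x). {z. rh L 0 z (origin L n x)}"
  assume "((n, a), (m, b)) \<in> pi0_rel L"
  then have "?h (n, a) = ?h (m, b)"
    unfolding pi0_rel_def
  proof (rule gen_equiv_invariant[OF _ pi0_gen_sub[OF cL]])
    fix p q assume "(p, q) \<in> {((m, act L m n \<phi> x), (n, x)) | m n \<phi> x. box_map m n \<phi> \<and> x \<in> cubes L n}"
    then obtain m n \<phi> x where *: "p = (m, act L m n \<phi> x)" "q = (n, x)" "box_map m n \<phi>" "x \<in> cubes L n" by auto
    have "rh L 0 (origin L m (app L m n \<phi> x)) (origin L n x)" by (rule origin_app[OF L box_map_bm[OF *(3)] *(4)])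
    then show "?h p = ?h q" unfolding * app_box_map[OF *(3)] by (auto intro: rh_trans[OF L] rh_sym[OF L])
  qed
  then show "rh L 0 (origin L n a) (origin L m b)" using rh_refl[OF cL origin_in[OF cL ab(1)]] by auto
next
  note cL = akan_cubical[OF L]
  assume "rh L 0 (origin L n a) (origin L m b)"
  then obtain h where h: "h \<in> cubes L 1" "fac L 0 0 False h = origin L n a" "fac L 0 0 True h = origin L m b"
    unfolding rh_def by auto
  have 1: "((0, origin L k c), (k, c)) \<in> pi0_rel L" if "c \<in> cubes L k" for k c
    unfolding origin_def by (rule pi0_rel_app[OF cL bm_origin that])
  have 2: "((0, fac L 0 0 \<epsilon> h), (1, h)) \<in> pi0_rel L" for \<epsilon>
    unfolding fac_def using pi0_rel_app[OF cL bm_fc[of 0 0 \<epsilon>], of h] h by simp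
  have s: "sym (pi0_rel L)" and t: "trans (pi0_rel L)" using pi0_equiv[OF cL] by (auto simp: equiv_def)
  have "((0, origin L n a), (0, origin L m b)) \<in> pi0_rel L"
    using 2[of False] 2[of True] h symD[OF s] transD[OF t] by metis
  then show "((n, a), (m, b)) \<in> pi0_rel L"
    using 1[OF ab(1)] 1[OF ab(2)] symD[OF s] transD[OF t] by metis
qed

lemma pi0_class_eq_iff:
  assumes L: "akan L" and ab: "a \<in> cubes L 0" "b \<in> cubes L 0"
  shows "pi0_class L 0 a = pi0_class L 0 b \<longleftrightarrow> rh L 0 a b"
proof -
  note cL = akan_cubical[OF L]
  have "pi0_class L 0 a = pi0_class L 0 b \<longleftrightarrow> ((0, a), (0, b)) \<in> pi0_rel L"
    unfolding pi0_class_def using eq_equiv_class_iff[OF pi0_equiv[OF cL], of "(0, a)" "(0, b)"] ab by simp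
  then show ?thesis using pi0_rel_iff[OF L ab] origin_0[OF cL] ab by simp
qed

lemma pi0_class_in: "a \<in> cubes L n \<Longrightarrow> pi0_class L n a \<in> pi0 L"
  unfolding pi0_class_def pi0_def by (auto intro: quotientI)

lemma pi0_cases:
  assumes L: "cubical_set L" and C: "C \<in> pi0 L"
  obtains a where "a \<in> cubes L 0" "C = pi0_class L 0 a"
proof -
  obtain n a where na: "a \<in> cubes L n" "C = pi0_class L n a"
    using C unfolding pi0_def pi0_class_def by (auto elim!: quotientE)
  have "pi0_class L 0 (origin L n a) = pi0_class L n a"
    unfolding pi0_class_def origin_def
    by (rule equiv_class_eq[OF pi0_equiv[OF L]]) (rule pi0_rel_app[OF L bm_origin na(1)])
  then show ?thesis using that origin_in[OF L na(1)] na(2) by simp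
qed

lemma pi0_rel_map:
  assumes L': "cubical_set L'" and f: "cubical_map L L' f" and L: "cubical_set L"
    and ab: "((n, a), (m, b)) \<in> pi0_rel L"
  shows "((n, f n a), (m, f m b)) \<in> pi0_rel L'"
proof -
  let ?h = "\<lambda>(n, x). pi0_class L' n (f n x)"
  have nm: "a \<in> cubes L n" "b \<in> cubes L m" using ab by (auto simp: pi0_rel_def gen_equiv_def)
  have "?h (n, a) = ?h (m, b)"
    using ab unfolding pi0_rel_def
  proof (rule gen_equiv_invariant[OF _ pi0_gen_sub[OF L]])
    fix p q assume "(p, q) \<in> {((m, act L m n \<phi> x), (n, x)) | m n \<phi> x. box_map m n \<phi> \<and> x \<in> cubes L n}"
    then obtain m n \<phi> x where *: "p = (m, act L m n \<phi> x)" "q = (n, x)" "box_map m n \<phi>" "x \<in> cubes L n" by auto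
    show "?h p = ?h q"
      unfolding * pi0_class_def app_box_map[OF *(3)] prod.case cubical_map_app[OF f box_map_bm[OF *(3)] *(4)]
      by (rule equiv_class_eq[OF pi0_equiv[OF L'] pi0_rel_app[OF L' box_map_bm[OF *(3)] cubical_map_in[OF f *(4)]]])
  qed
  then show ?thesis
    unfolding pi0_class_def using eq_equiv_class_iff[OF pi0_equiv[OF L'], of "(n, f n a)" "(m, f m b)"]
      cubical_map_in[OF f] nm by simp
qed

lemma pi0_map_class:
  assumes L: "cubical_set L" and L': "cubical_set L'" and f: "cubical_map L L' f" and a: "a \<in> cubes L n"
  shows "pi0_map L' f (pi0_class L n a) = pi0_class L' n (f n a)"
proof -
  have s: "sym (pi0_rel L')" and t: "trans (pi0_rel L')" using pi0_equiv[OF L'] by (auto simp: equiv_def)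
  have "((n, a), (n, a)) \<in> pi0_rel L" using pi0_equiv[OF L] a by (auto simp: equiv_def refl_on_def)
  then show ?thesis
    unfolding pi0_map_def pi0_class_def using pi0_rel_map[OF L' f L] transD[OF t] by fastforce
qed

lemma pi0_eq_vertices: "cubical_set L \<Longrightarrow> pi0 L = pi0_class L 0 ` cubes L 0"
  by (auto intro: pi0_class_in elim: pi0_cases)

lemma pi0_bij_iff:
  assumes L: "akan L" and L': "akan L'" and f: "cubical_map L L' f"
  shows "bij_betw (pi0_map L' f) (pi0 L) (pi0 L') \<longleftrightarrow>
    (\<forall>a\<in>cubes L 0. \<forall>b\<in>cubes L 0. rh L' 0 (f 0 a) (f 0 b) \<longrightarrow> rh L 0 a b) \<and>
    (\<forall>b\<in>cubes L' 0. \<exists>a\<in>cubes L 0. rh L' 0 (f 0 a) b)"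
proof -
  note cL = akan_cubical[OF L] and cL' = akan_cubical[OF L']
  note cls = pi0_eq_vertices
  note m = pi0_map_class[OF cL cL' f]
  have "inj_on (pi0_map L' f) (pi0 L) \<longleftrightarrow>
     (\<forall>a\<in>cubes L 0. \<forall>b\<in>cubes L 0. rh L' 0 (f 0 a) (f 0 b) \<longrightarrow> rh L 0 a b)"
    unfolding inj_on_def cls[OF cL] ball_simps
    using cubical_map_in[OF f, of _ 0] by (simp add: m pi0_class_eq_iff[OF L] pi0_class_eq_iff[OF L'])
  moreover have "pi0_map L' f ` pi0 L = pi0 L' \<longleftrightarrow> (\<forall>b\<in>cubes L' 0. \<exists>a\<in>cubes L 0. rh L' 0 (f 0 a) b)"
  proof -
    have "pi0_map L' f ` pi0 L = (\<lambda>a. pi0_class L' 0 (f 0 a)) ` cubes L 0"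
      unfolding cls[OF cL] image_image by (rule image_cong) (simp_all add: m)
    moreover have "(\<lambda>a. pi0_class L' 0 (f 0 a)) ` cubes L 0 \<subseteq> pi0 L'"
      using cubical_map_in[OF f, of _ 0] pi0_class_in[of _ L' 0] by auto
    ultimately have "pi0_map L' f ` pi0 L = pi0 L' \<longleftrightarrow> pi0_class L' 0 ` cubes L' 0 \<subseteq> (\<lambda>a. pi0_class L' 0 (f 0 a)) ` cubes L 0"
      using cls[OF cL'] by auto
    also have "\<dots> \<longleftrightarrow> (\<forall>b\<in>cubes L' 0. \<exists>a\<in>cubes L 0. pi0_class L' 0 (f 0 a) = pi0_class L' 0 b)"
      unfolding image_subset_iff image_iff by (simp add: eq_commute)
    also have "\<dots> \<longleftrightarrow> (\<forall>b\<in>cubes L' 0. \<exists>a\<in>cubes L 0. rh L' 0 (f 0 a) b)"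
      using cubical_map_in[OF f] by (simp add: pi0_class_eq_iff[OF L'])
    finally show ?thesis .
  qed
  ultimately show ?thesis by (simp add: bij_betw_def)
qed

lemma pi_bij_iff:
  assumes X: "akan X" and Y: "akan Y" and f: "cubical_map X Y f" and x: "x \<in> cubes X 0"
  shows "bij_betw (pi_map n (Y, f 0 x) f) (pi_set n (X, x)) (pi_set n (Y, f 0 x)) \<longleftrightarrow>
    (\<forall>a\<in>cubes (loops X x n) 0. \<forall>b\<in>cubes (loops X x n) 0. rh Y n (f n a) (f n b) \<longrightarrow> rh X n a b) \<and>
    (\<forall>b\<in>cubes (loops Y (f 0 x) n) 0. \<exists>a\<in>cubes (loops X x n) 0. rh Y n (f n a) b)"
proof -
  note cX = akan_cubical[OF X] and cY = akan_cubical[OF Y]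
  have y: "f 0 x \<in> cubes Y 0" by (rule cubical_map_in[OF f x])
  note m = cubical_map_loop[OF cX x cY f, of n]
  have fin: "f n a \<in> cubes (loops Y (f 0 x) n) 0" if "a \<in> cubes (loops X x n) 0" for a
    using cubical_map_in[OF m that] by (simp add: loop_map_iterate)
  show ?thesis
    unfolding pi_map_def pi_set_def loops_def[symmetric] pi0_bij_iff[OF akan_loop[OF X x] akan_loop[OF Y y] m]
    using fin by (simp add: loop_map_iterate rh_loop[OF cX x] rh_loop[OF cY y])
qed

section \<open>The group structure\<close>

lemma loop_once: "fst (loop_object (Z, z)) = loops Z z (Suc 0)"
  by (simp add: loops_def)

lemma loop_vertices:
  "cubical_set Z \<Longrightarrow> z \<in> cubes Z 0 \<Longrightarrow> p \<in> cubes (loops Z z n) 0 \<longleftrightarrow>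
    p \<in> cubes Z n \<and> (\<forall>j<n. \<forall>\<eta>. fac Z (n - 1) j \<eta> p = const_cube Z z (n - 1))"
  by (simp add: loop_iterate(1))

lemma loop_once_vertices:
  "cubical_set Z \<Longrightarrow> z \<in> cubes Z 0 \<Longrightarrow> p \<in> cubes (loops Z z (Suc 0)) 0 \<longleftrightarrow>
    p \<in> cubes Z (Suc 0) \<and> (\<forall>\<eta>. fac Z 0 0 \<eta> p = z)"
  by (simp add: loop_vertices const_cube_0)

text \<open>The description by \<open>THE\<close> denotes something because the side opposite to the
  constant one, read as the product, is unique up to homotopy: two squares with homotopic factors
  are joined by a three-dimensional box.\<close>

lemma pi1_mult_eq:
  assumes Z: "akan Z" and z: "z \<in> cubes Z 0" and s: "s \<in> cubes Z (Suc (Suc 0))"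
    and fg: "fac Z (Suc 0) 0 False s \<in> cubes (loops Z z (Suc 0)) 0" "fac Z (Suc 0) (Suc 0) True s \<in> cubes (loops Z z (Suc 0)) 0"
    and sT: "fac Z (Suc 0) 0 True s = const_cube Z z (Suc 0)"
  shows "pi1_mult (Z, z) (pi0_class (loops Z z (Suc 0)) 0 (fac Z (Suc 0) 0 False s)) (pi0_class (loops Z z (Suc 0)) 0 (fac Z (Suc 0) (Suc 0) True s))
    = pi0_class (loops Z z (Suc 0)) 0 (fac Z (Suc 0) (Suc 0) False s)"
proof -
  note cZ = akan_cubical[OF Z]
  let ?L = "loops Z z (Suc 0)"
  let ?cls = "pi0_class ?L 0" and ?d = "fac Z (Suc 0)" and ?c = "const_cube Z z (Suc 0)"
  note LV = loop_once_vertices[OF cZ z]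
  have L: "akan ?L" by (rule akan_loop[OF Z z])
  have a1: "act Z 1 2 (face 2 1 \<epsilon>) = fac Z (Suc 0) 0 \<epsilon>" for \<epsilon>
    using face_eq[of "Suc 0" 0 \<epsilon>] by (simp add: fac_def[abs_def] app_def[abs_def] numeral_2_eq_2)
  have a2: "act Z 1 2 (face 2 2 \<epsilon>) = fac Z (Suc 0) (Suc 0) \<epsilon>" for \<epsilon>
    using face_eq[of "Suc 0" "Suc 0" \<epsilon>] by (simp add: fac_def[abs_def] app_def[abs_def] numeral_2_eq_2)
  have a3: "act Z 1 0 (degen 1 1) z = const_cube Z z (Suc 0)"
    using loop_object_simps(3)[of Z z] by (simp add: loop_object_def)
  define Q where "Q A B C t \<longleftrightarrow> ?d 0 False t \<in> cubes ?L 0 \<and> A = ?cls (?d 0 False t) \<and>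
      ?d (Suc 0) True t \<in> cubes ?L 0 \<and> B = ?cls (?d (Suc 0) True t) \<and>
      ?d 0 True t = ?c \<and> C = ?cls (?d (Suc 0) False t)" for A B C t
  have mult: "pi1_mult (Z, z) A B = (THE C. \<exists>t\<in>cubes Z (Suc (Suc 0)). Q A B C t)" for A B
    unfolding pi1_mult_def Q_def prod.case Let_def a1 a2 a3 loop_once by (simp add: numeral_2_eq_2)
  have bot: "?d (Suc 0) False t \<in> cubes ?L 0"
    if "t \<in> cubes Z (Suc (Suc 0))" "?d 0 False t \<in> cubes ?L 0" "?d 0 True t = ?c" for t
  proof -
    have "fac Z 0 0 \<eta> (?d (Suc 0) False t) = z" for \<eta>
      using fac_fac[OF cZ, of 0 "Suc 0" 0 t \<eta> False] that cZ z by (cases \<eta>) (auto simp: LV const_cube_0)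
    then show ?thesis using that cZ by (simp add: LV)
  qed
  have uniq: "?cls (?d (Suc 0) False s') = ?cls (?d (Suc 0) False s)"
    if s': "s' \<in> cubes Z (Suc (Suc 0))"
      and fg': "?d 0 False s' \<in> cubes ?L 0" "?d (Suc 0) True s' \<in> cubes ?L 0"
      and sT': "?d 0 True s' = ?c"
      and eq: "?cls (?d 0 False s) = ?cls (?d 0 False s')"
        "?cls (?d (Suc 0) True s) = ?cls (?d (Suc 0) True s')" for s'
  proof -
    have hom: "\<exists>h\<in>cubes Z (Suc (Suc 0)). ?d (Suc 0) False h = a \<and> ?d (Suc 0) True h = b \<and>
        (\<forall>\<eta>. ?d 0 \<eta> h = ?c)"
      if "a \<in> cubes ?L 0" "b \<in> cubes ?L 0" "?cls a = ?cls b" for a b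
      using that pi0_class_eq_iff[OF L that(1,2)] rh_loop[OF cZ z that(1,2)] rh_loop_edge[OF cZ z that(1)] by simp
    obtain hf where hf: "hf \<in> cubes Z (Suc (Suc 0))" "?d (Suc 0) False hf = ?d 0 False s"
      "?d (Suc 0) True hf = ?d 0 False s'" "\<And>\<eta>. ?d 0 \<eta> hf = ?c"
      using hom[OF fg(1) fg'(1) eq(1)] by auto
    obtain hg where hg: "hg \<in> cubes Z (Suc (Suc 0))" "?d (Suc 0) False hg = ?d (Suc 0) True s"
      "?d (Suc 0) True hg = ?d (Suc 0) True s'" "\<And>\<eta>. ?d 0 \<eta> hg = ?c"
      using hom[OF fg(2) fg'(2) eq(2)] by auto
    \<comment> \<open>The squares s and s' are the ends of the last direction, the homotopies of the
      factors are two of the sides, and a third side is constant. The missing fourth side is a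
      homotopy between the products.\<close>
    define u where "u j \<eta> = (if j = 0 then (if \<eta> then const_cube Z z (Suc (Suc 0)) else hf)
       else if j = Suc 0 then hg else if \<eta> then s' else s)" for j \<eta>
    obtain H where H: "H \<in> cubes Z (Suc (Suc (Suc 0)))"
      "\<And>j \<eta>. j \<le> Suc (Suc 0) \<Longrightarrow> (j, \<eta>) \<noteq> (Suc 0, False) \<Longrightarrow> fac Z (Suc (Suc 0)) j \<eta> H = u j \<eta>"
    proof (rule akan_fill[OF Z, of "Suc 0" "Suc (Suc 0)" False u])
      fix j \<eta> assume "j \<le> Suc (Suc 0)" then show "u j \<eta> \<in> cubes Z (Suc (Suc 0))"
        using s s' hf hg cZ z by (auto simp: u_def)
    next
      fix j k \<eta> \<theta> assume *: "j \<le> Suc (Suc 0)" "k < j" "(j, \<eta>) \<noteq> (Suc 0, False)" "(k, \<theta>) \<noteq> (Suc 0, False)"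
      then consider "j = Suc 0" "k = 0" "\<eta>" | "j = Suc (Suc 0)" "k = 0" | "j = Suc (Suc 0)" "k = Suc 0" "\<theta>"
        by (cases j; cases k) (auto simp: le_Suc_eq less_Suc_eq)
      then show "fac Z (Suc (Suc 0) - 1) k \<theta> (u j \<eta>) = fac Z (Suc (Suc 0) - 1) (j - 1) \<eta> (u k \<theta>)"
        by cases (use hf hg sT sT' cZ z in \<open>auto simp: u_def\<close>)
    qed (use in auto)
    let ?h = "fac Z (Suc (Suc 0)) (Suc 0) False H"
    have h: "?h \<in> cubes Z (Suc (Suc 0))" using H cZ by simp
    have "?d (Suc 0) \<eta> ?h = ?d (Suc 0) False (if \<eta> then s' else s)" for \<eta>
      using fac_fac[OF cZ, of "Suc 0" "Suc (Suc 0)" "Suc 0" H False \<eta>] H by (simp add: u_def)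
    moreover have "?d 0 \<eta> ?h = ?c" for \<eta>
      using fac_fac[OF cZ, of 0 "Suc 0" "Suc 0" H \<eta> False] H hf cZ z by (simp add: u_def)
    ultimately have "rh Z (Suc 0) (?d (Suc 0) False s) (?d (Suc 0) False s')"
      unfolding rh_loop_edge[OF cZ z bot[OF s fg(1) sT]]
      using h bot[OF s' fg'(1) sT'] by (auto simp: LV intro!: bexI[of _ ?h])
    then show ?thesis
      using pi0_class_eq_iff[OF L bot[OF s fg(1) sT] bot[OF s' fg'(1) sT']] rh_loop[OF cZ z bot[OF s fg(1) sT] bot[OF s' fg'(1) sT']]
      by simp
  qed
  show ?thesis unfolding mult
  proof (rule the_equality)
    show "\<exists>t\<in>cubes Z (Suc (Suc 0)). Q (?cls (?d 0 False s)) (?cls (?d (Suc 0) True s)) (?cls (?d (Suc 0) False s)) t"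
      using s fg sT unfolding Q_def by blast
  next
    fix C assume "\<exists>t\<in>cubes Z (Suc (Suc 0)). Q (?cls (?d 0 False s)) (?cls (?d (Suc 0) True s)) C t"
    then show "C = ?cls (?d (Suc 0) False s)" using uniq unfolding Q_def by blast
  qed
qed

text \<open>A square exhibiting a product in Z exists by the Kan condition, and F sends it to a
  square exhibiting the product of the images.\<close>

lemma pi1_mult_map:
  assumes Z: "akan Z" and W: "akan W" and F: "cubical_map Z W F" and z: "z \<in> cubes Z 0"
    and A: "A \<in> pi0 (loops Z z (Suc 0))" and B: "B \<in> pi0 (loops Z z (Suc 0))"
  shows "pi0_map (loops W (F 0 z) (Suc 0)) (loop_map F) (pi1_mult (Z, z) A B) =
    pi1_mult (W, F 0 z) (pi0_map (loops W (F 0 z) (Suc 0)) (loop_map F) A) (pi0_map (loops W (F 0 z) (Suc 0)) (loop_map F) B)"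
proof -
  note cZ = akan_cubical[OF Z] and cW = akan_cubical[OF W]
  let ?L = "loops Z z (Suc 0)" and ?M = "loops W (F 0 z) (Suc 0)"
  have w: "F 0 z \<in> cubes W 0" by (rule cubical_map_in[OF F z])
  note LV = loop_once_vertices[OF cZ z] and MV = loop_once_vertices[OF cW w]
  have L: "akan ?L" and M: "akan ?M" by (rule akan_loop[OF Z z], rule akan_loop[OF W w])
  note cL = akan_cubical[OF L] and cM = akan_cubical[OF M]
  have LF: "cubical_map ?L ?M (loop_map F)" using cubical_map_loop[OF cZ z cW F, of "Suc 0"] by simp
  note cls = pi0_map_class[OF cL cM LF, of _ 0]
  obtain f g where f: "f \<in> cubes ?L 0" "A = pi0_class ?L 0 f" and g: "g \<in> cubes ?L 0" "B = pi0_class ?L 0 g"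
    using pi0_cases[OF cL A] pi0_cases[OF cL B] by metis
  define u where "u j \<eta> = (if j = 0 then (if \<eta> then const_cube Z z (Suc 0) else f) else g)" for j :: nat and \<eta>
  obtain s where s: "s \<in> cubes Z (Suc (Suc 0))" "\<And>j \<eta>. j \<le> Suc 0 \<Longrightarrow> (j, \<eta>) \<noteq> (Suc 0, False) \<Longrightarrow> fac Z (Suc 0) j \<eta> s = u j \<eta>"
    by (rule akan_fill[OF Z, of "Suc 0" "Suc 0" False u])
      (use f g cZ z in \<open>auto simp: u_def LV le_Suc_eq const_cube_0\<close>)
  have s3: "fac Z (Suc 0) 0 False s = f" "fac Z (Suc 0) (Suc 0) True s = g" "fac Z (Suc 0) 0 True s = const_cube Z z (Suc 0)"
    using s(2)[of 0 False] s(2)[of "Suc 0" True] s(2)[of 0 True] by (simp_all add: u_def)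
  have "pi1_mult (Z, z) A B = pi0_class ?L 0 (fac Z (Suc 0) (Suc 0) False s)"
    using pi1_mult_eq[OF Z z s(1)] s3 f g by simp
  have "fac Z 0 0 \<eta> (fac Z (Suc 0) (Suc 0) False s) = z" for \<eta>
    using fac_fac[OF cZ, of 0 "Suc 0" 0 s \<eta> False] s s3 f cZ z by (cases \<eta>) (auto simp: LV const_cube_0)
  then have c: "fac Z (Suc 0) (Suc 0) False s \<in> cubes ?L 0" using s cZ by (simp add: LV)
  have Fs: "fac W (Suc 0) j \<eta> (F (Suc (Suc 0)) s) = F (Suc 0) (fac Z (Suc 0) j \<eta> s)" if "j \<le> Suc 0" for j \<eta>
    using map_fac[OF F that s(1)] by simp
  have lm: "loop_map F 0 a = F (Suc 0) a" for a by (simp add: loop_map_def)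
  have in': "F (Suc 0) f \<in> cubes ?M 0" "F (Suc 0) g \<in> cubes ?M 0"
    using cubical_map_in[OF LF] f g lm by metis+
  have "pi1_mult (W, F 0 z) (pi0_class ?M 0 (F (Suc 0) f)) (pi0_class ?M 0 (F (Suc 0) g)) =
      pi0_class ?M 0 (F (Suc 0) (fac Z (Suc 0) (Suc 0) False s))"
    using pi1_mult_eq[OF W w cubical_map_in[OF F s(1)]] in' map_const_cube[OF F z, of "Suc 0"] by (simp add: Fs s3)
  then show ?thesis
    using pi1_mult_eq[OF Z z s(1)] s3 f g c by (simp add: cls lm)
qed

text \<open>Multiplicativity holds for every map, by writing the n-fold loop object as a single loop
  object of the (n-1)-fold one and applying \<open>pi1_mult_map\<close> there.\<close>

lemma pi_iso_iff:
  assumes X: "akan X" and Y: "akan Y" and f: "cubical_map X Y f" and x: "x \<in> cubes X 0" and n: "n \<ge> 1"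
  shows "pi_map n (Y, f 0 x) f \<in> iso (pi_group n (X, x)) (pi_group n (Y, f 0 x)) \<longleftrightarrow>
    bij_betw (pi_map n (Y, f 0 x) f) (pi_set n (X, x)) (pi_set n (Y, f 0 x))"
proof -
  note cX = akan_cubical[OF X] and cY = akan_cubical[OF Y]
  have y: "f 0 x \<in> cubes Y 0" by (rule cubical_map_in[OF f x])
  obtain m where m: "n = Suc m" using n by (cases n) auto
  let ?Z = "loops X x m" and ?z = "const_cube X x m" and ?W = "loops Y (f 0 x) m" and ?F = "(loop_map ^^ m) f"
  have Fz: "?F 0 ?z = const_cube Y (f 0 x) m"
    using map_const_cube[OF f x] by (simp add: loop_map_iterate)
  have zin: "?z \<in> cubes ?Z 0"
    using cX x fac_const_cube[OF cX x, of _ "m - 1"] by (cases m) (auto simp: loop_vertices)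
  have lpX: "loops X x n = loops ?Z ?z (Suc 0)"
    unfolding m loops_def[of X x "Suc m"] funpow.simps comp_apply loop_object_iterate[OF cX x] loop_once ..
  have lpY: "loops Y (f 0 x) n = loops ?W (?F 0 ?z) (Suc 0)"
    unfolding m loops_def[of Y "f 0 x" "Suc m"] funpow.simps comp_apply loop_object_iterate[OF cY y] loop_once Fz ..
  have pm: "pi_map n (Y, f 0 x) f = pi0_map (loops ?W (?F 0 ?z) (Suc 0)) (loop_map ?F)"
    unfolding pi_map_def loops_def[symmetric] lpY unfolding m by simp
  have "pi_map n (Y, f 0 x) f (pi1_mult (?Z, ?z) A B) =
      pi1_mult (?W, ?F 0 ?z) (pi_map n (Y, f 0 x) f A) (pi_map n (Y, f 0 x) f B)"
    if "A \<in> pi_set n (X, x)" "B \<in> pi_set n (X, x)" for A B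
    unfolding pm
    by (rule pi1_mult_map[OF akan_loop[OF X x] akan_loop[OF Y y] cubical_map_loop[OF cX x cY f] zin])
      (use that in \<open>simp_all add: pi_set_def loops_def[symmetric] lpX\<close>)
  then show ?thesis
    unfolding iso_def hom_def pi_group_def
    using loop_object_iterate[OF cX x, of m] loop_object_iterate[OF cY y, of m]
    by (auto simp: m Fz bij_betw_def)
qed

section \<open>Weak equivalences and homotopy groups\<close>

lemma weq_loop_surj:
  assumes X: "cubical_set X" and Y: "cubical_set Y" and f: "cubical_map X Y f" and x: "x \<in> cubes X 0"
    and W: "weq X Y f" and b: "b \<in> cubes (loops Y (f 0 x) n) 0"
  shows "\<exists>a\<in>cubes (loops X x n) 0. rh Y n (f n a) b"
proof -
  have y: "f 0 x \<in> cubes Y 0" by (rule cubical_map_in[OF f x])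
  have "fam X n (n - 1) (\<lambda>j \<eta>. const_cube X x (n - 1))"
  proof (rule famI)
    fix i j \<epsilon> \<eta> assume "j < n" "i < j"
    then show "fac X (n - 1 - 1) i \<epsilon> (const_cube X x (n - 1)) = fac X (n - 1 - 1) (j - 1) \<eta> (const_cube X x (n - 1))"
      using X x by (cases n; cases "n - 1") auto
  qed (use X x in auto)
  then have "lift_problem X Y f n (\<lambda>j \<eta>. const_cube X x (n - 1)) b"
    unfolding lift_problem_def using b map_const_cube[OF f x] by (auto simp: loop_vertices[OF Y y])
  then obtain v where "v \<in> cubes X n" "\<forall>j<n. \<forall>\<eta>. fac X (n - 1) j \<eta> v = const_cube X x (n - 1)" "rh Y n (f n v) b"
    using W unfolding weq_def lift_solution_def by blast
  then show ?thesis by (auto simp: loop_vertices[OF X x])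
qed

lemma weq_loop_inj:
  assumes X: "cubical_set X" and Y: "cubical_set Y" and f: "cubical_map X Y f" and x: "x \<in> cubes X 0"
    and W: "weq X Y f" and ab: "a \<in> cubes (loops X x n) 0" "b \<in> cubes (loops X x n) 0" and r: "rh Y n (f n a) (f n b)"
  shows "rh X n a b"
  by (rule lift_rh[OF X Y f weq_fill[OF W] _ _ _ r]) (use ab in \<open>auto simp: loop_vertices[OF X x]\<close>)

lemma weq_pi:
  assumes X: "akan X" and Y: "akan Y" and f: "cubical_map X Y f" and W: "weq X Y f"
  shows "bij_betw (pi0_map Y f) (pi0 X) (pi0 Y)"
    and "x \<in> cubes X 0 \<Longrightarrow> bij_betw (pi_map n (Y, f 0 x) f) (pi_set n (X, x)) (pi_set n (Y, f 0 x))"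
proof -
  note cX = akan_cubical[OF X] and cY = akan_cubical[OF Y]
  show "bij_betw (pi_map n (Y, f 0 x) f) (pi_set n (X, x)) (pi_set n (Y, f 0 x))" if "x \<in> cubes X 0"
    unfolding pi_bij_iff[OF X Y f that]
    using weq_loop_surj[OF cX cY f that W] weq_loop_inj[OF cX cY f that W] by blast
  \<comment> \<open>As X may be empty, surjectivity on components is not an instance of the pointed
    case; it is the lifting problem with empty boundary. For injectivity, a vertex a serves as its
    own base point.\<close>
  have "\<exists>a\<in>cubes X 0. rh Y 0 (f 0 a) b" if "b \<in> cubes Y 0" for b
  proof -
    have "lift_problem X Y f 0 (\<lambda>_ _. undefined) b" using that by (simp add: lift_problem_def fam_def)
    then show ?thesis using W unfolding weq_def lift_solution_def by blast
  qed
  moreover have "rh X 0 a b" if "a \<in> cubes X 0" "b \<in> cubes X 0" "rh Y 0 (f 0 a) (f 0 b)" for a b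
    using weq_loop_inj[OF cX cY f that(1) W, of a 0 b] that by (simp add: loops_0)
  ultimately show "bij_betw (pi0_map Y f) (pi0 X) (pi0 Y)" unfolding pi0_bij_iff[OF X Y f] by blast
qed

lemma lift_problem_cong: "(\<And>j \<eta>. j < n \<Longrightarrow> u j \<eta> = u' j \<eta>) \<Longrightarrow> lift_problem X Y f n u w \<longleftrightarrow> lift_problem X Y f n u' w"
  by (simp add: lift_problem_def fam_def)

lemma lift_solution_cong: "(\<And>j \<eta>. j < n \<Longrightarrow> u j \<eta> = u' j \<eta>) \<Longrightarrow> lift_solution X Y f n u w \<longleftrightarrow> lift_solution X Y f n u' w"
  by (simp add: lift_solution_def)

text \<open>All faces but the last one are faces of a cube that depends on the first \<open>k\<close> coordinates only. They are
  contracted one coordinate at a time, by a connection joining that coordinate to the homotopy parameter,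
  and the last face is carried along by homotopy extension.\<close>

lemma solution_contract:
  assumes X: "akan X" and Y: "akan Y" and f: "cubical_map X Y f"
    and inj: "\<And>x a b. x \<in> cubes X 0 \<Longrightarrow> a \<in> cubes (loops X x m) 0 \<Longrightarrow> b \<in> cubes (loops X x m) 0 \<Longrightarrow> rh Y m (f m a) (f m b) \<Longrightarrow> rh X m a b"
    and surj: "\<And>x b. x \<in> cubes X 0 \<Longrightarrow> b \<in> cubes (loops Y (f 0 x) (Suc m)) 0 \<Longrightarrow> \<exists>a\<in>cubes (loops X x (Suc m)) 0. rh Y (Suc m) (f (Suc m) a) b"
  shows "k \<le> Suc m \<Longrightarrow> c \<in> cubes X k \<Longrightarrow>
    (\<And>j \<eta>. j \<le> m \<Longrightarrow> (j, \<eta>) \<noteq> (m, True) \<Longrightarrow> u j \<eta> = fac X m j \<eta> (app X (Suc m) k (take k) c)) \<Longrightarrow>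
    lift_problem X Y f (Suc m) u w \<Longrightarrow> lift_solution X Y f (Suc m) u w"
proof (induction k arbitrary: c u w)
  note cX = akan_cubical[OF X] and cY = akan_cubical[OF Y]
  case 0
  have x: "c \<in> cubes X 0" by (rule 0)
  have y: "f 0 c \<in> cubes Y 0" by (rule cubical_map_in[OF f x])
  have "app X (Suc m) 0 (take 0) c = const_cube X c (Suc m)" by (simp add: const_cube_app)
  then have uc: "u j \<eta> = const_cube X c m" if "j \<le> m" "(j, \<eta>) \<noteq> (m, True)" for j \<eta>
    using 0(3)[OF that] that cX x by simp
  have u: "fam X (Suc m) m u" and w: "w \<in> cubes Y (Suc m)" and wu: "\<And>j \<eta>. j < Suc m \<Longrightarrow> fac Y m j \<eta> w = f m (u j \<eta>)"
    using 0(4) by (auto simp: lift_problem_def)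
  let ?b = "u m True"
  have b: "?b \<in> cubes X m" using fam_in[OF u] by simp
  have "fac X (m - 1) i \<epsilon> ?b = const_cube X c (m - 1)" if "i < m" for i \<epsilon>
    using fam_fac[OF u, of m i \<epsilon> True] that uc[of i \<epsilon>] cX x by (cases m) auto
  then have bL: "?b \<in> cubes (loops X c m) 0" using b by (simp add: loop_vertices[OF cX x])
  have cL: "const_cube X c m \<in> cubes (loops X c m) 0"
    using cX x by (cases m) (auto simp: loop_vertices)
  have fc: "f m (const_cube X c m) = const_cube Y (f 0 c) m" by (rule map_const_cube[OF f x])
  have cL': "const_cube Y (f 0 c) m \<in> cubes (loops Y (f 0 c) m) 0"
    using cY y by (cases m) (auto simp: loop_vertices)
  \<comment> \<open>The cube w itself is a null homotopy of the image of the one face that may be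
    nonconstant.\<close>
  have "rh Y m (f m (const_cube X c m)) (f m ?b)"
    unfolding fc rh_loop_edge[OF cY y cL'] using w wu uc fc cubical_map_in[OF f b] by (auto intro!: bexI[of _ w])
  from inj[OF x cL bL this] obtain h where h: "h \<in> cubes X (Suc m)" "fac X m m False h = const_cube X c m" "fac X m m True h = ?b"
    "\<And>j \<eta>. j < m \<Longrightarrow> fac X m j \<eta> h = const_cube X c m"
    unfolding rh_loop_edge[OF cX x cL] by auto
  define U where "U j \<eta> = (if (j, \<eta>) = (m, True) then h else const_cube X c (Suc m))" for j \<eta>
  have U: "fam X (Suc m) (Suc m) U"
  proof (rule famI)
    fix i j \<epsilon> \<eta> assume "j < Suc m" "i < j"
    then show "fac X (Suc m - 1) i \<epsilon> (U j \<eta>) = fac X (Suc m - 1) (j - 1) \<eta> (U i \<epsilon>)"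
      using cX x h by (auto simp: U_def)
  qed (use cX x h in \<open>auto simp: U_def\<close>)
  have e0: "fend X (Suc m) False U j \<eta> = const_cube X c m" if "j < Suc m" for j \<eta>
    using h cX x by (auto simp: fend_def U_def)
  have e1: "fend X (Suc m) (\<not> False) U j \<eta> = u j \<eta>" if "j < Suc m" for j \<eta>
    using h cX x uc[of j \<eta>] that by (auto simp: fend_def U_def)
  have "lift_solution X Y f (Suc m) (fend X (Suc m) (\<not> False) U) w"
  proof (rule solution_deform[OF X Y f U])
    show "lift_problem X Y f (Suc m) (fend X (Suc m) (\<not> False) U) w"
      by (rule iffD2[OF lift_problem_cong[of "Suc m", OF e1] 0(4)])
    fix w' assume "lift_problem X Y f (Suc m) (fend X (Suc m) False U) w'"
    then have "w' \<in> cubes (loops Y (f 0 c) (Suc m)) 0"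
      using e0 fc by (auto simp: lift_problem_def loop_vertices[OF cY y])
    from surj[OF x this] show "lift_solution X Y f (Suc m) (fend X (Suc m) False U) w'"
      by (fastforce simp: e0 lift_solution_def loop_vertices[OF cX x])
  qed
  then show ?case
    using lift_solution_cong[of "Suc m" "fend X (Suc m) (\<not> False) U" u X Y f w, OF e1] by blast
next
  note cX = akan_cubical[OF X] and cY = akan_cubical[OF Y]
  case (Suc k)
  have k: "k \<le> m" and c: "c \<in> cubes X (Suc k)" using Suc(2,3) by auto
  have u: "fam X (Suc m) m u" using Suc(5) by (simp add: lift_problem_def)
  \<comment> \<open>At parameter 1 this is the projection to the first k + 1 coordinates; at
    parameter 0 the coordinate k is replaced by 0, which leaves a cube depending on k
    coordinates.\<close>
  define \<beta> where "\<beta> v = take k v @ [v ! k \<and> last v]" for v :: "bool list"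
  have bm1: "bm (Suc (Suc m)) (Suc (Suc k)) (rwhisk (Suc m) (take (Suc k)))"
    using bm_rwhisk[OF bm_take[of "Suc k" "Suc m"], of "Suc 0"] k by simp
  have bm\<beta>: "bm (Suc (Suc m)) (Suc k) \<beta>"
  proof (rule bm_comp'[OF bm1 bm_cf[of k "Suc k" True]])
    fix v :: "bool list" assume v: "length v = Suc (Suc m)"
    then have "drop (Suc m) v = [last v]"
      by (metis append_butlast_last_id append_eq_conv_conj diff_Suc_1 length_0_conv length_butlast nat.distinct(1))
    then show "\<beta> v = cf k True (rwhisk (Suc m) (take (Suc k)) v)"
      using v k by (simp add: \<beta>_def rwhisk_def cf_def min_absorb1 min_absorb2 nth_append)
  qed simp
  define B where "B = app X (Suc (Suc m)) (Suc k) \<beta> c"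
  define A where "A = app X (Suc m) (Suc k) (take (Suc k)) c"
  have B: "B \<in> cubes X (Suc (Suc m))" unfolding B_def using cX bm\<beta> c by simp
  have A: "A \<in> cubes X (Suc m)" unfolding A_def using cX bm_take[OF Suc(2)] c by simp
  have c': "fac X k k False c \<in> cubes X k" using cX c by simp
  have BA: "fac X (Suc m) (Suc m) True B = A"
    unfolding B_def A_def fac_def
    by (rule app_app_eq1[OF cX bm_fc bm\<beta> c])
      (use k in \<open>auto simp: \<beta>_def fc_def nth_append take_Suc_conv_app_nth\<close>)
  have BA': "fac X (Suc m) (Suc m) False B = app X (Suc m) k (take k) (fac X k k False c)"
    unfolding B_def fac_def
    by (rule app_app_eq[OF cX bm_fc bm\<beta> bm_take bm_fc c])
      (use k in \<open>auto simp: \<beta>_def fc_def nth_append\<close>)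
  have uA: "u j \<eta> = fac X m j \<eta> A" if "j \<le> m" "(j, \<eta>) \<noteq> (m, True)" for j \<eta>
    using Suc(4)[OF that] by (simp add: A_def)
  define B' where "B' = fac X (Suc m) m True B"
  have B': "B' \<in> cubes X (Suc m)" using cX B by (simp add: B'_def)
  have B'A: "fac X m m True B' = fac X m m True A"
    using fac_fac[OF cX, of m "Suc m" m B True True] B BA by (simp add: B'_def)
  have bd: "fac X (m - 1) j \<eta> (u m True) = fend X m True (\<lambda>j \<eta>. fac X m j \<eta> B') j \<eta>" if j: "j < m" for j \<eta>
  proof -
    note ff = fac_fac_pred[OF cX _ j order_refl]
    have "fac X (m - 1) j \<eta> (u m True) = fac X (m - 1) (m - 1) True (u j \<eta>)" using fam_fac[OF u, of m j \<eta> True] j by simp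
    also have "\<dots> = fac X (m - 1) j \<eta> (fac X m m True B')" using uA[of j \<eta>] j ff[OF A] by (simp add: B'A)
    also have "\<dots> = fac X (m - 1) (m - 1) True (fac X m j \<eta> B')" by (rule ff[OF B'])
    finally show ?thesis by (simp add: fend_def)
  qed
  \<comment> \<open>The exceptional face is not a face of the contracted cube. It is carried along
    by extending the homotopy on its boundary, which is prescribed by the neighbouring faces of
    B.\<close>
  obtain W where W: "W \<in> cubes X (Suc m)" "fac X m m True W = u m True" "\<And>j \<eta>. j < m \<Longrightarrow> fac X m j \<eta> W = fac X m j \<eta> B'"
    "\<And>j \<eta>. j < m \<Longrightarrow> fac X (m - 1) j \<eta> (fac X m m (\<not> True) W) = fend X m (\<not> True) (\<lambda>j \<eta>. fac X m j \<eta> B') j \<eta>"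
    by (rule homotopy_extension[OF X fam_faces[OF cX B', of m] fam_in[OF u, of m True] bd]) auto
  define U where "U j \<eta> = (if (j, \<eta>) = (m, True) then W else fac X (Suc m) j \<eta> B)" for j \<eta>
  have U: "fam X (Suc m) (Suc m) U"
  proof (rule famI)
    fix i j \<epsilon> \<eta> assume *: "j < Suc m" "i < j"
    have "fac X m i \<epsilon> (fac X (Suc m) j \<eta> B) = fac X m (j - 1) \<eta> (fac X (Suc m) i \<epsilon> B)"
      by (rule fac_fac[OF cX]) (use * B in auto)
    then show "fac X (Suc m - 1) i \<epsilon> (U j \<eta>) = fac X (Suc m - 1) (j - 1) \<eta> (U i \<epsilon>)"
      using * W by (auto simp: U_def B'_def)
  qed (use cX B W in \<open>auto simp: U_def\<close>)
  have BU: "fac X m m \<epsilon> (fac X (Suc m) j \<eta> B) = fac X m j \<eta> (fac X (Suc m) (Suc m) \<epsilon> B)" if "j \<le> m" for j \<eta> \<epsilon>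
    using fac_fac[OF cX, of j "Suc m" m B \<eta> \<epsilon>] B that by simp
  have e1: "fend X (Suc m) (\<not> False) U j \<eta> = u j \<eta>" if "j < Suc m" for j \<eta>
    using that uA[of j \<eta>] W by (auto simp: fend_def U_def BU BA)
  have "lift_solution X Y f (Suc m) (fend X (Suc m) (\<not> False) U) w"
  proof (rule solution_deform[OF X Y f U])
    show "lift_problem X Y f (Suc m) (fend X (Suc m) (\<not> False) U) w"
      by (rule iffD2[OF lift_problem_cong[of "Suc m", OF e1] Suc(5)])
    fix w' assume P: "lift_problem X Y f (Suc m) (fend X (Suc m) False U) w'"
    show "lift_solution X Y f (Suc m) (fend X (Suc m) False U) w'"
    proof (rule Suc(1)[OF _ c' _ P])
      fix j \<eta> assume "j \<le> m" "(j, \<eta>) \<noteq> (m, True)"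
      then show "fend X (Suc m) False U j \<eta> = fac X m j \<eta> (app X (Suc m) k (take k) (fac X k k False c))"
        by (auto simp: fend_def U_def BU BA')
    qed (use k in simp)
  qed
  then show ?case
    using lift_solution_cong[of "Suc m" "fend X (Suc m) (\<not> False) U" u X Y f w, OF e1] by blast
qed

lemma pi_weq:
  assumes X: "akan X" and Y: "akan Y" and f: "cubical_map X Y f"
    and pi0: "bij_betw (pi0_map Y f) (pi0 X) (pi0 Y)"
    and pi: "\<And>x n. x \<in> cubes X 0 \<Longrightarrow> n \<ge> 1 \<Longrightarrow> bij_betw (pi_map n (Y, f 0 x) f) (pi_set n (X, x)) (pi_set n (Y, f 0 x))"
  shows "weq X Y f"
  unfolding weq_def
proof (intro allI impI)
  fix n u w assume P: "lift_problem X Y f n u w"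
  note cX = akan_cubical[OF X] and cY = akan_cubical[OF Y]
  note pi0' = pi0[unfolded pi0_bij_iff[OF X Y f]]
  have inj: "rh X m a b" if "x \<in> cubes X 0" "a \<in> cubes (loops X x m) 0" "b \<in> cubes (loops X x m) 0" "rh Y m (f m a) (f m b)" for x m a b
  proof (cases m)
    case 0 then show ?thesis using pi0' that by (simp add: loops_0)
  next
    case (Suc m')
    then show ?thesis using pi[OF that(1), of m] that unfolding pi_bij_iff[OF X Y f that(1)] by simp
  qed
  have surj: "\<exists>a\<in>cubes (loops X x (Suc m)) 0. rh Y (Suc m) (f (Suc m) a) b"
    if "x \<in> cubes X 0" "b \<in> cubes (loops Y (f 0 x) (Suc m)) 0" for x m b
    using pi[OF that(1), of "Suc m"] that unfolding pi_bij_iff[OF X Y f that(1)] by simp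
  show "lift_solution X Y f n u w"
  proof (cases n)
    case 0
    then show ?thesis using pi0' P by (auto simp: lift_problem_def lift_solution_def)
  next
    case (Suc m)
    have u: "fam X (Suc m) m u" using P Suc by (simp add: lift_problem_def)
    \<comment> \<open>The faces other than the exceptional one form an open box. Its filler depends
      on all m + 1 coordinates, which starts the contraction.\<close>
    obtain A where A: "A \<in> cubes X (Suc m)" "\<And>j \<eta>. j \<le> m \<Longrightarrow> (j, \<eta>) \<noteq> (m, True) \<Longrightarrow> fac X m j \<eta> A = u j \<eta>"
      by (rule akan_fill[OF X, of m m True u]) (use fam_in[OF u] fam_fac[OF u] in auto)
    have "app X (Suc m) (Suc m) (take (Suc m)) A = A" by (rule app_ident[OF cX _ A(1)]) simp
    then have "lift_solution X Y f (Suc m) u w"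
      by (intro solution_contract[OF X Y f inj surj, where k = "Suc m" and c = A]) (use A P Suc in auto)
    then show ?thesis using Suc by simp
  qed
qed

section \<open>Homotopies and the geometric product\<close>

lemma lwhisk_box_map: "box_map q q' y \<Longrightarrow> bm (p + q) (p + q') (lwhisk p y)"
  by (rule bm_lwhisk[OF box_map_bm])

lemma box_tensor_whisk:
  "box_map p p' \<alpha> \<Longrightarrow> length v = p + q \<Longrightarrow> box_tensor p q \<alpha> \<beta> v = rwhisk p \<alpha> (lwhisk p \<beta> v)"
  by (simp add: box_tensor_def rwhisk_def lwhisk_def min_absorb1)

lemma bm_box_tensor:
  assumes "box_map p p' \<alpha>" "box_map q q' \<beta>"
  shows "bm (p + q) (p' + q') (box_tensor p q \<alpha> \<beta>)"
  by (rule bm_comp'[OF bm_lwhisk[OF box_map_bm[OF assms(2)]] bm_rwhisk[OF box_map_bm[OF assms(1)]]])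
    (use assms box_tensor_whisk in auto)

abbreviation geom_gen :: "'a cubical \<Rightarrow> 'b cubical \<Rightarrow> nat \<Rightarrow> (('a, 'b) geom_rep \<times> ('a, 'b) geom_rep) set" where
  "geom_gen X Y n \<equiv> {((p, q, act X p p' \<alpha> x, act Y q q' \<beta> y, \<phi>),
       (p', q', x, y, compose (vertices n) (box_tensor p q \<alpha> \<beta>) \<phi>)) | p q p' q' \<alpha> \<beta> x y \<phi>.
       box_map p p' \<alpha> \<and> box_map q q' \<beta> \<and> x \<in> cubes X p' \<and> y \<in> cubes Y q' \<and> box_map n (p + q) \<phi>}"

lemma compose_eq_restrict: "compose (vertices n) \<psi> \<phi> = restrict (\<psi> \<circ> \<phi>) (vertices n)"
  by (simp add: compose_def comp_def)

lemma box_map_compose_bm: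
  "box_map l m \<phi> \<Longrightarrow> bm m n \<psi> \<Longrightarrow> box_map l n (compose (vertices l) \<psi> \<phi>)"
  unfolding compose_eq_restrict using bm_comp[OF box_map_bm] by (auto simp: bm_def)

lemma geom_gen_sub:
  assumes X: "cubical_set X" and Y: "cubical_set Y"
  shows "geom_gen X Y n \<subseteq> geom_reps X Y n \<times> geom_reps X Y n"
proof clarify
  fix p q p' q' \<alpha> \<beta> x y \<phi>
  assume *: "box_map p p' \<alpha>" "box_map q q' \<beta>" "x \<in> cubes X p'" "y \<in> cubes Y q'" "box_map n (p + q) \<phi>"
  have "box_map n (p' + q') (compose (vertices n) (box_tensor p q \<alpha> \<beta>) \<phi>)"
    by (rule box_map_compose_bm[OF *(5) bm_box_tensor[OF *(1,2)]])
  then show "(p, q, act X p p' \<alpha> x, act Y q q' \<beta> y, \<phi>) \<in> geom_reps X Y n \<and>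
     (p', q', x, y, compose (vertices n) (box_tensor p q \<alpha> \<beta>) \<phi>) \<in> geom_reps X Y n"
    using * X Y by (auto simp: geom_reps_def app_box_map box_map_bm)
qed

lemma geom_equiv: "cubical_set X \<Longrightarrow> cubical_set Y \<Longrightarrow> equiv (geom_reps X Y n) (geom_rel X Y n)"
  unfolding geom_rel_def by (rule gen_equiv_equiv[OF geom_gen_sub])

lemma cubical_set_std_cube: "cubical_set (std_cube k)"
  unfolding cubical_set_def std_cube_def
proof (simp, intro conjI allI impI)
  fix n x assume x: "box_map n k x"
  have "compose (vertices n) x (box_id n) = restrict x (vertices n)"
    by (auto simp: compose_def box_id_def restrict_def fun_eq_iff)
  then show "compose (vertices n) x (box_id n) = x" by (simp add: box_map_ext[OF x])
next
  fix l m n \<psi> \<phi> x assume "box_map l m \<psi>"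
  then show "compose (vertices l) x (compose (vertices l) \<phi> \<psi>) = compose (vertices l) (compose (vertices m) x \<phi>) \<psi>"
    by (auto simp: compose_def restrict_def fun_eq_iff box_map_length)
qed (auto intro: box_map.comp)

text \<open>Precomposition respects the generators of the relation, so the image of a class lies
  within one class and the operator may be computed on any representative.\<close>

lemma geom_prod_app:
  assumes X: "cubical_set X" and Y: "cubical_set Y" and \<psi>: "bm m n \<psi>" and r: "(p, q, x, y, \<phi>) \<in> geom_reps X Y n"
  shows "app (geom_prod X Y) m n \<psi> (geom_rel X Y n `` {(p, q, x, y, \<phi>)}) =
    geom_rel X Y m `` {(p, q, x, y, restrict (\<phi> \<circ> \<psi>) (vertices m))}"
proof -
  let ?g = "\<lambda>(p, q, x, y, \<phi>). (p, q, x, y, restrict (\<phi> \<circ> \<psi>) (vertices m))"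
  note eq = geom_equiv[OF X Y]
  have gin: "?g s \<in> geom_reps X Y m" if "s \<in> geom_reps X Y n" for s
    using that bm_comp[OF \<psi> box_map_bm] by (auto simp: geom_reps_def bm_def)
  have step: "geom_rel X Y m `` {?g s} = geom_rel X Y m `` {?g t}" if "(s, t) \<in> geom_rel X Y n" for s t
    using that unfolding geom_rel_def[of X Y n]
  proof (rule gen_equiv_invariant[OF _ geom_gen_sub[OF X Y]])
    fix s t assume "(s, t) \<in> geom_gen X Y n"
    then obtain p q p' q' \<alpha> \<beta> x y \<phi> where
      s: "s = (p, q, act X p p' \<alpha> x, act Y q q' \<beta> y, \<phi>)" and
      t: "t = (p', q', x, y, compose (vertices n) (box_tensor p q \<alpha> \<beta>) \<phi>)" and
      *: "box_map p p' \<alpha>" "box_map q q' \<beta>" "x \<in> cubes X p'" "y \<in> cubes Y q'" "box_map n (p + q) \<phi>"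
      by blast
    let ?\<phi> = "restrict (\<phi> \<circ> \<psi>) (vertices m)"
    have "restrict (compose (vertices n) (box_tensor p q \<alpha> \<beta>) \<phi> \<circ> \<psi>) (vertices m) =
       compose (vertices m) (box_tensor p q \<alpha> \<beta>) ?\<phi>"
      unfolding compose_def by (rule restrict_vertices_eqI) (simp add: bm_length[OF \<psi>])
    moreover have "box_map m (p + q) ?\<phi>" using bm_comp[OF \<psi> box_map_bm[OF *(5)]] by (simp add: bm_def)
    ultimately have "(?g s, ?g t) \<in> geom_gen X Y m" using * unfolding s t by auto
    then show "geom_rel X Y m `` {?g s} = geom_rel X Y m `` {?g t}"
      unfolding geom_rel_def by (intro equiv_class_eq[OF gen_equiv_equiv] gen_equiv_step geom_gen_sub[OF X Y])
  qed
  have "compose (vertices m) \<phi> (restrict \<psi> (vertices m)) = restrict (\<phi> \<circ> \<psi>) (vertices m)" for \<phi> :: "bool list \<Rightarrow> bool list"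
    unfolding compose_def by (rule restrict_vertices_eqI) simp
  then have "app (geom_prod X Y) m n \<psi> C = geom_rel X Y m `` (?g ` C)" for C
    by (simp add: app_def geom_prod_def)
  moreover have "geom_rel X Y m `` (?g ` (geom_rel X Y n `` {r})) = geom_rel X Y m `` {?g r}" if "r \<in> geom_reps X Y n" for r
    using step equiv_class_self[OF eq that] by blast
  ultimately show ?thesis using r by force
qed

lemma geom_rel_step:
  assumes X: "cubical_set X" and Y: "cubical_set Y" and ab: "bm p p' \<alpha>" "bm q q' \<beta>"
    and x: "x \<in> cubes X p'" and y: "y \<in> cubes Y q'" and \<phi>: "box_map n (p + q) \<phi>"
    and \<chi>: "\<chi> = restrict (\<lambda>v. \<alpha> (take p (\<phi> v)) @ \<beta> (drop p (\<phi> v))) (vertices n)"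
  shows "((p, q, app X p p' \<alpha> x, app Y q q' \<beta> y, \<phi>), (p', q', x, y, \<chi>)) \<in> geom_rel X Y n"
proof -
  let ?\<alpha> = "restrict \<alpha> (vertices p)" and ?\<beta> = "restrict \<beta> (vertices q)"
  have "\<chi> = compose (vertices n) (box_tensor p q ?\<alpha> ?\<beta>) \<phi>"
    unfolding \<chi> compose_def by (rule restrict_vertices_eqI) (simp add: box_tensor_def box_map_length[OF \<phi>])
  then have "((p, q, act X p p' ?\<alpha> x, act Y q q' ?\<beta> y, \<phi>), (p', q', x, y, \<chi>)) \<in> geom_gen X Y n"
    using ab x y \<phi> unfolding bm_def by blast
  then show ?thesis unfolding geom_rel_def app_def by (rule gen_equiv_step[OF geom_gen_sub[OF X Y]])
qed

text \<open>The map \<open>X \<otimes> \<box>^1 \<rightarrow> Y\<close> induced by \<open>K\<close>, on representatives.\<close>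

definition geom_val :: "'b cubical \<Rightarrow> (nat \<Rightarrow> 'a \<Rightarrow> 'b) \<Rightarrow> nat \<Rightarrow> ('a, bool list \<Rightarrow> bool list) geom_rep \<Rightarrow> 'b" where
  "geom_val Y K n = (\<lambda>(p, q, x, y, \<phi>). app Y n (Suc p) (lwhisk p y \<circ> \<phi>) (K p x))"

lemma geom_val_bm: "box_map q 1 y \<Longrightarrow> box_map n (p + q) \<phi> \<Longrightarrow> bm n (Suc p) (lwhisk p y \<circ> \<phi>)"
  using bm_comp[OF box_map_bm lwhisk_box_map[of q 1 y p]] by simp

text \<open>Naturality of K in \<open>\<alpha>\<close> and the interchange law: applying y after
  \<open>\<beta>\<close> on the last coordinates and then \<open>\<alpha>\<close> on the first ones
  equals applying the tensor of \<open>\<alpha>\<close> and \<open>\<beta>\<close> and then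
  y.\<close>

lemma geom_val_rel:
  assumes X: "cubical_set X" and Y: "cubical_set Y" and K: "natural_homotopy X Y K f"
    and rs: "(r, s) \<in> geom_rel X (std_cube 1) n"
  shows "geom_val Y K n r = geom_val Y K n s"
  using rs unfolding geom_rel_def
proof (rule gen_equiv_invariant[OF _ geom_gen_sub[OF X cubical_set_std_cube]])
  fix r s assume "(r, s) \<in> geom_gen X (std_cube 1) n"
  then obtain p q p' q' \<alpha> \<beta> x y \<phi> where
    r: "r = (p, q, act X p p' \<alpha> x, act (std_cube 1) q q' \<beta> y, \<phi>)" and
    s: "s = (p', q', x, y, compose (vertices n) (box_tensor p q \<alpha> \<beta>) \<phi>)" and
    *: "box_map p p' \<alpha>" "box_map q q' \<beta>" "x \<in> cubes X p'" "y \<in> cubes (std_cube 1) q'" "box_map n (p + q) \<phi>"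
    by blast
  have y: "box_map q' 1 y" using *(4) by (simp add: std_cube_def)
  have y\<beta>: "box_map q 1 (compose (vertices q) y \<beta>)" by (rule box_map.comp[OF *(2) y])
  have Kx: "K p' x \<in> cubes Y (Suc p')" using K *(3) by (simp add: natural_homotopy_def)
  have "geom_val Y K n r = app Y n (Suc p) (lwhisk p (compose (vertices q) y \<beta>) \<circ> \<phi>) (K p (app X p p' \<alpha> x))"
    by (simp add: geom_val_def r std_cube_def app_box_map[OF *(1)])
  also have "K p (app X p p' \<alpha> x) = app Y (Suc p) (Suc p') (rwhisk p \<alpha>) (K p' x)"
    using K box_map_bm[OF *(1)] *(3) unfolding natural_homotopy_def by blast
  also have "app Y n (Suc p) (lwhisk p (compose (vertices q) y \<beta>) \<circ> \<phi>) \<dots> =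
      app Y n (Suc p') (lwhisk p' y \<circ> compose (vertices n) (box_tensor p q \<alpha> \<beta>) \<phi>) (K p' x)"
  proof (rule app_app_eq1[OF Y geom_val_bm[OF y\<beta> *(5)] _ Kx])
    show "bm (Suc p) (Suc p') (rwhisk p \<alpha>)" using bm_rwhisk[OF box_map_bm[OF *(1)], of "Suc 0"] by simp
    fix v :: "bool list" assume v: "length v = n"
    let ?w = "\<phi> v"
    have w: "length ?w = p + q" by (rule box_map_length[OF *(5) v])
    then show "rwhisk p \<alpha> ((lwhisk p (compose (vertices q) y \<beta>) \<circ> \<phi>) v) =
        (lwhisk p' y \<circ> compose (vertices n) (box_tensor p q \<alpha> \<beta>) \<phi>) v"
      using v box_map_length[OF *(1), of "take p ?w"]
      by (simp add: rwhisk_def lwhisk_def compose_def box_tensor_def)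
  qed
  also have "\<dots> = geom_val Y K n s" by (simp add: geom_val_def s)
  finally show "geom_val Y K n r = geom_val Y K n s" .
qed

lemma elementary_homotopicI:
  assumes X: "cubical_set X" and Y: "cubical_set Y" and f: "\<And>\<epsilon>. cubical_map X Y (f \<epsilon>)" and K: "natural_homotopy X Y K f"
  shows "elementary_homotopic X Y (f False) (f True)"
proof -
  note rel = geom_val_rel[OF X Y K]
  let ?I = "std_cube 1"
  note eq = geom_equiv[OF X cubical_set_std_cube, of 1]
  define H where "H n C = geom_val Y K n (SOME r. r \<in> C)" for n C
  have H: "H n (geom_rel X ?I n `` {r}) = geom_val Y K n r" if "r \<in> geom_reps X ?I n" for n r
  proof -
    have "r \<in> geom_rel X ?I n `` {r}" using equiv_class_self[OF eq that] .
    then have "(SOME s. s \<in> geom_rel X ?I n `` {r}) \<in> geom_rel X ?I n `` {r}" by (rule someI)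
    then show ?thesis unfolding H_def using rel by auto
  qed
  have val_in: "geom_val Y K n r \<in> cubes Y n" if "r \<in> geom_reps X ?I n" for n r
  proof -
    obtain p q x y \<phi> where r: "r = (p, q, x, y, \<phi>)" "x \<in> cubes X p" "box_map q 1 y" "box_map n (p + q) \<phi>"
      using \<open>r \<in> geom_reps X ?I n\<close> by (auto simp: geom_reps_def std_cube_def)
    then have "K p x \<in> cubes Y (Suc p)" using K by (simp add: natural_homotopy_def)
    then show ?thesis using Y geom_val_bm[OF r(3,4)] by (simp add: geom_val_def r)
  qed
  have Hmap: "cubical_map (geom_prod X ?I) Y H"
    unfolding cubical_map_def
  proof (intro conjI allI impI ballI funcsetI)
    fix n C assume "C \<in> cubes (geom_prod X ?I) n"
    then obtain r where "r \<in> geom_reps X ?I n" "C = geom_rel X ?I n `` {r}"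
      by (auto simp: geom_prod_def elim!: quotientE)
    then show "H n C \<in> cubes Y n" using H val_in by simp
  next
    fix m n \<psi> C assume \<psi>: "box_map m n \<psi>" and "C \<in> cubes (geom_prod X ?I) n"
    then obtain p q x y \<phi> where r: "(p, q, x, y, \<phi>) \<in> geom_reps X ?I n" "C = geom_rel X ?I n `` {(p, q, x, y, \<phi>)}"
      by (auto simp: geom_prod_def elim!: quotientE)
    then have *: "x \<in> cubes X p" "box_map q 1 y" "box_map n (p + q) \<phi>" by (auto simp: geom_reps_def std_cube_def)
    let ?\<phi> = "restrict (\<phi> \<circ> \<psi>) (vertices m)"
    have "box_map m (p + q) ?\<phi>" using bm_comp[OF box_map_bm[OF \<psi>] box_map_bm[OF *(3)]] by (simp add: bm_def)
    then have "(p, q, x, y, ?\<phi>) \<in> geom_reps X ?I m" using r(1) by (simp add: geom_reps_def)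
    then have "H m (act (geom_prod X ?I) m n \<psi> C) = geom_val Y K m (p, q, x, y, ?\<phi>)"
      unfolding r(2) app_box_map[OF \<psi>] geom_prod_app[OF X cubical_set_std_cube box_map_bm[OF \<psi>] r(1)] by (rule H)
    also have "\<dots> = app Y m n \<psi> (geom_val Y K n (p, q, x, y, \<phi>))"
      unfolding geom_val_def prod.case
      by (rule app_app_eq1[OF Y box_map_bm[OF \<psi>] geom_val_bm[OF *(2,3)], symmetric])
        (use K * in \<open>auto simp: natural_homotopy_def\<close>)
    finally show "H m (act (geom_prod X ?I) m n \<psi> C) = act Y m n \<psi> (H n C)"
      using H[OF r(1)] r(2) by (simp only: app_box_map[OF \<psi>])
  qed
  have ends: "H n (end_incl X \<epsilon> n x) = f \<epsilon> n x" if x: "x \<in> cubes X n" for n x \<epsilon>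
  proof -
    have y: "box_map 0 1 (face 1 1 \<epsilon>)" using box_map.face[of 1 1 \<epsilon>] by simp
    have "(n, 0, x, face 1 1 \<epsilon>, box_id n) \<in> geom_reps X ?I n"
      using x y box_map.ident[of n] by (simp add: geom_reps_def std_cube_def)
    then have "H n (end_incl X \<epsilon> n x) = app Y n (Suc n) (lwhisk n (face 1 1 \<epsilon>) \<circ> box_id n) (K n x)"
      unfolding end_incl_def by (simp only: H geom_val_def prod.case)
    also have "app Y n (Suc n) (lwhisk n (face 1 1 \<epsilon>) \<circ> box_id n) = app Y n (Suc n) (fc n \<epsilon>)"
      by (rule app_cong) (simp add: lwhisk_def face_def box_id_def fc_def)
    also have "\<dots> (K n x) = f \<epsilon> n x" using K x by (simp add: natural_homotopy_def fac_def)
    finally show ?thesis .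
  qed
  show ?thesis unfolding elementary_homotopic_def using f Hmap ends by blast
qed

lemma natural_homotopy_elementary:
  assumes "cubical_set X" "cubical_set Y" "cubical_map X Y f" "cubical_map X Y g"
    and "natural_homotopy X Y K (\<lambda>\<epsilon>. if \<epsilon> then g else f)"
  shows "elementary_homotopic X Y f g"
  using elementary_homotopicI[OF assms(1,2) _ assms(5)] assms(3,4) by (simp split: if_splits)

text \<open>The prism over x is the value at the class of x paired with the identity of the
  interval. Its ends and its naturality come from sliding a face of the interval, respectively an
  operator on x, across the tensor.\<close>

lemma elementary_homotopicE:
  assumes X: "cubical_set X" and Y: "cubical_set Y" and h: "elementary_homotopic X Y f g"
  obtains K where "natural_homotopy X Y K (\<lambda>\<epsilon>. if \<epsilon> then g else f)"
proof -
  let ?I = "std_cube 1" and ?h = "\<lambda>\<epsilon>. if \<epsilon> then g else f"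
  obtain H where H: "cubical_map (geom_prod X ?I) Y H" and ends: "\<And>n x \<epsilon>. x \<in> cubes X n \<Longrightarrow> H n (end_incl X \<epsilon> n x) = ?h \<epsilon> n x"
    using h unfolding elementary_homotopic_def by (auto split: if_splits)
  note cI = cubical_set_std_cube[of 1]
  note eq = geom_equiv[OF X cI]
  let ?cls = "\<lambda>n r. geom_rel X ?I n `` {r}"
  have i1: "box_id 1 \<in> cubes ?I 1" by (simp add: std_cube_def box_map.ident)
  define r where "r n x = (n, 1::nat, x, box_id 1, box_id (Suc n))" for n and x :: 'a
  have rin: "r n x \<in> geom_reps X ?I (Suc n)" if "x \<in> cubes X n" for n x
    using that i1 box_map.ident[of "Suc n"] by (simp add: r_def geom_reps_def)
  define K where "K n x = H (Suc n) (?cls (Suc n) (r n x))" for n x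
  have cin: "?cls n s \<in> cubes (geom_prod X ?I) n" if "s \<in> geom_reps X ?I n" for n s
    using that by (auto simp: geom_prod_def intro: quotientI)
  have act: "app (geom_prod X ?I) m (Suc n) \<psi> (?cls (Suc n) (r n x)) = ?cls m (n, 1, x, box_id 1, restrict \<psi> (vertices m))"
    if x: "x \<in> cubes X n" and \<psi>: "bm m (Suc n) \<psi>" for m n x \<psi>
  proof -
    have "restrict (box_id (Suc n) \<circ> \<psi>) (vertices m) = restrict \<psi> (vertices m)"
      by (rule restrict_vertices_eqI) (simp add: box_id_def bm_length[OF \<psi>])
    then show ?thesis using geom_prod_app[OF X cI \<psi> rin[OF x, unfolded r_def]] by (simp only: r_def)
  qed
  have Happ: "app Y m (Suc n) \<psi> (K n x) = H m (?cls m (n, 1, x, box_id 1, restrict \<psi> (vertices m)))"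
    if x: "x \<in> cubes X n" and \<psi>: "bm m (Suc n) \<psi>" for m n x \<psi>
    unfolding K_def cubical_map_app[OF H \<psi> cin[OF rin[OF x]], symmetric] act[OF x \<psi>] ..
  have "natural_homotopy X Y K ?h"
    unfolding natural_homotopy_def
  proof (intro conjI allI impI ballI)
    fix n x assume x: "x \<in> cubes X n"
    show "K n x \<in> cubes Y (Suc n)" unfolding K_def by (rule cubical_map_in[OF H cin[OF rin[OF x]]])
    fix \<epsilon>
    have y: "app ?I 0 1 (fc 0 \<epsilon>) (box_id 1) = face 1 1 \<epsilon>"
      using face_eq[of 0 0 \<epsilon>] by (auto simp: app_def std_cube_def compose_def box_id_def fun_eq_iff)
    have x': "app X n n id x = x" by (rule app_ident[OF X _ x]) simp
    have "((n, 0, app X n n id x, app ?I 0 1 (fc 0 \<epsilon>) (box_id 1), box_id n), (n, 1, x, box_id 1, restrict (fc n \<epsilon>) (vertices n)))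
        \<in> geom_rel X ?I n"
      by (rule geom_rel_step[OF X cI bm_id(1) _ x i1])
        (use bm_fc[of 0 0 \<epsilon>] box_map.ident[of n] in \<open>auto simp: fc_def box_id_def intro!: restrict_vertices_eqI\<close>)
    then have "?cls n (n, 0, x, face 1 1 \<epsilon>, box_id n) = ?cls n (n, 1, x, box_id 1, restrict (fc n \<epsilon>) (vertices n))"
      unfolding x' y by (rule equiv_class_eq[OF eq])
    then show "fac Y n n \<epsilon> (K n x) = ?h \<epsilon> n x"
      using ends[OF x, of \<epsilon>] Happ[OF x bm_fc[of n n \<epsilon>]] by (simp add: end_incl_def fac_def)
  next
    fix m n \<phi> x assume \<phi>: "bm m n \<phi>" and x: "x \<in> cubes X n"
    have y: "app ?I 1 1 id (box_id 1) = box_id 1" by (rule app_ident[OF cI _ i1]) simp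
    have bm1: "bm (Suc m) (Suc n) (rwhisk m \<phi>)" using bm_rwhisk[OF \<phi>, of "Suc 0"] by simp
    have "((m, 1, app X m n \<phi> x, app ?I 1 1 id (box_id 1), box_id (Suc m)), (n, 1, x, box_id 1, restrict (rwhisk m \<phi>) (vertices (Suc m))))
        \<in> geom_rel X ?I (Suc m)"
      by (rule geom_rel_step[OF X cI \<phi> _ x i1])
        (use box_map.ident[of "Suc m"] in \<open>auto simp: rwhisk_def box_id_def intro!: restrict_vertices_eqI\<close>)
    then have "?cls (Suc m) (r m (app X m n \<phi> x)) = ?cls (Suc m) (n, 1, x, box_id 1, restrict (rwhisk m \<phi>) (vertices (Suc m)))"
      unfolding y r_def by (rule equiv_class_eq[OF eq])
    then show "K m (app X m n \<phi> x) = app Y (Suc m) (Suc n) (rwhisk m \<phi>) (K n x)"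
      unfolding Happ[OF x bm1] by (simp add: K_def)
  qed
  then show ?thesis using that by blast
qed

text \<open>The mapping path object of \<open>f\<close>; its evaluation at the free end is a trivial fibration if \<open>weq X Y f\<close>.\<close>

definition mpath :: "'a cubical \<Rightarrow> 'b cubical \<Rightarrow> (nat \<Rightarrow> 'a \<Rightarrow> 'b) \<Rightarrow> ('a \<times> 'b) cubical" where
  "mpath X Y f = \<lparr>cubes = (\<lambda>n. {(x, k). x \<in> cubes X n \<and> k \<in> cubes Y (Suc n) \<and> fac Y n n False k = f n x}),
     act = (\<lambda>m n \<phi> (x, k). (act X m n \<phi> x, app Y (Suc m) (Suc n) (rwhisk m \<phi>) k))\<rparr>"

lemma mpath_cubes: "(x, k) \<in> cubes (mpath X Y f) n \<longleftrightarrow> x \<in> cubes X n \<and> k \<in> cubes Y (Suc n) \<and> fac Y n n False k = f n x"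
  by (simp add: mpath_def)

lemma mpath_app: "app (mpath X Y f) m n \<phi> (x, k) = (app X m n \<phi> x, app Y (Suc m) (Suc n) (rwhisk m \<phi>) k)"
proof -
  have "length (take m v) = m" if "length v = Suc m" for v :: "bool list" using that by simp
  then have "app Y (Suc m) (Suc n) (rwhisk m (restrict \<phi> (vertices m))) = app Y (Suc m) (Suc n) (rwhisk m \<phi>)"
    by (intro app_cong) (simp add: rwhisk_def)
  then show ?thesis unfolding app_def[of "mpath X Y f"] app_def[of X] by (simp add: mpath_def)
qed

lemma fac_last_rwhisk:
  assumes Y: "cubical_set Y" and \<phi>: "bm m n \<phi>" and k: "k \<in> cubes Y (Suc n)"
  shows "fac Y m m \<epsilon> (app Y (Suc m) (Suc n) (rwhisk m \<phi>) k) = app Y m n \<phi> (fac Y n n \<epsilon> k)"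
  unfolding fac_def
proof (rule app_app_eq[OF Y])
  show "bm (Suc m) (Suc n) (rwhisk m \<phi>)" using bm_rwhisk[OF \<phi>, of "Suc 0"] by simp
  show "rwhisk m \<phi> (fc m \<epsilon> v) = fc n \<epsilon> (\<phi> v)" if "length v = m" for v
    using that bm_length[OF \<phi> that] by (simp add: rwhisk_def fc_def)
qed (use \<phi> k in auto)

lemma cubical_set_mpath:
  assumes X: "cubical_set X" and Y: "cubical_set Y" and f: "cubical_map X Y f"
  shows "cubical_set (mpath X Y f)"
proof (rule cubical_setI)
  fix m n \<phi> t assume \<phi>: "bm m n \<phi>" and t: "t \<in> cubes (mpath X Y f) n"
  obtain x k where xk: "t = (x, k)" by (cases t)
  have bm1: "bm (Suc m) (Suc n) (rwhisk m \<phi>)" using bm_rwhisk[OF \<phi>, of "Suc 0"] by simp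
  show "app (mpath X Y f) m n \<phi> t \<in> cubes (mpath X Y f) m"
    using t X Y bm1 \<phi> cubical_map_app[OF f \<phi>] fac_last_rwhisk[OF Y \<phi>] by (simp add: xk mpath_cubes mpath_app)
next
  fix n t assume "t \<in> cubes (mpath X Y f) n"
  moreover obtain x k where xk: "t = (x, k)" by (cases t)
  ultimately show "app (mpath X Y f) n n id t = t"
    using app_ident[OF X, of n id x] app_ident[OF Y, of "Suc n" "rwhisk n id" k] by (simp add: mpath_cubes mpath_app rwhisk_def)
next
  fix l m n \<psi> \<phi> t assume *: "bm l m \<psi>" "bm m n \<phi>" and t: "t \<in> cubes (mpath X Y f) n"
  obtain x k where xk: "t = (x, k)" by (cases t)
  have bm1: "bm (Suc m) (Suc n) (rwhisk m \<phi>)" "bm (Suc l) (Suc m) (rwhisk l \<psi>)"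
    using bm_rwhisk[OF *(1), of "Suc 0"] bm_rwhisk[OF *(2), of "Suc 0"] by simp_all
  have "app Y (Suc l) (Suc m) (rwhisk l \<psi>) (app Y (Suc m) (Suc n) (rwhisk m \<phi>) k) = app Y (Suc l) (Suc n) (rwhisk l (\<phi> \<circ> \<psi>)) k"
    by (rule app_app_eq1[OF Y bm1(2,1)]) (use t xk in \<open>auto simp: mpath_cubes rwhisk_def bm_length[OF *(1)]\<close>)
  then show "app (mpath X Y f) l n (\<phi> \<circ> \<psi>) t = app (mpath X Y f) l m \<psi> (app (mpath X Y f) m n \<phi> t)"
    using t app_app[OF X *] by (simp add: xk mpath_cubes mpath_app)
qed

lemma weq_section:
  assumes X: "akan X" and Y: "akan Y" and f: "cubical_map X Y f" and W: "weq X Y f"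
  obtains g K where "cubical_map Y X g" "natural_homotopy Y Y K (\<lambda>\<epsilon>. if \<epsilon> then (\<lambda>n. id) else (\<lambda>n. f n \<circ> g n))"
proof -
  note cX = akan_cubical[OF X] and cY = akan_cubical[OF Y]
  let ?T = "mpath X Y f"
  define p where "p n t = fac Y n n True (snd t)" for n and t :: "'a \<times> 'b"
  have T: "cubical_set ?T" by (rule cubical_set_mpath[OF cX cY f])
  have p: "cubical_map ?T Y p"
    by (rule cubical_mapI) (use cY in \<open>auto simp: p_def mpath_cubes mpath_app fac_last_rwhisk[OF cY]\<close>)
  have rwfc: "app Y (Suc n) (Suc (Suc n)) (rwhisk n (fc j \<eta>)) = app Y (Suc n) (Suc (Suc n)) (fc j \<eta>)" if "j \<le> n" for n j \<eta>
    by (rule app_cong) (use that in \<open>simp add: rwhisk_def fc_def min_absorb1 drop_take_append\<close>)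
  have facT: "fac ?T n j \<eta> t = (fac X n j \<eta> (fst t), fac Y (Suc n) j \<eta> (snd t))" if "j \<le> n" for n j \<eta> t
    using rwfc[OF that] by (cases t) (simp add: fac_def mpath_app)
  \<comment> \<open>The paths prescribed on the boundary are extended so as to end at y. Their
    starting cube is a lifting problem for f, and the solution is attached to that start by
    \<open>rh_paste\<close>, which changes neither the sides nor the end.\<close>
  have lift: "\<exists>t\<in>cubes ?T n. (\<forall>j<n. \<forall>\<eta>. fac ?T (n - 1) j \<eta> t = u j \<eta>) \<and> p n t = y"
    if y: "y \<in> cubes Y n" and u: "fam ?T n (n - 1) u" and pu: "\<And>j \<eta>. j < n \<Longrightarrow> p (n - 1) (u j \<eta>) = fac Y (n - 1) j \<eta> y" for n y u
  proof -
    define ux where "ux j \<eta> = fst (u j \<eta>)" for j \<eta>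
    define uk where "uk j \<eta> = snd (u j \<eta>)" for j \<eta>
    have uin: "ux j \<eta> \<in> cubes X (n - 1)" "uk j \<eta> \<in> cubes Y n" "fac Y (n - 1) (n - 1) False (uk j \<eta>) = f (n - 1) (ux j \<eta>)"
      if "j < n" for j \<eta>
      using fam_in[OF u that, of \<eta>] that by (cases "u j \<eta>"; simp add: ux_def uk_def mpath_cubes)+
    have comp: "fac X (n - 1 - 1) i \<epsilon> (ux j \<eta>) = fac X (n - 1 - 1) (j - 1) \<eta> (ux i \<epsilon>)"
      "fac Y (n - 1) i \<epsilon> (uk j \<eta>) = fac Y (n - 1) (j - 1) \<eta> (uk i \<epsilon>)" if "j < n" "i < j" for i j \<epsilon> \<eta>
    proof -
      have n: "Suc (n - 1 - 1) = n - 1" "i \<le> n - 1 - 1" "j - 1 \<le> n - 1 - 1" using that by auto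
      show "fac X (n - 1 - 1) i \<epsilon> (ux j \<eta>) = fac X (n - 1 - 1) (j - 1) \<eta> (ux i \<epsilon>)"
        "fac Y (n - 1) i \<epsilon> (uk j \<eta>) = fac Y (n - 1) (j - 1) \<eta> (uk i \<epsilon>)"
        using fam_fac[OF u that, of \<epsilon> \<eta>] unfolding facT[OF n(2)] facT[OF n(3)] n(1) by (auto simp: ux_def uk_def)
    qed
    have fux: "fam X n (n - 1) ux" by (rule famI) (use uin comp in auto)
    have fuk: "fam Y n n uk" by (rule famI) (use uin comp in auto)
    obtain Q where Q: "Q \<in> cubes Y (Suc n)" "fac Y n n True Q = y" "\<And>j \<eta>. j < n \<Longrightarrow> fac Y n j \<eta> Q = uk j \<eta>"
      "\<And>j \<eta>. j < n \<Longrightarrow> fac Y (n - 1) j \<eta> (fac Y n n (\<not> True) Q) = fend Y n (\<not> True) uk j \<eta>"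
      by (rule homotopy_extension[OF Y fuk y, of True]) (use pu in \<open>auto simp: fend_def p_def uk_def\<close>)
    have "lift_problem X Y f n ux (fac Y n n False Q)"
      unfolding lift_problem_def using fux Q cY uin by (auto simp: fend_def)
    then obtain v where v: "v \<in> cubes X n" "\<And>j \<eta>. j < n \<Longrightarrow> fac X (n - 1) j \<eta> v = ux j \<eta>"
      and r: "rh Y n (f n v) (fac Y n n False Q)"
      using W unfolding weq_def lift_solution_def by blast
    obtain P where P: "P \<in> cubes Y (Suc n)" "fac Y n n False P = f n v" "fac Y n n True P = fac Y n n True Q"
      "\<And>j \<eta>. j < n \<Longrightarrow> fac Y n j \<eta> P = fac Y n j \<eta> Q"
      using rh_paste[OF Y Q(1) r] by blast
    have "fac ?T (n - 1) j \<eta> (v, P) = u j \<eta>" if "j < n" for j \<eta>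
    proof -
      have n: "j \<le> n - 1" "Suc (n - 1) = n" using that by auto
      show ?thesis using v(2)[OF that] P(4)[OF that] Q(3)[OF that] unfolding facT[OF n(1)] n(2) by (simp add: ux_def uk_def)
    qed
    moreover have "(v, P) \<in> cubes ?T n" "p n (v, P) = y" using v P Q by (auto simp: mpath_cubes p_def)
    ultimately show ?thesis by blast
  qed
  obtain s where s: "cubical_map Y ?T s" "\<And>n y. y \<in> cubes Y n \<Longrightarrow> p n (s n y) = y"
    using trivial_fibration_section[OF T cY p lift] by blast
  let ?g = "\<lambda>n y. fst (s n y)" and ?K = "\<lambda>n y. snd (s n y)"
  have sin: "?g n y \<in> cubes X n" "?K n y \<in> cubes Y (Suc n)" "fac Y n n False (?K n y) = f n (?g n y)" if "y \<in> cubes Y n" for n y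
    using cubical_map_in[OF s(1) that] by (cases "s n y"; simp add: mpath_cubes)+
  have sapp: "?g m (app Y m n \<phi> y) = app X m n \<phi> (?g n y)" "?K m (app Y m n \<phi> y) = app Y (Suc m) (Suc n) (rwhisk m \<phi>) (?K n y)"
    if "bm m n \<phi>" "y \<in> cubes Y n" for m n \<phi> y
    using cubical_map_app[OF s(1) that] by (cases "s n y"; simp add: mpath_app)+
  have "cubical_map Y X ?g" by (rule cubical_mapI) (use sin sapp in auto)
  moreover have "natural_homotopy Y Y ?K (\<lambda>\<epsilon>. if \<epsilon> then (\<lambda>n. id) else (\<lambda>n. f n \<circ> ?g n))"
    unfolding natural_homotopy_def using sin sapp s(2) by (auto simp: p_def)
  ultimately show ?thesis using that by blast
qed

lemma natural_homotopy_pre: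
  "natural_homotopy Y Z K h \<Longrightarrow> cubical_map X Y g \<Longrightarrow> natural_homotopy X Z (\<lambda>n. K n \<circ> g n) (\<lambda>\<epsilon> n. h \<epsilon> n \<circ> g n)"
  unfolding natural_homotopy_def by (auto simp: cubical_map_in cubical_map_app)

lemma natural_homotopy_post:
  assumes K: "natural_homotopy X Y K h" and g: "cubical_map Y Z g"
  shows "natural_homotopy X Z (\<lambda>n. g (Suc n) \<circ> K n) (\<lambda>\<epsilon> n. g n \<circ> h \<epsilon> n)"
  unfolding natural_homotopy_def
proof (intro conjI allI impI ballI)
  fix n x assume x: "x \<in> cubes X n"
  then have Kx: "K n x \<in> cubes Y (Suc n)" "fac Y n n \<epsilon> (K n x) = h \<epsilon> n x" for \<epsilon> using K by (auto simp: natural_homotopy_def)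
  show "(g (Suc n) \<circ> K n) x \<in> cubes Z (Suc n)" using cubical_map_in[OF g Kx(1)] by simp
  show "fac Z n n \<epsilon> ((g (Suc n) \<circ> K n) x) = (g n \<circ> h \<epsilon> n) x" for \<epsilon>
    using map_fac[OF g, of n n "K n x" \<epsilon>] Kx by simp
next
  fix m n \<phi> x assume \<phi>: "bm m n \<phi>" and x: "x \<in> cubes X n"
  have Kx: "K n x \<in> cubes Y (Suc n)" "K m (app X m n \<phi> x) = app Y (Suc m) (Suc n) (rwhisk m \<phi>) (K n x)"
    using K \<phi> x by (auto simp: natural_homotopy_def)
  have bm1: "bm (Suc m) (Suc n) (rwhisk m \<phi>)" using bm_rwhisk[OF \<phi>, of "Suc 0"] by simp
  show "(g (Suc m) \<circ> K m) (app X m n \<phi> x) = app Z (Suc m) (Suc n) (rwhisk m \<phi>) ((g (Suc n) \<circ> K n) x)"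
    using cubical_map_app[OF g bm1 Kx(1)] Kx(2) by simp
qed

section \<open>Weak equivalences are the homotopy equivalences\<close>

lemma weq_elementary:
  assumes X: "akan X" and Y: "akan Y" and h: "elementary_homotopic X Y f g"
  shows "weq X Y f \<longleftrightarrow> weq X Y g"
proof -
  let ?h = "\<lambda>\<epsilon>. if \<epsilon> then g else f"
  obtain K where K: "natural_homotopy X Y K ?h"
    using elementary_homotopicE[OF akan_cubical[OF X] akan_cubical[OF Y] h] .
  have m: "cubical_map X Y (?h \<epsilon>)" for \<epsilon> using h by (simp add: elementary_homotopic_def)
  show ?thesis
    using weq_homotopic[OF X Y m K, of False] weq_homotopic[OF X Y m K, of True] by auto
qed

lemma weq_homotopic_iff:
  assumes X: "akan X" and Y: "akan Y" and h: "homotopic X Y f g"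
  shows "weq X Y f \<longleftrightarrow> weq X Y g"
  using h unfolding homotopic_def
  by (induction rule: equivclp_induct) (auto dest: weq_elementary[OF X Y])

text \<open>Cancellation applies to g f once g has fillers. Applying f to the target cube turns a
  problem for g into one for f g with the same boundary, and f g is a weak equivalence.\<close>

lemma homotopy_equivalence_weq:
  assumes X: "akan X" and Y: "akan Y" and h: "homotopy_equivalence X Y f"
  shows "weq X Y f"
proof -
  obtain g where f: "cubical_map X Y f" and g: "cubical_map Y X g"
    and gf: "homotopic X X (\<lambda>n. g n \<circ> f n) (\<lambda>n. id)" and fg: "homotopic Y Y (\<lambda>n. f n \<circ> g n) (\<lambda>n. id)"
    using h unfolding homotopy_equivalence_def by blast
  have Wgf: "weq X X (\<lambda>n. g n \<circ> f n)"
    using weq_homotopic_iff[OF X X gf] weq_id[OF akan_cubical[OF X]] by blast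
  have Wfg: "weq Y Y (\<lambda>n. f n \<circ> g n)"
    using weq_homotopic_iff[OF Y Y fg] weq_id[OF akan_cubical[OF Y]] by blast
  show ?thesis
  proof (rule weq_cancel[OF X Y X f g Wgf])
    fix n u w assume P: "lift_problem Y X g n u w"
    have "fac Y (n - 1) j \<eta> (f n w) = (f (n - 1) \<circ> g (n - 1)) (u j \<eta>)" if "j < n" for j \<eta>
      using map_fac[OF f, of j "n - 1" w \<eta>] P that by (auto simp: lift_problem_def)
    then have "lift_problem Y Y (\<lambda>n. f n \<circ> g n) n u (f n w)"
      using P cubical_map_in[OF f] by (auto simp: lift_problem_def)
    from weq_fill[OF Wfg this] show "\<exists>v\<in>cubes Y n. \<forall>j<n. \<forall>\<eta>. fac Y (n - 1) j \<eta> v = u j \<eta>" .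
  qed
qed

text \<open>The section construction gives g with f g homotopic to the identity; applied to g it
  gives f' with g f' homotopic to the identity. Then g f is joined through g f g f' to g f', hence
  to the identity. Both homotopies on the composite start at it, so the first is traversed
  backwards.\<close>

lemma weq_homotopy_equivalence:
  assumes X: "akan X" and Y: "akan Y" and f: "cubical_map X Y f" and W: "weq X Y f"
  shows "homotopy_equivalence X Y f"
proof -
  note cX = akan_cubical[OF X] and cY = akan_cubical[OF Y]
  obtain g K where g: "cubical_map Y X g" and K: "natural_homotopy Y Y K (\<lambda>\<epsilon>. if \<epsilon> then (\<lambda>n. id) else (\<lambda>n. f n \<circ> g n))"
    using weq_section[OF X Y f W] .
  have fg: "elementary_homotopic Y Y (\<lambda>n. f n \<circ> g n) (\<lambda>n. id)"
    by (rule natural_homotopy_elementary[OF cY cY cubical_map_comp[OF g f] cubical_map_id K])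
  have Wfg: "weq Y Y (\<lambda>n. f n \<circ> g n)" using weq_elementary[OF Y Y fg] weq_id[OF cY] by blast
  have Wg: "weq Y X g" by (rule weq_cancel[OF Y X Y g f Wfg weq_fill[OF W]])
  obtain f' L where f': "cubical_map X Y f'" and L: "natural_homotopy X X L (\<lambda>\<epsilon>. if \<epsilon> then (\<lambda>n. id) else (\<lambda>n. g n \<circ> f' n))"
    using weq_section[OF Y X g Wg] .
  have gf': "elementary_homotopic X X (\<lambda>n. g n \<circ> f' n) (\<lambda>n. id)"
    by (rule natural_homotopy_elementary[OF cX cX cubical_map_comp[OF f' g] cubical_map_id L])
  let ?a = "\<lambda>n. g n \<circ> f n" and ?b = "\<lambda>n. g n \<circ> f n \<circ> g n \<circ> f' n" and ?c = "\<lambda>n. g n \<circ> f' n"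
  note gf = cubical_map_comp[OF f g]
  have mb: "cubical_map X X ?b" using cubical_map_comp[OF cubical_map_comp[OF f' g] gf] by (simp add: comp_assoc)
  have "natural_homotopy X X (\<lambda>n. (g (Suc n) \<circ> f (Suc n)) \<circ> L n) (\<lambda>\<epsilon>. if \<epsilon> then ?a else ?b)"
    using natural_homotopy_post[OF L gf] by (auto simp: natural_homotopy_def)
  then have ba: "elementary_homotopic X X ?b ?a"
    by (rule natural_homotopy_elementary[OF cX cX mb gf])
  have "natural_homotopy X X (\<lambda>n. g (Suc n) \<circ> (K n \<circ> f' n)) (\<lambda>\<epsilon>. if \<epsilon> then ?c else ?b)"
    using natural_homotopy_post[OF natural_homotopy_pre[OF K f'] g] by (auto simp: natural_homotopy_def)
  then have bc: "elementary_homotopic X X ?b ?c"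
    by (rule natural_homotopy_elementary[OF cX cX mb cubical_map_comp[OF f' g]])
  have "homotopic X X ?a (\<lambda>n. id)"
    unfolding homotopic_def
  proof (rule equivclp_trans)
    show "equivclp (elementary_homotopic X X) ?a ?b" by (rule converse_r_into_equivclp) (rule ba)
    show "equivclp (elementary_homotopic X X) ?b (\<lambda>n. id)"
      by (rule equivclp_into_equivclp[where b = ?c]) (use bc gf' in auto)
  qed
  moreover have "homotopic Y Y (\<lambda>n. f n \<circ> g n) (\<lambda>n. id)" unfolding homotopic_def by (rule r_into_equivclp) (rule fg)
  ultimately show ?thesis unfolding homotopy_equivalence_def using f g by blast
qed

theorem theorem4p7:
  fixes X :: "'a cubical" and Y :: "'b cubical" and f :: "nat \<Rightarrow> 'a \<Rightarrow> 'b"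
  assumes "kan_complex X" and "kan_complex Y" and "cubical_map X Y f"
  shows "homotopy_equivalence X Y f \<longleftrightarrow>
    bij_betw (pi0_map Y f) (pi0 X) (pi0 Y) \<and>
    (\<forall>x\<in>cubes X 0. \<forall>n\<ge>1. pi_map n (Y, f 0 x) f \<in> iso (pi_group n (X, x)) (pi_group n (Y, f 0 x)))"
proof -
  note X = kan_akan[OF assms(1)] and Y = kan_akan[OF assms(2)] and f = assms(3)
  have "homotopy_equivalence X Y f \<longleftrightarrow> weq X Y f"
    using homotopy_equivalence_weq[OF X Y] weq_homotopy_equivalence[OF X Y f] by blast
  also have "\<dots> \<longleftrightarrow> bij_betw (pi0_map Y f) (pi0 X) (pi0 Y) \<and>
    (\<forall>x\<in>cubes X 0. \<forall>n\<ge>1. bij_betw (pi_map n (Y, f 0 x) f) (pi_set n (X, x)) (pi_set n (Y, f 0 x)))"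
    using weq_pi[OF X Y f] pi_weq[OF X Y f] by blast
  finally show ?thesis using pi_iso_iff[OF X Y f] by simp
qed

end
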